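(* There exists a function $g:\mathbb R^+\to\mathbb R^+$ with the following property. If $\phi\in W^{1,1}(\mathbb S^1,\mathbb S^1)$ then there exists $u\in W^{1,(2,\infty)}(D^2,\mathbb S^1)$ with $u|_{\partial D^2}=\phi$ in the sense of traces and $$\|u\|_{W^{1,(2,\infty)}(D^2,\mathbb S^1)}\leq g\left(\|\phi\|_{W^{1,1}(\mathbb S^1,\mathbb S^1)}\right).$$
   Context: $\mathbb R^+=[0,\infty)$; $D^2$ is the unit disk of $\mathbb R^2$ and $\mathbb S^1=\partial D^2$. Sobolev maps into $\mathbb S^1$ are maps into $\mathbb R^{2}$ of the given Sobolev class with values in $\mathbb S^1$ almost everywhere. $L^{p,\infty}$ is the weak-$L^p$ space, with $\|f\|_{L^{p,\infty}}^p:=\sup_{\lambda>0}\lambda^p|\{x:|f(x)|>\lambda\}|$; $W^{1,(p,\infty)}$ is the space of weakly differentiable functions with $f,\nabla f\in L^{p,\infty}$, with $\|f\|_{W^{1,(p,\infty)}}=\|f\|_{L^{p,\infty}}+\|\nabla f\|_{L^{p,\infty}}$. *)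

theory Defs
  imports "HOL-Analysis.Analysis"
begin

section \<open>Smooth functions and test functions\<close>

primrec C_diff :: "nat \<Rightarrow> ('a::real_normed_vector \<Rightarrow> 'b::real_normed_vector) \<Rightarrow> bool" where
  "C_diff 0 f \<longleftrightarrow> continuous_on UNIV f"
| "C_diff (Suc k) f \<longleftrightarrow>
     (\<forall>x. f differentiable (at x)) \<and> (\<forall>v. C_diff k (\<lambda>x. frechet_derivative f (at x) v))"

definition smooth :: "('a::real_normed_vector \<Rightarrow> 'b::real_normed_vector) \<Rightarrow> bool" where
  "smooth f \<longleftrightarrow> (\<forall>k. C_diff k f)"

definition test_function :: "'a::euclidean_space set \<Rightarrow> ('a \<Rightarrow> real) \<Rightarrow> bool" where
  "test_function \<Omega> \<eta> \<longleftrightarrow>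
     smooth \<eta> \<and> compact (closure {x. \<eta> x \<noteq> 0}) \<and> closure {x. \<eta> x \<noteq> 0} \<subseteq> \<Omega>"


section \<open>Weak derivatives on open sets\<close>

definition locally_integrable ::
    "'a::euclidean_space set \<Rightarrow> ('a \<Rightarrow> 'b::euclidean_space) \<Rightarrow> bool" where
  "locally_integrable \<Omega> f \<longleftrightarrow> (\<forall>K. compact K \<and> K \<subseteq> \<Omega> \<longrightarrow> integrable (lebesgue_on K) f)"

definition has_weak_partial ::
    "'a::euclidean_space set \<Rightarrow> 'a \<Rightarrow> ('a \<Rightarrow> 'b::euclidean_space) \<Rightarrow> ('a \<Rightarrow> 'b) \<Rightarrow> bool" where
  "has_weak_partial \<Omega> b f g \<longleftrightarrow>
     locally_integrable \<Omega> f \<and> locally_integrable \<Omega> g \<and>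
     (\<forall>\<eta>. test_function \<Omega> \<eta> \<longrightarrow>
        (LINT x|lebesgue_on \<Omega>. frechet_derivative \<eta> (at x) b *\<^sub>R f x)
          = - (LINT x|lebesgue_on \<Omega>. \<eta> x *\<^sub>R g x))"

definition weakly_differentiable ::
    "'a::euclidean_space set \<Rightarrow> ('a \<Rightarrow> 'b::euclidean_space) \<Rightarrow> bool" where
  "weakly_differentiable \<Omega> f \<longleftrightarrow> (\<forall>b\<in>Basis. \<exists>g. has_weak_partial \<Omega> b f g)"

text \<open>On an open set a weak partial derivative is unique up to a null set, so the choice of
  representative below affects none of the norms.\<close>

definition weak_partial ::
    "'a::euclidean_space set \<Rightarrow> 'a \<Rightarrow> ('a \<Rightarrow> 'b::euclidean_space) \<Rightarrow> 'a \<Rightarrow> 'b" where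
  "weak_partial \<Omega> b f = (SOME g. has_weak_partial \<Omega> b f g)"

text \<open>The pointwise Euclidean (Frobenius) length of the weak gradient.\<close>

definition weak_grad_norm ::
    "'a::euclidean_space set \<Rightarrow> ('a \<Rightarrow> 'b::euclidean_space) \<Rightarrow> 'a \<Rightarrow> real" where
  "weak_grad_norm \<Omega> f x = sqrt (\<Sum>b\<in>Basis. (norm (weak_partial \<Omega> b f x))\<^sup>2)"


section \<open>Weak Lebesgue spaces and Sobolev spaces on open sets\<close>

definition weak_Lp_sup ::
    "real \<Rightarrow> 'a::euclidean_space set \<Rightarrow> ('a \<Rightarrow> 'b::euclidean_space) \<Rightarrow> ennreal" where
  "weak_Lp_sup p \<Omega> f =
     (SUP t\<in>{0<..}. ennreal (t powr p) * emeasure (lebesgue_on \<Omega>) {x \<in> \<Omega>. t < norm (f x)})"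

definition weak_Lp ::
    "real \<Rightarrow> 'a::euclidean_space set \<Rightarrow> ('a \<Rightarrow> 'b::euclidean_space) set" where
  "weak_Lp p \<Omega> = {f. f \<in> borel_measurable (lebesgue_on \<Omega>) \<and> weak_Lp_sup p \<Omega> f < \<infinity>}"

definition weak_Lp_norm ::
    "real \<Rightarrow> 'a::euclidean_space set \<Rightarrow> ('a \<Rightarrow> 'b::euclidean_space) \<Rightarrow> real" where
  "weak_Lp_norm p \<Omega> f = enn2real (weak_Lp_sup p \<Omega> f) powr (1 / p)"

definition W1_weak ::
    "real \<Rightarrow> 'a::euclidean_space set \<Rightarrow> ('a \<Rightarrow> 'b::euclidean_space) set" where
  "W1_weak p \<Omega> =
     {f. weakly_differentiable \<Omega> f \<and> f \<in> weak_Lp p \<Omega> \<and> weak_grad_norm \<Omega> f \<in> weak_Lp p \<Omega>}"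

definition W1_weak_norm ::
    "real \<Rightarrow> 'a::euclidean_space set \<Rightarrow> ('a \<Rightarrow> 'b::euclidean_space) \<Rightarrow> real" where
  "W1_weak_norm p \<Omega> f = weak_Lp_norm p \<Omega> f + weak_Lp_norm p \<Omega> (weak_grad_norm \<Omega> f)"

definition W11 :: "'a::euclidean_space set \<Rightarrow> ('a \<Rightarrow> 'b::euclidean_space) set" where
  "W11 \<Omega> =
     {f. weakly_differentiable \<Omega> f \<and> integrable (lebesgue_on \<Omega>) f \<and>
         integrable (lebesgue_on \<Omega>) (weak_grad_norm \<Omega> f)}"

definition W11_norm :: "'a::euclidean_space set \<Rightarrow> ('a \<Rightarrow> 'b::euclidean_space) \<Rightarrow> real" where
  "W11_norm \<Omega> f = (LINT x|lebesgue_on \<Omega>. norm (f x)) + (LINT x|lebesgue_on \<Omega>. weak_grad_norm \<Omega> f x)"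


section \<open>The unit disk and the unit circle\<close>

text \<open>The plane is the Euclidean space \<^typ>\<open>complex\<close>, whose norm, inner product, standard basis
  and Lebesgue measure are those of the real plane.  A function on the circle is a function on the
  plane of which only the values on \<^term>\<open>sphere (0::complex) 1\<close> matter; arc length is Lebesgue
  measure transported by the parametrization \<^const>\<open>cis\<close>.\<close>

abbreviation disk :: "complex set" where
  "disk \<equiv> ball 0 1"

abbreviation angles :: "real measure" where
  "angles \<equiv> lebesgue_on {0..2 * pi}"

text \<open>The weak tangential derivative; smooth functions on the circle are the smooth
  \<open>2 \<pi>\<close>-periodic functions of the angle.\<close>

definition has_weak_tangential ::
    "(complex \<Rightarrow> 'b::euclidean_space) \<Rightarrow> (complex \<Rightarrow> 'b) \<Rightarrow> bool" where
  "has_weak_tangential \<phi> \<psi> \<longleftrightarrow>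
     integrable angles (\<lambda>t. \<phi> (cis t)) \<and> integrable angles (\<lambda>t. \<psi> (cis t)) \<and>
     (\<forall>\<eta> :: real \<Rightarrow> real. smooth \<eta> \<and> (\<forall>t. \<eta> (t + 2 * pi) = \<eta> t) \<longrightarrow>
        (LINT t|angles. deriv \<eta> t *\<^sub>R \<phi> (cis t)) = - (LINT t|angles. \<eta> t *\<^sub>R \<psi> (cis t)))"

definition weak_tangential ::
    "(complex \<Rightarrow> 'b::euclidean_space) \<Rightarrow> complex \<Rightarrow> 'b" where
  "weak_tangential \<phi> = (SOME \<psi>. has_weak_tangential \<phi> \<psi>)"

definition W11_circle :: "(complex \<Rightarrow> 'b::euclidean_space) set" where
  "W11_circle = {\<phi>. \<exists>\<psi>. has_weak_tangential \<phi> \<psi>}"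

definition W11_circle_norm :: "(complex \<Rightarrow> 'b::euclidean_space) \<Rightarrow> real" where
  "W11_circle_norm \<phi> =
     (LINT t|angles. norm (\<phi> (cis t))) + (LINT t|angles. norm (weak_tangential \<phi> (cis t)))"

definition W11_circle_S1 :: "(complex \<Rightarrow> complex) set" where
  "W11_circle_S1 = {\<phi> \<in> W11_circle. AE t in angles. \<phi> (cis t) \<in> sphere 0 1}"

definition W1_weak_disk_S1 :: "real \<Rightarrow> (complex \<Rightarrow> complex) set" where
  "W1_weak_disk_S1 p = {u \<in> W1_weak p disk. AE x in lebesgue_on disk. u x \<in> sphere 0 1}"

text \<open>The trace operator from \<open>W\<^sup>1\<^sup>,\<^sup>1\<close> of the disk to \<open>L\<^sup>1\<close> of the circle is the continuous extension
  of the restriction map, which is defined on the dense subspace of those \<open>W\<^sup>1\<^sup>,\<^sup>1\<close> functions that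
  are continuous up to the boundary.  It applies to \<open>W\<^sup>1\<^sup>,\<^sup>(\<^sup>p\<^sup>,\<^sup>\<infinity>\<^sup>)\<close> with \<open>p > 1\<close>, which is contained
  in \<open>W\<^sup>1\<^sup>,\<^sup>1\<close> because the disk has finite measure.\<close>

definition has_trace :: "(complex \<Rightarrow> 'b::euclidean_space) \<Rightarrow> (complex \<Rightarrow> 'b) \<Rightarrow> bool" where
  "has_trace u \<phi> \<longleftrightarrow>
     u \<in> W11 disk \<and> integrable angles (\<lambda>t. \<phi> (cis t)) \<and>
     (\<exists>U :: nat \<Rightarrow> complex \<Rightarrow> 'b.
        (\<forall>k. U k \<in> W11 disk \<and> continuous_on (cball 0 1) (U k)) \<and>
        (\<lambda>k. W11_norm disk (\<lambda>x. U k x - u x)) \<longlonglongrightarrow> 0 \<and>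
        (\<lambda>k. LINT t|angles. norm (U k (cis t) - \<phi> (cis t))) \<longlonglongrightarrow> 0)"

end

theory Submission
  imports Defs "HOL-Real_Asymp.Real_Asymp"
begin

text \<open>Write \<open>\<phi> (cis t) = \<phi>\<^sub>0 exp (\<i> F t)\<close> with \<open>F\<close> absolutely continuous, \<open>F' = f\<close> and
  \<open>F (2 * pi) - F 0 = 2 * pi * d\<close>.  The extension is \<open>u x = C (x / \<bar>x\<bar>)\<^sup>d exp (\<i> H x)\<close>, where \<open>H\<close> is the
  harmonic function \<open>H x = - (1 / pi) \<integral> f t Arg (1 - x cis (- t)) dt\<close>.  Its boundary values are
  \<open>F t - d t\<close> up to a constant, because \<open>t \<mapsto> Arg (1 - cis t)\<close> is a sawtooth with one jump of height
  \<open>pi\<close>.  Moreover \<open>\<bar>\<nabla>u\<bar> x = \<bar>d / x + (1 / pi) \<integral> f t / (cis t - x) dt\<bar>\<close> is a superposition of kernels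
  \<open>1 / \<bar>x - a\<bar>\<close>, and \<open>\<integral>\<^sub>E dx / \<bar>x - a\<bar> \<le> (1 + pi) \<bar>E\<bar>\<^sup>1\<^sup>/\<^sup>2\<close>; taking \<open>E = {\<bar>\<nabla>u\<bar> > \<lambda>}\<close> gives a
  weak \<open>L\<^sup>2\<close> bound that is linear in the norm of \<open>\<phi>\<close>.\<close>

section \<open>Smooth functions\<close>

text \<open>The kernel \<open>1 / norm (x - a)\<close> misses L^2 of the disk only by a logarithm,
  and it arises twice: from a boundary map of nonzero degree, and from \<open>f\<close>, which is
  controlled in L^1 only. Weak L^2 is therefore the right scale. Its quasinorm does not add up well
  over a continuum of kernels; integrals over a fixed set E do, so Tonelli's theorem is applied for
  arbitrary E before E becomes a superlevel set.

  With the argument kernel in place of the Poisson kernel, \<open>f\<close> and not \<open>F\<close>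
  stands under the integral: the kernel is bounded, so dominated convergence reaches the circle, and
  its derivative is the Cauchy kernel.

  Three obstacles shape the rest. Maps and weak derivatives are given up to null sets, so a
  continuous representative and uniqueness of weak partials have to be secured. \<open>F\<close>
  need not be differentiable at every angle, so the exponential form rests on increments instead of
  derivatives. The extension jumps at the origin unless \<open>d = 0\<close>, hence weak partials
  are computed along lines that miss the origin, and the trace goes through approximants damped
  there.\<close>

lemma C_diff_imp_continuous: "C_diff k f \<Longrightarrow> continuous_on UNIV f"
  by (cases k) (auto simp: continuous_on_eq_continuous_at differentiable_imp_continuous_within)

lemma C_diff_SucI:
  assumes "\<And>x. (f has_derivative f' x) (at x)" "\<And>v. C_diff k (\<lambda>x. f' x v)"
  shows "C_diff (Suc k) f"
proof -
  have "frechet_derivative f (at x) = f' x" for x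
    using assms(1) by (metis frechet_derivative_at)
  then show ?thesis using assms by (auto simp: differentiable_def)
qed

lemma C_diff_SucD: "C_diff (Suc k) f \<Longrightarrow> C_diff k f"
proof (induction k arbitrary: f)
  case 0
  then show ?case using C_diff_imp_continuous by (metis C_diff.simps(1))
next
  case (Suc k)
  have *: "C_diff (Suc k) (\<lambda>x. frechet_derivative f (at x) v)" for v
    using Suc.prems by (subst (asm) C_diff.simps(2)) blast
  have **: "f differentiable (at x)" for x using Suc.prems by simp
  show ?case unfolding C_diff.simps(2)[of k f] using * ** Suc.IH by blast
qed

lemma C_diff_const: "C_diff k (\<lambda>x. c)"
proof (induction k arbitrary: c)
  case (Suc k)
  show ?case by (rule C_diff_SucI[where f' = "\<lambda>x v. 0"]) (auto intro: Suc)
qed auto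

lemma C_diff_bounded_linear: "bounded_linear f \<Longrightarrow> C_diff k f"
proof (cases k)
  case 0
  assume "bounded_linear f"
  with 0 show ?thesis by (simp add: linear_continuous_on)
next
  case (Suc k)
  assume b: "bounded_linear f"
  show ?thesis unfolding Suc
    by (rule C_diff_SucI[where f' = "\<lambda>x v. f v"]) (auto intro: C_diff_const bounded_linear_imp_has_derivative b)
qed

lemma C_diff_add: "C_diff k f \<Longrightarrow> C_diff k g \<Longrightarrow> C_diff k (\<lambda>x. f x + g x)"
proof (induction k arbitrary: f g)
  case 0
  then show ?case by (auto intro: continuous_intros)
next
  case (Suc k)
  show ?case
  proof (rule C_diff_SucI)
    show "((\<lambda>x. f x + g x) has_derivative
        (\<lambda>v. frechet_derivative f (at x) v + frechet_derivative g (at x) v)) (at x)" for x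
      using Suc.prems by (auto intro!: derivative_eq_intros simp: frechet_derivative_works)
    show "C_diff k (\<lambda>x. frechet_derivative f (at x) v + frechet_derivative g (at x) v)" for v
      using Suc by simp
  qed
qed

lemma C_diff_mult:
  fixes f g :: "'a::real_normed_vector \<Rightarrow> real"
  shows "C_diff k f \<Longrightarrow> C_diff k g \<Longrightarrow> C_diff k (\<lambda>x. f x * g x)"
proof (induction k arbitrary: f g)
  case 0
  then show ?case by (auto intro: continuous_intros)
next
  case (Suc k)
  \<comment> \<open>The product rule leaves one factor undifferentiated in each summand, so order
    \<open>k\<close> of the factors themselves is needed next to order \<open>k\<close> of their
    derivatives.\<close>
  note l = C_diff_SucD[OF Suc.prems(1)] C_diff_SucD[OF Suc.prems(2)]
  show ?case
  proof (rule C_diff_SucI)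
    show "((\<lambda>x. f x * g x) has_derivative
        (\<lambda>v. f x * frechet_derivative g (at x) v + frechet_derivative f (at x) v * g x)) (at x)" for x
      using Suc.prems by (auto intro!: has_derivative_mult simp: frechet_derivative_works)
    show "C_diff k (\<lambda>x. f x * frechet_derivative g (at x) v + frechet_derivative f (at x) v * g x)" for v
      using Suc.prems by (intro C_diff_add Suc.IH l) auto
  qed
qed

lemma C_diff_compose_real:
  fixes f :: "'a::real_normed_vector \<Rightarrow> real" and g :: "real \<Rightarrow> real"
  shows "C_diff k g \<Longrightarrow> C_diff k f \<Longrightarrow> C_diff k (\<lambda>x. g (f x))"
proof (induction k arbitrary: g)
  case 0
  then show ?case by (auto intro: continuous_on_compose2)
next
  case (Suc k)
  note l = C_diff_SucD[OF Suc.prems(2)]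
  show ?case
  proof (rule C_diff_SucI)
    fix x
    have D: "((\<lambda>x. g (f x)) has_derivative
        (\<lambda>v. frechet_derivative g (at (f x)) (frechet_derivative f (at x) v))) (at x)"
      by (rule has_derivative_compose[of f]) (use Suc.prems in \<open>auto simp: frechet_derivative_works\<close>)
    \<comment> \<open>A linear map of the real line is multiplication by its value at 1. This turns
      the chain rule into a product, and the induction hypothesis applies to the derivative of
      \<open>g\<close> in place of \<open>g\<close>.\<close>
    have lin: "frechet_derivative g (at y) h = frechet_derivative g (at y) 1 * h" for y h
    proof -
      have "g differentiable (at y)" using Suc.prems(1) by simp
      then have "linear (frechet_derivative g (at y))" by (rule linear_frechet_derivative)
      from linear_scale[OF this, of h 1] show ?thesis by (simp add: mult.commute)
    qed
    show "((\<lambda>x. g (f x)) has_derivative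
        (\<lambda>v. frechet_derivative g (at (f x)) 1 * frechet_derivative f (at x) v)) (at x)"
      by (rule has_derivative_eq_rhs[OF D]) (rule ext, rule lin)
  next
    fix v
    show "C_diff k (\<lambda>x. frechet_derivative g (at (f x)) 1 * frechet_derivative f (at x) v)"
    proof (rule C_diff_mult)
      show "C_diff k (\<lambda>x. frechet_derivative g (at (f x)) 1)"
        by (rule Suc.IH[of "\<lambda>y. frechet_derivative g (at y) 1", OF _ l]) (use Suc.prems(1) in simp)
      show "C_diff k (\<lambda>x. frechet_derivative f (at x) v)"
        using Suc.prems(2) by simp
    qed
  qed
qed

lemma smooth_const: "smooth (\<lambda>x. c)" by (simp add: smooth_def C_diff_const)
lemma smooth_bounded_linear: "bounded_linear f \<Longrightarrow> smooth f" by (simp add: smooth_def C_diff_bounded_linear)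
lemma smooth_add: "smooth f \<Longrightarrow> smooth g \<Longrightarrow> smooth (\<lambda>x. f x + g x)" by (simp add: smooth_def C_diff_add)
lemma smooth_mult:
  fixes f g :: "'a::real_normed_vector \<Rightarrow> real"
  shows "smooth f \<Longrightarrow> smooth g \<Longrightarrow> smooth (\<lambda>x. f x * g x)" by (simp add: smooth_def C_diff_mult)
lemma smooth_compose_real:
  fixes f :: "'a::real_normed_vector \<Rightarrow> real" and g :: "real \<Rightarrow> real"
  shows "smooth g \<Longrightarrow> smooth f \<Longrightarrow> smooth (\<lambda>x. g (f x))" by (simp add: smooth_def C_diff_compose_real)

lemma smooth_imp_continuous: "smooth f \<Longrightarrow> continuous_on UNIV f"
  unfolding smooth_def using C_diff_imp_continuous by blast

lemma smooth_has_derivative: "smooth f \<Longrightarrow> (f has_derivative frechet_derivative f (at x)) (at x)"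
  unfolding smooth_def by (metis C_diff.simps(2) frechet_derivative_works)

lemma smooth_frechet_derivative: "smooth f \<Longrightarrow> smooth (\<lambda>x. frechet_derivative f (at x) v)"
  unfolding smooth_def by (metis C_diff.simps(2))

text \<open>The classical smooth function that vanishes on the negative axis is the member \<open>j = 0\<close> of a
  family that is closed under differentiation up to linear combinations.\<close>

definition flat :: "nat \<Rightarrow> real \<Rightarrow> real" where
  "flat j x = (if x > 0 then exp (- (1 / x)) / x ^ j else 0)"

lemma flat_has_field_derivative:
  "(flat j has_field_derivative flat (j + 2) x - real j * flat (j + 1) x) (at x)"
proof -
  consider "x > 0" | "x < 0" | "x = 0" by linarith
  then show ?thesis
  proof cases
    case 1
    have "((\<lambda>x. exp (- (1 / x)) / x ^ j) has_field_derivative flat (j + 2) x - real j * flat (j + 1) x) (at x)"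
    proof -
      have "((\<lambda>x. exp (- (1 / x))) has_field_derivative exp (- (1 / x)) / x\<^sup>2) (at x)"
        using 1 by (auto intro!: derivative_eq_intros simp: power2_eq_square)
      moreover have "((\<lambda>x. x ^ j) has_field_derivative real j * x ^ (j - 1)) (at x)"
        by (auto intro!: derivative_eq_intros)
      moreover have "x ^ j \<noteq> 0" using 1 by auto
      ultimately have "((\<lambda>x. exp (- (1 / x)) / x ^ j) has_field_derivative
          (exp (- (1 / x)) / x\<^sup>2 * x ^ j - exp (- (1 / x)) * (real j * x ^ (j - 1))) / (x ^ j * x ^ j)) (at x)"
        by (rule DERIV_divide)
      moreover have "x ^ j = x * x ^ (j - 1)" if "j \<noteq> 0" using that by (cases j) auto
      then have "(exp (- (1 / x)) / x\<^sup>2 * x ^ j - exp (- (1 / x)) * (real j * x ^ (j - 1))) / (x ^ j * x ^ j) =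
         flat (j + 2) x - real j * flat (j + 1) x"
        using 1 by (cases "j = 0") (simp_all add: flat_def field_simps power2_eq_square)
      ultimately show ?thesis by simp
    qed
    moreover have "\<forall>\<^sub>F y in nhds x. exp (- (1 / y)) / y ^ j = flat j y"
      using eventually_nhds_in_open[of "{0<..}" x] 1 by (auto simp: flat_def elim!: eventually_mono)
    ultimately show ?thesis by (subst (asm) DERIV_cong_ev) auto
  next
    case 2
    have "\<forall>\<^sub>F y in nhds x. 0 = flat j y"
      using eventually_nhds_in_open[of "{..<0}" x] 2 by (auto simp: flat_def elim!: eventually_mono)
    moreover have "((\<lambda>x. 0) has_field_derivative flat (j + 2) x - real j * flat (j + 1) x) (at x)"
      using 2 by (simp add: flat_def)
    ultimately show ?thesis by (subst (asm) DERIV_cong_ev) auto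
  next
    case 3
    \<comment> \<open>The exponential beats every power on the right, and on the left the function
      is 0. The claimed derivative at 0 is 0 because every \<open>flat\<close> vanishes
      there.\<close>
    have "((\<lambda>h. exp (- (1 / h)) / h ^ j / h) \<longlongrightarrow> 0) (at_right (0::real))" by real_asymp
    then have "((\<lambda>h. flat j h / h) \<longlongrightarrow> 0) (at_right 0)"
      by (rule Lim_transform_eventually) (auto simp: eventually_at_filter flat_def)
    moreover have "((\<lambda>h. flat j h / h) \<longlongrightarrow> 0) (at_left 0)"
      by (rule tendsto_eventually) (auto simp: eventually_at_filter flat_def)
    ultimately have "((\<lambda>h. flat j h / h) \<longlongrightarrow> 0) (at 0)" using filterlim_split_at by blast
    then show ?thesis using 3 by (simp add: has_field_derivative_iff flat_def)
  qed
qed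

lemma C_diff_flat: "C_diff k (flat j)"
proof (induction k arbitrary: j)
  case 0
  show ?case using DERIV_isCont[OF flat_has_field_derivative]
    by (auto simp: continuous_on_eq_continuous_at)
next
  case (Suc k)
  show ?case
  proof (rule C_diff_SucI)
    show "(flat j has_derivative (\<lambda>v. (flat (j + 2) x + (- real j) * flat (j + 1) x) * v)) (at x)" for x
      using flat_has_field_derivative[of j x] by (simp add: has_field_derivative_def)
    show "C_diff k (\<lambda>x. (flat (j + 2) x + (- real j) * flat (j + 1) x) * v)" for v
      by (intro C_diff_mult C_diff_add C_diff_const Suc)
  qed
qed

definition bump :: "real \<Rightarrow> real" where "bump = flat 0"

lemma smooth_bump: "smooth bump" by (simp add: smooth_def bump_def C_diff_flat)
lemma bump_nonneg: "0 \<le> bump x" by (simp add: bump_def flat_def)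
lemma bump_le_1: "bump x \<le> 1" by (simp add: bump_def flat_def)
lemma bump_eq_0_iff: "bump x = 0 \<longleftrightarrow> x \<le> 0" by (simp add: bump_def flat_def)

text \<open>For fixed positive \<open>x\<close> the exponent \<open>- 1 / (n * x)\<close> tends to
  0. Scaling the argument thus approximates the indicator of the positive axis by smooth functions
  that never leave its support.\<close>

lemma bump_tendsto: "(\<lambda>n. bump (real n * x)) \<longlonglongrightarrow> (if x > 0 then 1 else 0)"
proof (cases "x > 0")
  case True
  have "(\<lambda>n. exp (- (1 / (real n * x)))) \<longlonglongrightarrow> 1"
    using True by real_asymp
  then have "(\<lambda>n. bump (real n * x)) \<longlonglongrightarrow> 1"
    by (rule Lim_transform_eventually)
      (use True in \<open>auto simp: bump_def flat_def eventually_at_top_linorder intro!: exI[of _ 1]\<close>)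
  then show ?thesis using True by simp
next
  case False
  then have "bump (real n * x) = 0" for n by (simp add: bump_eq_0_iff mult_nonneg_nonpos)
  then show ?thesis using False by simp
qed

lemma smooth_cos: "smooth (cos :: real \<Rightarrow> real)"
proof -
  \<comment> \<open>Linear combinations of cosine and sine are closed under differentiation, which
    cosine alone is not.\<close>
  have "C_diff k (\<lambda>x. a * cos x + b * sin x)" for k and a b :: real
  proof (induction k arbitrary: a b)
    case 0
    then show ?case by (auto intro!: continuous_intros)
  next
    case (Suc k)
    show ?case
    proof (rule C_diff_SucI)
      show "((\<lambda>x. a * cos x + b * sin x) has_derivative (\<lambda>v. v * (b * cos x + (-a) * sin x))) (at x)" for x
        by (auto intro!: derivative_eq_intros simp: algebra_simps)
      show "C_diff k (\<lambda>x. v * (b * cos x + (-a) * sin x))" for v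
        by (intro C_diff_mult C_diff_const Suc)
    qed
  qed
  from this[of _ 1 0] show ?thesis by (simp add: smooth_def)
qed

section \<open>Uniqueness of weak derivatives\<close>

text \<open>Open boxes are an intersection-stable generator of the Borel sets, and the sets over
  which \<open>h\<close> integrates to 0 are closed under complements and countable disjoint unions.
  A Lebesgue set differs from its Borel main part by a null set, so every set integral of
  \<open>h\<close> vanishes.\<close>

lemma AE_zero_if_box_integrals_zero:
  fixes h :: "'a::euclidean_space \<Rightarrow> 'b::{banach, second_countable_topology}"
  assumes h: "integrable (lebesgue_on (cbox a b)) h"
    and box: "\<And>c d. (LINT x:box c d|lebesgue_on (cbox a b). h x) = 0"
  shows "AE x in lebesgue_on (cbox a b). h x = 0"
proof -
  define M where "M = lebesgue_on (cbox a b)"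
  interpret finite_measure M
    unfolding M_def by (rule finite_measure_lebesgue_on) simp
  have h': "integrable M h" using h by (simp add: M_def)
  have setsM: "A \<inter> cbox a b \<in> sets M" if "A \<in> sets lebesgue" for A :: "'a set"
    using that by (auto simp: M_def sets_restrict_space)
  have restr: "(LINT x:A|M. h x) = (LINT x:A \<inter> cbox a b|M. h x)" for A
    unfolding set_lebesgue_integral_def
    by (rule Bochner_Integration.integral_cong) (auto simp: M_def indicator_def)
  \<comment> \<open>One box that swallows \<open>cbox a b\<close> gives integral 0 over the whole
    space, which the complement step of the induction needs.\<close>
  obtain c where c: "cbox a b \<subseteq> box (- c) c"
    using bounded_subset_box_symmetric[OF bounded_cbox] by metis
  have univ: "(LINT x:UNIV|M. h x) = 0"
    using box[of "- c" c] restr[of "box (- c) c"] restr[of UNIV] c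
    by (simp add: M_def Int_absorb1)
  have int: "set_integrable M (A \<inter> cbox a b) h" if "A \<in> sets lebesgue" for A
    unfolding set_integrable_def using that by (intro integrable_mult_indicator setsM h')
  have borel: "(LINT x:A|M. h x) = 0" if "A \<in> sets borel" for A
  proof -
    have "Int_stable (range (\<lambda>(a, b). box a b :: 'a set))"
      by (auto simp: Int_stable_def box_Int_box)
    moreover have "range (\<lambda>(a, b). box a b :: 'a set) \<subseteq> Pow UNIV" by simp
    moreover have "A \<in> sigma_sets UNIV (range (\<lambda>(a, b). box a b :: 'a set))"
      using that by (subst (asm) borel_eq_box) simp
    ultimately show ?thesis
    proof (induction rule: sigma_sets_induct_disjoint)
      case (basic A)
      then show ?case using box by (auto simp: M_def)
    next
      case empty
      then show ?case by (simp add: set_lebesgue_integral_def)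
    next
      case (compl A)
      then have "A \<in> sets borel" by (subst borel_eq_box) simp
      then have "A \<in> sets lebesgue" by simp
      have "(LINT x:UNIV - A|M. h x) = (LINT x|M. indicator UNIV x *\<^sub>R h x - indicator (A \<inter> cbox a b) x *\<^sub>R h x)"
        unfolding set_lebesgue_integral_def
        by (rule Bochner_Integration.integral_cong) (auto simp: M_def indicator_def)
      also have "\<dots> = (LINT x:UNIV|M. h x) - (LINT x:A \<inter> cbox a b|M. h x)"
        unfolding set_lebesgue_integral_def
        by (rule Bochner_Integration.integral_diff)
          (use int[OF \<open>A \<in> sets lebesgue\<close>] h' in \<open>auto simp: set_integrable_def\<close>)
      finally show ?case using univ compl restr[of A] by simp
    next
      case (union A)
      have A: "A i \<in> sets lebesgue" for i
      proof -
        have "A i \<in> sets borel" using union(2) by (subst borel_eq_box) auto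
        then show ?thesis by simp
      qed
      have "(LINT x:(\<Union>i. A i \<inter> cbox a b)|M. h x) = (\<Sum>i. (LINT x:A i \<inter> cbox a b|M. h x))"
      proof (rule lebesgue_integral_countable_add)
        show "A i \<inter> cbox a b \<in> sets M" for i using A by (rule setsM)
        show "(A i \<inter> cbox a b) \<inter> (A j \<inter> cbox a b) = {}" if "i \<noteq> j" for i j
          using union(1) that by (auto simp: disjoint_family_on_def)
        have "set_integrable M ((\<Union>i. A i) \<inter> cbox a b) h" by (rule int) (use A in auto)
        then show "set_integrable M (\<Union>i. A i \<inter> cbox a b) h" by simp
      qed
      also have "\<dots> = 0"
        using union(3) by (simp only: restr[symmetric] suminf_zero)
      also have "(\<Union>i. A i \<inter> cbox a b) = (\<Union>i. A i) \<inter> cbox a b" by blast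
      finally show ?case by (simp only: restr[symmetric])
    qed
  qed
  have "AE x in M. h x = 0"
  proof (rule density_zero[OF h'])
    fix A assume "A \<in> sets M"
    then have A: "A \<in> sets lebesgue" "A \<subseteq> cbox a b" by (auto simp: M_def sets_restrict_space)
    let ?B = "main_part lborel A"
    have Bb: "?B \<in> sets borel" using main_part_sets[OF A(1)] by simp
    have "AE x in lebesgue. (x \<in> ?B) = (x \<in> A)"
      using AE_in_main_part[OF A(1)] by (rule AE_completion)
    then have ae: "AE x in M. (x \<in> ?B) = (x \<in> A)"
      unfolding M_def by (subst AE_restrict_space_iff) auto
    have "(LINT x:A|M. h x) = (LINT x:?B|M. h x)"
      unfolding set_lebesgue_integral_def
    proof (rule integral_cong_AE)
      have "A \<in> sets M" by fact
      then show "(\<lambda>x. indicat_real A x *\<^sub>R h x) \<in> borel_measurable M"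
        using h' by measurable
      have "?B \<in> sets lebesgue" using Bb by simp
      from int[OF this] have "(\<lambda>x. indicat_real (?B \<inter> cbox a b) x *\<^sub>R h x) \<in> borel_measurable M"
        unfolding set_integrable_def by (rule borel_measurable_integrable)
      moreover have "(\<lambda>x. indicat_real (?B \<inter> cbox a b) x *\<^sub>R h x) \<in> borel_measurable M \<longleftrightarrow>
          (\<lambda>x. indicat_real ?B x *\<^sub>R h x) \<in> borel_measurable M"
        by (rule measurable_cong) (simp add: M_def indicator_def)
      ultimately show "(\<lambda>x. indicat_real ?B x *\<^sub>R h x) \<in> borel_measurable M" by (rule iffD1[rotated])
      show "AE x in M. indicat_real A x *\<^sub>R h x = indicat_real ?B x *\<^sub>R h x"
        using ae by eventually_elim (auto simp: indicator_def)
    qed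
    also have "\<dots> = 0" by (rule borel) (rule Bb)
    finally show "(LINT x:A|M. h x) = 0" .
  qed
  then show ?thesis unfolding M_def .
qed

section \<open>Smooth approximations of box indicators\<close>

lemma smooth_prod:
  fixes f :: "'i \<Rightarrow> 'a::real_normed_vector \<Rightarrow> real"
  assumes "\<And>i. i \<in> I \<Longrightarrow> smooth (f i)"
  shows "smooth (\<lambda>x. \<Prod>i\<in>I. f i x)"
  using assms by (induction I rule: infinite_finite_induct) (auto intro: smooth_const smooth_mult)

definition box_bump :: "'a::euclidean_space \<Rightarrow> 'a \<Rightarrow> nat \<Rightarrow> 'a \<Rightarrow> real" where
  "box_bump c d n x =
     (\<Prod>i\<in>Basis. bump (real n * (x \<bullet> i - c \<bullet> i)) * bump (real n * (d \<bullet> i - x \<bullet> i)))"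

lemma smooth_box_bump: "smooth (box_bump c d n)"
proof -
  have lin: "smooth (\<lambda>x::'a. s * (x \<bullet> i) + t)" for s t i
    by (intro smooth_add smooth_mult smooth_const smooth_bounded_linear bounded_linear_inner_left)
  have "smooth (\<lambda>x::'a. bump (real n * (x \<bullet> i - c \<bullet> i)))" for i
    using smooth_compose_real[OF smooth_bump lin[of "real n" i "- real n * (c \<bullet> i)"]]
    by (simp add: algebra_simps)
  moreover have "smooth (\<lambda>x::'a. bump (real n * (d \<bullet> i - x \<bullet> i)))" for i
    using smooth_compose_real[OF smooth_bump lin[of "- real n" i "real n * (d \<bullet> i)"]]
    by (simp add: algebra_simps)
  ultimately have "smooth (\<lambda>x::'a. box_bump c d n x)"
    unfolding box_bump_def by (intro smooth_prod smooth_mult)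
  then show ?thesis by simp
qed

lemma box_bump_nonneg: "0 \<le> box_bump c d n x"
  unfolding box_bump_def by (intro prod_nonneg ballI mult_nonneg_nonneg bump_nonneg)

lemma box_bump_le_1: "box_bump c d n x \<le> 1"
  unfolding box_bump_def by (intro prod_le_1 conjI mult_nonneg_nonneg mult_le_one bump_nonneg bump_le_1)

lemma box_bump_support: "box_bump c d n x \<noteq> 0 \<Longrightarrow> x \<in> box c d"
proof -
  assume nz: "box_bump c d n x \<noteq> 0"
  have "c \<bullet> i < x \<bullet> i \<and> x \<bullet> i < d \<bullet> i" if "i \<in> Basis" for i
  proof -
    have "bump (real n * (x \<bullet> i - c \<bullet> i)) \<noteq> 0" "bump (real n * (d \<bullet> i - x \<bullet> i)) \<noteq> 0"
      using nz that by (auto simp: box_bump_def)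
    then show ?thesis by (auto simp: bump_eq_0_iff not_le zero_less_mult_iff)
  qed
  then show ?thesis by (simp add: mem_box)
qed

lemma box_bump_tendsto: "(\<lambda>n. box_bump c d n x) \<longlonglongrightarrow> indicator (box c d) x"
proof -
  have "(\<lambda>n. box_bump c d n x) \<longlonglongrightarrow>
     (\<Prod>i\<in>Basis. (if x \<bullet> i - c \<bullet> i > 0 then 1 else 0) * (if d \<bullet> i - x \<bullet> i > 0 then 1 else 0))"
    unfolding box_bump_def by (intro tendsto_prod tendsto_mult bump_tendsto)
  also have "(\<Prod>i\<in>Basis. (if x \<bullet> i - c \<bullet> i > 0 then 1 else 0) * (if d \<bullet> i - x \<bullet> i > 0 then 1 else 0)) =
      (indicator (box c d) x :: real)"
    by (auto simp: mem_box indicator_def intro!: prod.neutral)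
  finally show ?thesis .
qed

lemma test_function_box_bump:
  assumes "cbox c d \<subseteq> \<Omega>" shows "test_function \<Omega> (box_bump c d n)"
proof -
  have "closure {x. box_bump c d n x \<noteq> 0} \<subseteq> cbox c d"
    by (rule closure_minimal) (use box_bump_support box_subset_cbox in blast)+
  moreover have "compact (closure {x. box_bump c d n x \<noteq> 0})"
    using calculation compact_cbox closed_closure compact_Int_closed by (metis inf.absorb_iff2)
  ultimately show ?thesis using assms smooth_box_bump by (auto simp: test_function_def)
qed

text \<open>This is the fundamental lemma of the calculus of variations. Box bumps converge
  boundedly to indicators of open boxes, so all box integrals of \<open>h\<close> inside a closed
  box in \<open>\<Omega>\<close> vanish; countably many such closed boxes cover
  \<open>\<Omega>\<close>.\<close>

lemma AE_zero_on_open_if_test_integrals_zero: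
  fixes h :: "'a::euclidean_space \<Rightarrow> 'b::euclidean_space"
  assumes \<Omega>: "open \<Omega>" and h: "locally_integrable \<Omega> h"
    and test: "\<And>\<eta>. test_function \<Omega> \<eta> \<Longrightarrow> (LINT x|lebesgue_on \<Omega>. \<eta> x *\<^sub>R h x) = 0"
  shows "AE x in lebesgue_on \<Omega>. h x = 0"
proof -
  have [measurable, simp]: "\<Omega> \<in> sets lebesgue" using \<Omega> by auto
  have local: "AE x in lebesgue. x \<in> cbox a b \<longrightarrow> h x = 0" if sub: "cbox a b \<subseteq> \<Omega>" for a b
  proof -
    have h_int: "integrable lebesgue (\<lambda>x. indicator (cbox a b) x *\<^sub>R h x)"
      using h sub unfolding locally_integrable_def
      by (subst integrable_restrict_space[symmetric]) auto
    have bx: "(LINT x:box c d|lebesgue. indicator (cbox a b) x *\<^sub>R h x) = 0" if "cbox c d \<subseteq> cbox a b" for c d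
    proof -
      have t: "test_function \<Omega> (box_bump c d n)" for n
        using sub that by (intro test_function_box_bump) auto
      have "(\<lambda>n. LINT x|lebesgue. box_bump c d n x *\<^sub>R (indicator (cbox a b) x *\<^sub>R h x)) \<longlonglongrightarrow>
          (LINT x|lebesgue. indicator (box c d) x *\<^sub>R (indicator (cbox a b) x *\<^sub>R h x))"
      proof (rule integral_dominated_convergence)
        show "integrable lebesgue (\<lambda>x. norm (indicator (cbox a b) x *\<^sub>R h x))"
          using h_int by (rule integrable_norm)
        show "(\<lambda>x. indicat_real (box c d) x *\<^sub>R (indicator (cbox a b) x *\<^sub>R h x)) \<in> borel_measurable lebesgue"
          by (intro borel_measurable_integrable integrable_mult_indicator h_int) simp
        have "box_bump c d n \<in> borel_measurable borel" for n
          by (rule borel_measurable_continuous_onI) (rule smooth_imp_continuous[OF smooth_box_bump])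
        then have "box_bump c d n \<in> borel_measurable lebesgue" for n
          by (simp add: measurable_completion)
        then show "(\<lambda>x. box_bump c d n x *\<^sub>R (indicator (cbox a b) x *\<^sub>R h x)) \<in> borel_measurable lebesgue" for n
          by (intro borel_measurable_scaleR borel_measurable_integrable[OF h_int])
        show "AE x in lebesgue. (\<lambda>n. box_bump c d n x *\<^sub>R (indicator (cbox a b) x *\<^sub>R h x)) \<longlonglongrightarrow>
           indicat_real (box c d) x *\<^sub>R (indicator (cbox a b) x *\<^sub>R h x)"
          by (intro AE_I2 tendsto_scaleR box_bump_tendsto tendsto_const)
        show "AE x in lebesgue. norm (box_bump c d n x *\<^sub>R (indicator (cbox a b) x *\<^sub>R h x))
            \<le> norm (indicator (cbox a b) x *\<^sub>R h x)" for n
        proof (rule AE_I2)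
          fix x :: 'a
          show "norm (box_bump c d n x *\<^sub>R (indicator (cbox a b) x *\<^sub>R h x)) \<le> norm (indicator (cbox a b) x *\<^sub>R h x)"
            unfolding norm_scaleR[of "box_bump c d n x"] abs_of_nonneg[OF box_bump_nonneg]
            by (rule mult_left_le_one_le) (auto simp: box_bump_nonneg box_bump_le_1)
        qed
      qed
      moreover have "(LINT x|lebesgue. box_bump c d n x *\<^sub>R (indicator (cbox a b) x *\<^sub>R h x)) = 0" for n
      proof -
        have "(LINT x|lebesgue. box_bump c d n x *\<^sub>R (indicator (cbox a b) x *\<^sub>R h x)) =
            (LINT x|lebesgue. indicator \<Omega> x *\<^sub>R (box_bump c d n x *\<^sub>R h x))"
        proof (rule Bochner_Integration.integral_cong[OF refl])
          fix x
          show "box_bump c d n x *\<^sub>R (indicator (cbox a b) x *\<^sub>R h x) = indicator \<Omega> x *\<^sub>R (box_bump c d n x *\<^sub>R h x)"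
          proof (cases "box_bump c d n x = 0")
            case False
            then have "x \<in> box c d" by (rule box_bump_support)
            then have "x \<in> cbox a b" using that box_subset_cbox by blast
            then show ?thesis using sub by auto
          qed simp
        qed
        then show ?thesis using test[OF t[of n]] by (simp add: integral_restrict_space)
      qed
      ultimately show ?thesis
        by (simp add: set_lebesgue_integral_def LIMSEQ_const_iff)
    qed
    have "AE x in lebesgue_on (cbox a b). h x = 0"
    proof (rule AE_zero_if_box_integrals_zero)
      show "integrable (lebesgue_on (cbox a b)) h"
        using h sub by (simp add: locally_integrable_def)
    next
      fix c d
      \<comment> \<open>An arbitrary open box meets the local one, up to the null frontier of
        \<open>cbox a b\<close>, in an open box whose closed version stays inside
        \<open>cbox a b\<close>, so the case already settled covers it.\<close>
      define l u where "l = (\<Sum>i\<in>Basis. max (a \<bullet> i) (c \<bullet> i) *\<^sub>R i)" and "u = (\<Sum>i\<in>Basis. min (b \<bullet> i) (d \<bullet> i) *\<^sub>R i)"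
      have lu: "box a b \<inter> box c d = box l u" "cbox l u \<subseteq> cbox a b"
        by (auto simp: l_def u_def Int_interval mem_box)
      have "(LINT x:box c d|lebesgue_on (cbox a b). h x) = (LINT x|lebesgue. indicator (box c d) x *\<^sub>R (indicator (cbox a b) x *\<^sub>R h x))"
        by (simp add: set_lebesgue_integral_def integral_restrict_space mult.commute)
      also have "\<dots> = (LINT x|lebesgue. indicator (box l u) x *\<^sub>R (indicator (cbox a b) x *\<^sub>R h x))"
      proof (rule integral_cong_AE)
        show "(\<lambda>x. indicat_real (box c d) x *\<^sub>R (indicator (cbox a b) x *\<^sub>R h x)) \<in> borel_measurable lebesgue"
          "(\<lambda>x. indicat_real (box l u) x *\<^sub>R (indicator (cbox a b) x *\<^sub>R h x)) \<in> borel_measurable lebesgue"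
          by (intro borel_measurable_integrable integrable_mult_indicator h_int; simp)+
        have "AE x in lebesgue. x \<notin> cbox a b - box a b"
          using negligible_frontier_interval[of a b] unfolding negligible_iff_null_sets by (rule AE_not_in)
        then show "AE x in lebesgue. indicat_real (box c d) x *\<^sub>R (indicator (cbox a b) x *\<^sub>R h x) =
            indicat_real (box l u) x *\<^sub>R (indicator (cbox a b) x *\<^sub>R h x)"
          by eventually_elim (use lu(1) in \<open>auto simp: indicator_def\<close>)
      qed
      also have "\<dots> = 0" using bx[OF lu(2)] by (simp add: set_lebesgue_integral_def)
      finally show "(LINT x:box c d|lebesgue_on (cbox a b). h x) = 0" .
    qed
    then show ?thesis by (subst (asm) AE_restrict_space_iff) auto
  qed
  obtain D where D: "countable D" "D \<subseteq> Pow \<Omega>" "\<And>X. X \<in> D \<Longrightarrow> \<exists>a b. X = cbox a b" "\<Union>D = \<Omega>"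
    using open_countable_Union_open_cbox[OF \<Omega>] by metis
  have "AE x in lebesgue. \<forall>X\<in>D. x \<in> X \<longrightarrow> h x = 0"
    unfolding AE_ball_countable[OF D(1)] using local D(2,3) by (metis Pow_iff subsetD)
  then show ?thesis
    by (subst AE_restrict_space_iff) (use D(4) in \<open>auto elim!: eventually_mono\<close>)
qed

text \<open>The factor is any continuous function vanishing off a compact set, so that derivatives
  of test functions are covered as well as test functions.\<close>

lemma test_function_mult_integrable:
  fixes g :: "'a::euclidean_space \<Rightarrow> 'b::euclidean_space"
  assumes \<Omega>: "open \<Omega>" and g: "locally_integrable \<Omega> g"
    and c: "continuous_on UNIV \<zeta>" and K: "compact K" "K \<subseteq> \<Omega>" "\<And>x. x \<notin> K \<Longrightarrow> \<zeta> x = (0::real)"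
  shows "integrable (lebesgue_on \<Omega>) (\<lambda>x. \<zeta> x *\<^sub>R g x)"
proof -
  have [simp]: "\<Omega> \<in> sets lebesgue" "K \<in> sets lebesgue"
    using \<Omega> lmeasurable_compact[OF K(1)] by (simp_all add: fmeasurableD)
  have "bounded (\<zeta> ` K)"
    using c K(1) by (intro compact_imp_bounded compact_continuous_image continuous_on_subset[OF c]) simp_all
  then obtain B where B: "\<And>x. x \<in> K \<Longrightarrow> \<bar>\<zeta> x\<bar> \<le> B" by (auto simp: bounded_iff)
  have gK: "integrable lebesgue (\<lambda>x. indicator K x *\<^sub>R g x)"
    using g K unfolding locally_integrable_def by (subst integrable_restrict_space[symmetric]) auto
  have \<zeta>: "\<zeta> \<in> borel_measurable lebesgue"
    using borel_measurable_continuous_onI[OF c] by (simp add: measurable_completion)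
  have "integrable lebesgue (\<lambda>x. \<zeta> x *\<^sub>R (indicator K x *\<^sub>R g x))"
  proof (rule Bochner_Integration.integrable_bound)
    show "integrable lebesgue (\<lambda>x. B *\<^sub>R norm (indicator K x *\<^sub>R g x))"
      by (intro integrable_scaleR_right integrable_norm gK)
    show "(\<lambda>x. \<zeta> x *\<^sub>R (indicator K x *\<^sub>R g x)) \<in> borel_measurable lebesgue"
      by (intro borel_measurable_scaleR \<zeta> borel_measurable_integrable[OF gK])
    show "AE x in lebesgue. norm (\<zeta> x *\<^sub>R (indicator K x *\<^sub>R g x)) \<le> norm (B *\<^sub>R norm (indicator K x *\<^sub>R g x))"
      using B by (intro AE_I2) (force simp: indicator_def intro!: mult_right_mono)
  qed
  also have "(\<lambda>x. \<zeta> x *\<^sub>R (indicator K x *\<^sub>R g x)) = (\<lambda>x. indicator \<Omega> x *\<^sub>R (\<zeta> x *\<^sub>R g x))"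
    using K by (auto simp: indicator_def fun_eq_iff)
  finally show ?thesis by (simp add: integrable_restrict_space)
qed

lemma test_function_integrable:
  assumes "open \<Omega>" "locally_integrable \<Omega> g" "test_function \<Omega> \<eta>"
  shows "integrable (lebesgue_on \<Omega>) (\<lambda>x. \<eta> x *\<^sub>R g x)"
proof (rule test_function_mult_integrable[OF assms(1,2)])
  show "continuous_on UNIV \<eta>" using assms(3) by (simp add: test_function_def smooth_imp_continuous)
  show "compact (closure {x. \<eta> x \<noteq> 0})" "closure {x. \<eta> x \<noteq> 0} \<subseteq> \<Omega>"
    using assms(3) by (simp_all add: test_function_def)
  show "\<eta> x = 0" if "x \<notin> closure {x. \<eta> x \<noteq> 0}" for x
    using that closure_subset[of "{x. \<eta> x \<noteq> 0}"] by blast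
qed

lemma has_weak_partial_unique:
  fixes g g' :: "'a::euclidean_space \<Rightarrow> 'b::euclidean_space"
  assumes \<Omega>: "open \<Omega>" and g: "has_weak_partial \<Omega> b f g" and g': "has_weak_partial \<Omega> b f g'"
  shows "AE x in lebesgue_on \<Omega>. g x = g' x"
proof -
  have li: "locally_integrable \<Omega> g" "locally_integrable \<Omega> g'"
    using g g' by (auto simp: has_weak_partial_def)
  have "AE x in lebesgue_on \<Omega>. g x - g' x = 0"
  proof (rule AE_zero_on_open_if_test_integrals_zero[OF \<Omega>])
    show "locally_integrable \<Omega> (\<lambda>x. g x - g' x)"
      using li by (auto simp: locally_integrable_def)
  next
    fix \<eta> :: "'a \<Rightarrow> real" assume \<eta>: "test_function \<Omega> \<eta>"
    have "(LINT x|lebesgue_on \<Omega>. \<eta> x *\<^sub>R (g x - g' x)) =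
        (LINT x|lebesgue_on \<Omega>. \<eta> x *\<^sub>R g x) - (LINT x|lebesgue_on \<Omega>. \<eta> x *\<^sub>R g' x)"
      unfolding scaleR_diff_right
      by (intro Bochner_Integration.integral_diff test_function_integrable \<Omega> li \<eta>)
    also have "\<dots> = 0" using g g' \<eta> unfolding has_weak_partial_def by (metis minus_equation_iff right_minus_eq)
    finally show "(LINT x|lebesgue_on \<Omega>. \<eta> x *\<^sub>R (g x - g' x)) = 0" .
  qed
  then show ?thesis by simp
qed

text \<open>The chosen representative is itself a weak partial, so uniqueness ties it to any
  explicit formula. All norms of the extension are computed through this link.\<close>

lemma weak_partial_AE_eq:
  fixes g :: "'a::euclidean_space \<Rightarrow> 'b::euclidean_space"
  assumes "open \<Omega>" "has_weak_partial \<Omega> b f g"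
  shows "AE x in lebesgue_on \<Omega>. weak_partial \<Omega> b f x = g x"
proof -
  have "has_weak_partial \<Omega> b f (weak_partial \<Omega> b f)"
    unfolding weak_partial_def by (rule someI[of _ g]) (rule assms(2))
  then show ?thesis using assms has_weak_partial_unique by blast
qed

section \<open>Indefinite integrals\<close>

text \<open>A quadratic remainder replaces a limit argument, both for reparametrized increments and
  for differentiation under the integral sign.\<close>

lemma has_derivative_if_quadratic:
  fixes f :: "'a::real_normed_vector \<Rightarrow> 'b::real_normed_vector"
  assumes "bounded_linear f'" "0 < \<delta>"
    and "\<And>y. y \<in> S \<Longrightarrow> dist y x < \<delta> \<Longrightarrow> norm (f y - f x - f' (y - x)) \<le> B * (norm (y - x))\<^sup>2"
  shows "(f has_derivative f') (at x within S)"
proof (rule has_derivativeI_sandwich[OF \<open>0 < \<delta>\<close> \<open>bounded_linear f'\<close>])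
  show "norm (f y - f x - f' (y - x)) / norm (y - x) \<le> B * norm (y - x)"
    if "y \<in> S" "y \<noteq> x" "dist y x < \<delta>" for y
    using assms(3)[OF that(1,3)] that(2) by (simp add: divide_le_eq power2_eq_square mult.assoc)
  have "((\<lambda>y. B * norm (y - x)) \<longlongrightarrow> B * norm (x - x)) (at x within S)"
    by (intro tendsto_intros)
  then show "((\<lambda>y. B * norm (y - x)) \<longlongrightarrow> 0) (at x within S)" by simp
qed

text \<open>Reparametrized by \<open>G\<close>, the function \<open>P\<close> has derivative zero.  This replaces the product and chain
  rules for absolutely continuous functions.\<close>

lemma constant_if_increments_quadratic:
  fixes P :: "real \<Rightarrow> 'a::real_normed_vector" and G :: "real \<Rightarrow> real"
  assumes cont: "continuous_on {a..b} G"
    and mono: "\<And>s t. a \<le> s \<Longrightarrow> s \<le> t \<Longrightarrow> t \<le> b \<Longrightarrow> G s \<le> G t"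
    and inc: "\<And>s t. a \<le> s \<Longrightarrow> s \<le> t \<Longrightarrow> t \<le> b \<Longrightarrow> norm (P t - P s) \<le> C * (G t - G s)\<^sup>2"
    and t: "t \<in> {a..b}"
  shows "P t = P a"
proof -
  \<comment> \<open>A right inverse of the monotone function \<open>G\<close>. Where
    \<open>G\<close> is constant the increment bound forces \<open>P\<close> to be constant too, so
    the choice of preimage does not matter.\<close>
  define sel where "sel y = (SOME s. s \<in> {a..b} \<and> G s = y)" for y
  have sel: "sel y \<in> {a..b} \<and> G (sel y) = y" if y: "y \<in> {G a..G b}" for y
  proof -
    have "\<exists>s. s \<in> {a..b} \<and> G s = y" using IVT'[of G a y b] y t cont by auto
    from someI_ex[OF this] show ?thesis unfolding sel_def .
  qed
  have inc': "norm (P v - P w) \<le> C * (norm (G v - G w))\<^sup>2" if "v \<in> {a..b}" "w \<in> {a..b}" for v w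
    using inc[of v w] inc[of w v] that by (cases "v \<le> w") (auto simp: norm_minus_commute power2_commute)
  have "((\<lambda>y. P (sel y)) has_derivative (\<lambda>_. 0)) (at y within {G a..G b})" if y: "y \<in> {G a..G b}" for y
  proof (rule has_derivative_if_quadratic[where B = C and \<delta> = 1])
    fix v assume v: "v \<in> {G a..G b}"
    show "norm (P (sel v) - P (sel y) - 0) \<le> C * (norm (v - y))\<^sup>2"
      using inc'[of "sel v" "sel y"] sel[OF v] sel[OF y] by simp
  qed (simp_all add: bounded_linear_zero)
  then obtain c where c: "\<And>y. y \<in> {G a..G b} \<Longrightarrow> P (sel y) = c"
    using has_derivative_zero_constant[of "{G a..G b}" "\<lambda>y. P (sel y)"] by auto
  have "P s = c" if s: "s \<in> {a..b}" for s
  proof -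
    have Gs: "G s \<in> {G a..G b}" using mono[of a s] mono[of s b] s by auto
    have "norm (P s - P (sel (G s))) \<le> C * (norm (G s - G (sel (G s))))\<^sup>2"
      using inc' s sel[OF Gs] by blast
    then show ?thesis using c[OF Gs] sel[OF Gs] by simp
  qed
  from this[of t] this[of a] show ?thesis using t by auto
qed

section \<open>Calculus of absolutely continuous functions\<close>

lemma absolutely_integrable_on_iff_integrable:
  fixes f :: "real \<Rightarrow> 'a::euclidean_space"
  shows "f absolutely_integrable_on {a..b} \<longleftrightarrow> integrable (lebesgue_on {a..b}) f"
  by (simp add: set_integrable_def integrable_restrict_space)

text \<open>These facts make the primitive of the norm usable as the monotone function
  \<open>G\<close> of the increment principle.\<close>

lemma indefinite_integral_norm_diff:
  fixes f :: "real \<Rightarrow> 'a::euclidean_space"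
  assumes f: "f absolutely_integrable_on {a..b}" and st: "a \<le> s" "s \<le> t" "t \<le> b"
  shows "integral {a..t} f - integral {a..s} f = integral {s..t} f"
    and "norm (integral {s..t} f) \<le> integral {a..t} (\<lambda>x. norm (f x)) - integral {a..s} (\<lambda>x. norm (f x))"
    and "0 \<le> integral {a..t} (\<lambda>x. norm (f x)) - integral {a..s} (\<lambda>x. norm (f x))"
    and "integral {s..t} (\<lambda>x. norm (f x)) = integral {a..t} (\<lambda>x. norm (f x)) - integral {a..s} (\<lambda>x. norm (f x))"
proof -
  have i: "f integrable_on {a..t}" "(\<lambda>x. norm (f x)) integrable_on {a..t}"
      "f integrable_on {s..t}" "(\<lambda>x. norm (f x)) integrable_on {s..t}"
    using f st by (auto simp: absolutely_integrable_on_def intro: integrable_on_subinterval)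
  note c = Henstock_Kurzweil_Integration.integral_combine[OF st(1,2)]
  show "integral {a..t} f - integral {a..s} f = integral {s..t} f"
    using c[OF i(1)] by (simp add: algebra_simps)
  have n: "integral {a..t} (\<lambda>x. norm (f x)) - integral {a..s} (\<lambda>x. norm (f x)) = integral {s..t} (\<lambda>x. norm (f x))"
    using c[OF i(2)] by (simp add: algebra_simps)
  then show "integral {s..t} (\<lambda>x. norm (f x)) = integral {a..t} (\<lambda>x. norm (f x)) - integral {a..s} (\<lambda>x. norm (f x))" ..
  show "norm (integral {s..t} f) \<le> integral {a..t} (\<lambda>x. norm (f x)) - integral {a..s} (\<lambda>x. norm (f x))"
    unfolding n by (rule Henstock_Kurzweil_Integration.integral_norm_bound_integral) (use i in auto)
  show "0 \<le> integral {a..t} (\<lambda>x. norm (f x)) - integral {a..s} (\<lambda>x. norm (f x))"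
    unfolding n by (rule Henstock_Kurzweil_Integration.integral_nonneg) (use i in auto)
qed

lemma indefinite_integral_continuous_AC:
  fixes f :: "real \<Rightarrow> 'a::euclidean_space"
  assumes "f absolutely_integrable_on {a..b}"
  shows "continuous_on {a..b} (\<lambda>t. integral {a..t} f)"
    and "continuous_on {a..b} (\<lambda>t. integral {a..t} (\<lambda>x. norm (f x)))"
  using assms by (auto simp: absolutely_integrable_on_def intro: indefinite_integral_continuous_1)

lemma absolutely_integrable_bilinear:
  fixes f :: "real \<Rightarrow> 'a::euclidean_space" and g :: "real \<Rightarrow> 'b::euclidean_space"
    and h :: "'a \<Rightarrow> 'b \<Rightarrow> 'c::euclidean_space"
  assumes "bounded_bilinear h" "continuous_on {a..b} f" "g absolutely_integrable_on {a..b}"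
  shows "(\<lambda>x. h (f x) (g x)) absolutely_integrable_on {a..b}"
proof (rule absolutely_integrable_bounded_measurable_product[where h = h and f = f and g = g])
  show "bilinear h" using assms(1) by (simp add: bilinear_conv_bounded_bilinear)
  show "f \<in> borel_measurable (lebesgue_on {a..b})"
    using assms(2) by (intro continuous_imp_measurable_on_sets_lebesgue) auto
  show "bounded (f ` {a..b})"
    using assms(2) compact_continuous_image compact_imp_bounded compact_Icc by blast
qed (use assms in auto)

text \<open>Seen as functions of the right endpoint, the two sides differ by a function
  \<open>P\<close> whose increments are sums of terms containing one increment of \<open>A\<close>
  and one of \<open>B\<close>. Such terms are quadratic in the increment of the total variation, so
  \<open>P\<close> is constant.\<close>

lemma integral_by_parts_AC:
  fixes a :: "real \<Rightarrow> 'a::euclidean_space" and b :: "real \<Rightarrow> 'b::euclidean_space"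
    and h :: "'a \<Rightarrow> 'b \<Rightarrow> 'c::euclidean_space"
  assumes h: "bounded_bilinear h" and le: "\<alpha> \<le> \<beta>"
    and a: "a absolutely_integrable_on {\<alpha>..\<beta>}" and b: "b absolutely_integrable_on {\<alpha>..\<beta>}"
    and A: "\<And>t. t \<in> {\<alpha>..\<beta>} \<Longrightarrow> A t = A0 + integral {\<alpha>..t} a"
    and B: "\<And>t. t \<in> {\<alpha>..\<beta>} \<Longrightarrow> B t = B0 + integral {\<alpha>..t} b"
  shows "h (A \<beta>) (B \<beta>) - h A0 B0 = integral {\<alpha>..\<beta>} (\<lambda>t. h (a t) (B t)) + integral {\<alpha>..\<beta>} (\<lambda>t. h (A t) (b t))"
proof -
  interpret h: bounded_bilinear h by (rule h)
  obtain K where K: "K \<ge> 0" "\<And>x y. norm (h x y) \<le> norm x * norm y * K"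
    using h.nonneg_bounded by blast
  define Ga Gb where "Ga t = integral {\<alpha>..t} (\<lambda>x. norm (a x))" and "Gb t = integral {\<alpha>..t} (\<lambda>x. norm (b x))" for t
  \<comment> \<open>The sum of both variations is one monotone function that dominates the
    increments of \<open>A\<close> and of \<open>B\<close> at the same time.\<close>
  define G where "G t = Ga t + Gb t" for t
  have cA: "continuous_on {\<alpha>..\<beta>} A"
    by (subst continuous_on_cong[OF refl A]) (auto intro!: continuous_intros indefinite_integral_continuous_AC a)
  have cB: "continuous_on {\<alpha>..\<beta>} B"
    by (subst continuous_on_cong[OF refl B]) (auto intro!: continuous_intros indefinite_integral_continuous_AC b)
  have aB: "(\<lambda>t. h (a t) (B t)) absolutely_integrable_on {\<alpha>..\<beta>}"
    using absolutely_integrable_bilinear[OF h.flip cB a] .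
  have Ab: "(\<lambda>t. h (A t) (b t)) absolutely_integrable_on {\<alpha>..\<beta>}"
    using absolutely_integrable_bilinear[OF h cA b] .
  define P where "P t = h (A t) (B t) - (integral {\<alpha>..t} (\<lambda>t. h (a t) (B t)) + integral {\<alpha>..t} (\<lambda>t. h (A t) (b t)))" for t
  have "P \<beta> = P \<alpha>"
  proof (rule constant_if_increments_quadratic[where C = "3 * K" and G = G])
    show "continuous_on {\<alpha>..\<beta>} G"
      unfolding G_def Ga_def Gb_def by (intro continuous_intros indefinite_integral_continuous_AC a b)
    fix s t assume st: "\<alpha> \<le> s" "s \<le> t" "t \<le> \<beta>"
    note ia = indefinite_integral_norm_diff[OF a] and ib = indefinite_integral_norm_diff[OF b]
    show "G s \<le> G t" using ia(3)[OF st] ib(3)[OF st] by (simp add: G_def Ga_def Gb_def)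
    have dA: "norm (A v - A s) \<le> Ga t - Ga s" if "v \<in> {s..t}" for v
      using ia(1,2)[of s v] ia(3)[of v t] st that by (auto simp: A Ga_def)
    have dB: "norm (B v - B s) \<le> Gb t - Gb s" if "v \<in> {s..t}" for v
      using ib(1,2)[of s v] ib(3)[of v t] st that by (auto simp: B Gb_def)
    have sub: "{s..t} \<subseteq> {\<alpha>..\<beta>}" using st by auto
    have ai: "a integrable_on {s..t}" "(\<lambda>x. norm (a x)) integrable_on {s..t}"
      and bi: "b integrable_on {s..t}" "(\<lambda>x. norm (b x)) integrable_on {s..t}"
      and aBi: "(\<lambda>t. h (a t) (B t)) integrable_on {s..t}" and Abi: "(\<lambda>t. h (A t) (b t)) integrable_on {s..t}"
      using a b aB Ab sub by (auto simp: absolutely_integrable_on_def intro: integrable_on_subinterval)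
    have e1: "integral {s..t} (\<lambda>v. h (a v) (B v - B s)) = integral {s..t} (\<lambda>v. h (a v) (B v)) - h (integral {s..t} a) (B s)"
      and e1i: "(\<lambda>v. h (a v) (B v - B s)) integrable_on {s..t}"
    proof -
      have "((\<lambda>v. h (a v) (B s)) has_integral h (integral {s..t} a) (B s)) {s..t}"
        using has_integral_linear[OF integrable_integral[OF ai(1)] h.bounded_linear_left[of "B s"]] by (simp add: o_def)
      from has_integral_diff[OF integrable_integral[OF aBi] this]
      show "integral {s..t} (\<lambda>v. h (a v) (B v - B s)) = integral {s..t} (\<lambda>v. h (a v) (B v)) - h (integral {s..t} a) (B s)"
        "(\<lambda>v. h (a v) (B v - B s)) integrable_on {s..t}"
        by (auto simp: h.diff_right)
    qed
    have e2: "integral {s..t} (\<lambda>v. h (A v - A s) (b v)) = integral {s..t} (\<lambda>v. h (A v) (b v)) - h (A s) (integral {s..t} b)"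
      and e2i: "(\<lambda>v. h (A v - A s) (b v)) integrable_on {s..t}"
    proof -
      have "((\<lambda>v. h (A s) (b v)) has_integral h (A s) (integral {s..t} b)) {s..t}"
        using has_integral_linear[OF integrable_integral[OF bi(1)] h.bounded_linear_right[of "A s"]] by (simp add: o_def)
      from has_integral_diff[OF integrable_integral[OF Abi] this]
      show "integral {s..t} (\<lambda>v. h (A v - A s) (b v)) = integral {s..t} (\<lambda>v. h (A v) (b v)) - h (A s) (integral {s..t} b)"
        "(\<lambda>v. h (A v - A s) (b v)) integrable_on {s..t}"
        by (auto simp: h.diff_left)
    qed
    have na: "integral {s..t} (\<lambda>x. norm (a x)) = Ga t - Ga s"
      using ia(4)[OF st] by (simp add: Ga_def)
    have nb: "integral {s..t} (\<lambda>x. norm (b x)) = Gb t - Gb s"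
      using ib(4)[OF st] by (simp add: Gb_def)
    have dGa: "0 \<le> Ga t - Ga s" and dGb: "0 \<le> Gb t - Gb s" using ia(3)[OF st] ib(3)[OF st] by (simp_all add: Ga_def Gb_def)
    have n1: "norm (integral {s..t} (\<lambda>v. h (a v) (B v - B s))) \<le> K * ((Ga t - Ga s) * (Gb t - Gb s))"
    proof -
      have "norm (integral {s..t} (\<lambda>v. h (a v) (B v - B s))) \<le> integral {s..t} (\<lambda>v. (K * (Gb t - Gb s)) * norm (a v))"
      proof (rule Henstock_Kurzweil_Integration.integral_norm_bound_integral[OF e1i])
        show "(\<lambda>v. (K * (Gb t - Gb s)) * norm (a v)) integrable_on {s..t}" using ai(2) by (rule integrable_on_mult_right)
        fix v assume v: "v \<in> {s..t}"
        have "norm (h (a v) (B v - B s)) \<le> norm (a v) * norm (B v - B s) * K" by (rule K(2))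
        also have "\<dots> \<le> norm (a v) * (Gb t - Gb s) * K" using dB[OF v] K(1) by (intro mult_right_mono mult_left_mono) auto
        finally show "norm (h (a v) (B v - B s)) \<le> K * (Gb t - Gb s) * norm (a v)" by (simp add: mult_ac)
      qed
      then show ?thesis by (simp add: na mult_ac)
    qed
    have n2: "norm (integral {s..t} (\<lambda>v. h (A v - A s) (b v))) \<le> K * ((Ga t - Ga s) * (Gb t - Gb s))"
    proof -
      have "norm (integral {s..t} (\<lambda>v. h (A v - A s) (b v))) \<le> integral {s..t} (\<lambda>v. (K * (Ga t - Ga s)) * norm (b v))"
      proof (rule Henstock_Kurzweil_Integration.integral_norm_bound_integral[OF e2i])
        show "(\<lambda>v. (K * (Ga t - Ga s)) * norm (b v)) integrable_on {s..t}" using bi(2) by (rule integrable_on_mult_right)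
        fix v assume v: "v \<in> {s..t}"
        have "norm (h (A v - A s) (b v)) \<le> norm (A v - A s) * norm (b v) * K" by (rule K(2))
        also have "\<dots> \<le> (Ga t - Ga s) * norm (b v) * K" using dA[OF v] K(1) by (intro mult_right_mono) auto
        finally show "norm (h (A v - A s) (b v)) \<le> K * (Ga t - Ga s) * norm (b v)" by (simp add: mult_ac)
      qed
      then show ?thesis by (simp add: nb mult_ac)
    qed
    have n3: "norm (h (A t - A s) (B t - B s)) \<le> K * ((Ga t - Ga s) * (Gb t - Gb s))"
    proof -
      have "norm (h (A t - A s) (B t - B s)) \<le> norm (A t - A s) * norm (B t - B s) * K" by (rule K(2))
      also have "\<dots> \<le> ((Ga t - Ga s) * (Gb t - Gb s)) * K"
        using dA[of t] dB[of t] dGa st K(1) by (intro mult_right_mono mult_mono) auto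
      finally show ?thesis by (simp add: mult_ac)
    qed
    \<comment> \<open>After expansion at the left endpoint \<open>s\<close> the parts linear in an
      increment cancel; every surviving term pairs two increments.\<close>
    have "P t - P s = h (A t - A s) (B t - B s) - integral {s..t} (\<lambda>v. h (a v) (B v - B s)) - integral {s..t} (\<lambda>v. h (A v - A s) (b v))"
    proof -
      have "h (A t) (B t) - h (A s) (B s) = h (A t - A s) (B t - B s) + h (A t - A s) (B s) + h (A s) (B t - B s)"
        by (simp add: h.diff_left h.diff_right)
      moreover have "A t - A s = integral {s..t} a" "B t - B s = integral {s..t} b"
        using ia(1)[OF st] ib(1)[OF st] A B st by auto
      moreover have "integral {\<alpha>..t} (\<lambda>t. h (a t) (B t)) - integral {\<alpha>..s} (\<lambda>t. h (a t) (B t)) = integral {s..t} (\<lambda>t. h (a t) (B t))"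
        "integral {\<alpha>..t} (\<lambda>t. h (A t) (b t)) - integral {\<alpha>..s} (\<lambda>t. h (A t) (b t)) = integral {s..t} (\<lambda>t. h (A t) (b t))"
        using indefinite_integral_norm_diff(1)[OF aB st] indefinite_integral_norm_diff(1)[OF Ab st] by auto
      ultimately show ?thesis unfolding P_def e1 e2 by (simp add: algebra_simps)
    qed
    then have "norm (P t - P s) \<le> norm (h (A t - A s) (B t - B s)) + norm (integral {s..t} (\<lambda>v. h (a v) (B v - B s))) +
        norm (integral {s..t} (\<lambda>v. h (A v - A s) (b v)))"
      using order_trans[OF norm_triangle_ineq4 add_right_mono[OF norm_triangle_ineq4]] by simp
    also have "\<dots> \<le> 3 * K * ((Ga t - Ga s) * (Gb t - Gb s))"
      using n1 n2 n3 by simp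
    also have "\<dots> \<le> 3 * K * (G t - G s)\<^sup>2"
    proof -
      have "(Ga t - Ga s) * (Gb t - Gb s) \<le> ((Ga t - Ga s) + (Gb t - Gb s)) * ((Ga t - Ga s) + (Gb t - Gb s))"
        using dGa dGb by (intro mult_mono) auto
      then show ?thesis using K(1) by (intro mult_left_mono) (auto simp: G_def power2_eq_square algebra_simps)
    qed
    finally show "norm (P t - P s) \<le> 3 * K * (G t - G s)\<^sup>2" .
  qed (use le in auto)
  then show ?thesis using A[of \<alpha>] B[of \<alpha>] le by (simp add: P_def algebra_simps)
qed

text \<open>Since \<open>\<Phi>\<close> has modulus 1, \<open>\<psi> = \<Phi> * q\<close> with
  \<open>q = cnj \<Phi> * \<psi>\<close>, so formally \<open>\<Phi>\<close> solves the linear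
  equation with coefficient \<open>q\<close>. The integrating factor \<open>exp (- Q)\<close> then
  makes the product constant, which is shown by increments.\<close>

lemma unimodular_AC_exp:
  fixes \<Phi> \<psi> :: "real \<Rightarrow> complex"
  assumes \<psi>: "\<psi> absolutely_integrable_on {0..T}"
    and \<Phi>: "\<And>t. t \<in> {0..T} \<Longrightarrow> \<Phi> t = \<Phi>0 + integral {0..t} \<psi>"
    and uni: "\<And>t. t \<in> {0..T} \<Longrightarrow> norm (\<Phi> t) = 1"
    and t: "t \<in> {0..T}"
  shows "\<Phi> t = \<Phi> 0 * exp (integral {0..t} (\<lambda>s. cnj (\<Phi> s) * \<psi> s))"
proof -
  define q where "q s = cnj (\<Phi> s) * \<psi> s" for s
  define Q where "Q t = integral {0..t} q" for t
  define G where "G t = integral {0..t} (\<lambda>x. norm (\<psi> x))" for t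
  define L where "L = G T"
  have c\<Phi>: "continuous_on {0..T} \<Phi>"
    by (subst continuous_on_cong[OF refl \<Phi>]) (auto intro!: continuous_intros indefinite_integral_continuous_AC \<psi>)
  have q: "q absolutely_integrable_on {0..T}"
    unfolding q_def by (rule absolutely_integrable_bilinear[OF bounded_bilinear_mult _ \<psi>]) (intro continuous_intros c\<Phi>)
  have nq: "norm (q s) = norm (\<psi> s)" if "s \<in> {0..T}" for s
    using uni[OF that] by (simp add: q_def norm_mult)
  have \<psi>q: "\<psi> s = \<Phi> s * q s" if "s \<in> {0..T}" for s
    using uni[OF that] complex_norm_square[of "\<Phi> s"] by (simp add: q_def mult.assoc[symmetric])
  have Gq: "integral {0..s} (\<lambda>x. norm (q x)) = G s" if "s \<in> {0..T}" for s
    unfolding G_def by (rule Henstock_Kurzweil_Integration.integral_cong) (use nq that in auto)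
  note i\<psi> = indefinite_integral_norm_diff[OF \<psi>] and iq = indefinite_integral_norm_diff[OF q]
  have Gm: "0 \<le> G v - G s" if "0 \<le> s" "s \<le> v" "v \<le> T" for s v
    using i\<psi>(3)[OF that] by (simp add: G_def)
  have G0: "G 0 = 0" by (simp add: G_def)
  have d\<Phi>: "norm (\<Phi> v - \<Phi> s) \<le> G v - G s" if "0 \<le> s" "s \<le> v" "v \<le> T" for s v
    using i\<psi>(1,2)[OF that] that \<Phi>[of v] \<Phi>[of s] by (simp add: G_def)
  have dQ: "norm (Q v - Q s) \<le> G v - G s" if "0 \<le> s" "s \<le> v" "v \<le> T" for s v
    using iq(1,2)[OF that] that Gq[of v] Gq[of s] by (simp add: Q_def)
  define P where "P t = \<Phi> t * exp (- Q t)" for t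
  have "P t = P 0"
  \<comment> \<open>The outer \<open>exp L\<close> bounds \<open>exp (- Q s)\<close>; the bracket
    adds \<open>exp L\<close> from the Taylor remainder of the exponential and 1 from each of the
    other two error terms.\<close>
  proof (rule constant_if_increments_quadratic[OF _ _ _ t, where G = G and C = "exp L * (exp L + 2)"])
    show "continuous_on {0..T} G" unfolding G_def by (intro indefinite_integral_continuous_AC \<psi>)
    fix s t assume st: "0 \<le> s" "s \<le> t" "t \<le> T"
    show "G s \<le> G t" using Gm[OF st] by simp
    define z g where "z = Q t - Q s" and "g = G t - G s"
    have zg: "norm z \<le> g" "0 \<le> g" using dQ[OF st] Gm[OF st] by (simp_all add: z_def g_def)
    have "g \<le> L" using Gm[of 0 s] Gm[of t T] st G0 by (simp add: g_def L_def)
    have zi: "z = integral {s..t} q" using iq(1)[OF st] by (simp add: z_def Q_def)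
    have T1: "norm (exp (- z) - 1 + z) \<le> exp L * g\<^sup>2"
    proof -
      have "norm (exp (- z) - (\<Sum>i\<le>1. (- z) ^ i / fact i)) \<le> exp \<bar>Re (- z)\<bar> * (norm (- z) ^ Suc 1) / fact 1"
        by (rule Taylor_exp)
      also have "\<dots> \<le> exp L * g\<^sup>2"
        using zg \<open>g \<le> L\<close> abs_Re_le_cmod[of z] by (auto simp: power2_eq_square intro!: mult_mono)
      finally show ?thesis by (simp add: algebra_simps)
    qed
    have sub: "{s..t} \<subseteq> {0..T}" using st by auto
    have \<psi>i: "\<psi> integrable_on {s..t}" "(\<lambda>x. norm (\<psi> x)) integrable_on {s..t}" and qi: "q integrable_on {s..t}"
      using \<psi> q sub by (auto simp: absolutely_integrable_on_def intro: integrable_on_subinterval)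
    \<comment> \<open>The integrand \<open>\<psi> v - \<Phi> s * q v\<close> equals
      \<open>(\<Phi> v - \<Phi> s) * q v\<close>. The first factor is at most \<open>g\<close>, and
      the norm of the second integrates to \<open>g\<close>.\<close>
    have T2: "norm (\<Phi> t - \<Phi> s - \<Phi> s * z) \<le> g\<^sup>2"
    proof -
      have "((\<lambda>v. \<psi> v - \<Phi> s * q v) has_integral (\<Phi> t - \<Phi> s) - \<Phi> s * z) {s..t}"
      proof (rule has_integral_diff)
        show "(\<psi> has_integral \<Phi> t - \<Phi> s) {s..t}"
          using integrable_integral[OF \<psi>i(1)] i\<psi>(1)[OF st] st \<Phi>[of t] \<Phi>[of s] by simp
        show "((\<lambda>v. \<Phi> s * q v) has_integral \<Phi> s * z) {s..t}"
          unfolding zi by (intro has_integral_mult_right integrable_integral qi)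
      qed
      then have hi: "((\<lambda>v. (\<Phi> v - \<Phi> s) * q v) has_integral (\<Phi> t - \<Phi> s) - \<Phi> s * z) {s..t}"
        by (rule has_integral_eq[rotated]) (use sub \<psi>q in \<open>auto simp: algebra_simps\<close>)
      then have "norm (integral {s..t} (\<lambda>v. (\<Phi> v - \<Phi> s) * q v)) \<le> integral {s..t} (\<lambda>v. g * norm (\<psi> v))"
      proof (intro Henstock_Kurzweil_Integration.integral_norm_bound_integral)
        show "(\<lambda>v. g * norm (\<psi> v)) integrable_on {s..t}" using \<psi>i(2) by (rule integrable_on_mult_right)
        fix v assume v: "v \<in> {s..t}"
        have "norm (\<Phi> v - \<Phi> s) \<le> g" using d\<Phi>[of s v] Gm[of v t] v st by (simp add: g_def)
        then show "norm ((\<Phi> v - \<Phi> s) * q v) \<le> g * norm (\<psi> v)"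
          using nq[of v] v sub by (auto simp: norm_mult intro!: mult_right_mono)
      qed (use hi in blast)
      also have "\<dots> = g\<^sup>2"
      proof -
        have "integral {s..t} (\<lambda>v. norm (\<psi> v)) = g"
          using i\<psi>(4)[OF st] by (simp add: g_def G_def)
        then show ?thesis by (simp add: power2_eq_square)
      qed
      finally show ?thesis using hi by (simp add: integral_unique)
    qed
    have "norm (Q s) \<le> L"
      using dQ[of 0 s] Gm[of s T] st G0 by (simp add: Q_def L_def)
    then have nE: "norm (exp (- Q s)) \<le> exp L"
      using abs_Re_le_cmod[of "Q s"] by simp
    have eq: "P t - P s = exp (- Q s) * (\<Phi> t * (exp (- z) - 1 + z) + (\<Phi> t - \<Phi> s - \<Phi> s * z) - (\<Phi> t - \<Phi> s) * z)"
    proof -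
      have "exp (- Q t) = exp (- Q s) * exp (- z)" by (simp add: z_def flip: exp_add)
      then show ?thesis by (simp add: P_def algebra_simps)
    qed
    have "norm (\<Phi> t * (exp (- z) - 1 + z) + (\<Phi> t - \<Phi> s - \<Phi> s * z) - (\<Phi> t - \<Phi> s) * z) \<le> exp L * g\<^sup>2 + g\<^sup>2 + g * g"
    proof (rule order_trans[OF norm_triangle_ineq4] add_mono order_trans[OF norm_triangle_ineq])+
      show "norm (\<Phi> t * (exp (- z) - 1 + z)) \<le> exp L * g\<^sup>2" using T1 uni[of t] st by (simp add: norm_mult)
      show "norm ((\<Phi> t - \<Phi> s) * z) \<le> g * g" using zg d\<Phi>[OF st] by (auto simp: norm_mult g_def intro!: mult_mono)
    qed (rule T2)
    then have "norm (P t - P s) \<le> exp L * (exp L * g\<^sup>2 + g\<^sup>2 + g * g)"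
      unfolding eq norm_mult using nE by (intro mult_mono) auto
    then show "norm (P t - P s) \<le> exp L * (exp L + 2) * (G t - G s)\<^sup>2"
      unfolding g_def[symmetric] by (simp add: algebra_simps power2_eq_square)
  qed
  then have "\<Phi> t * exp (- Q t) * exp (Q t) = \<Phi> 0 * exp (Q t)" by (simp add: P_def Q_def)
  then have "\<Phi> t = \<Phi> 0 * exp (Q t)" by (simp add: mult.assoc flip: exp_add)
  then show ?thesis unfolding Q_def q_def .
qed

section \<open>Sobolev maps of the circle\<close>

lemma smooth_if_has_derivative:
  assumes "\<And>x. (f has_field_derivative f' x) (at x)" and "smooth f'"
  shows "smooth (f :: real \<Rightarrow> real)"
proof -
  have "C_diff (Suc k) f" for k
  proof (rule C_diff_SucI)
    show "(f has_derivative (\<lambda>v. f' x * v)) (at x)" for x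
      using assms(1)[of x] by (simp add: has_field_derivative_def)
    show "C_diff k (\<lambda>x. f' x * v)" for v
      using assms(2) by (intro C_diff_mult C_diff_const) (auto simp: smooth_def)
  qed
  then show ?thesis unfolding smooth_def using C_diff_SucD by blast
qed

lemma continuous_antiderivative_real:
  fixes f :: "real \<Rightarrow> real"
  assumes "continuous_on UNIV f"
  obtains F where "\<And>x. (F has_field_derivative f x) (at x)"
proof -
  have "\<exists>F. \<forall>x. -\<infinity> < ereal x \<longrightarrow> ereal x < \<infinity> \<longrightarrow> (F has_vector_derivative f x) (at x)"
    by (rule einterval_antiderivative) (use assms in \<open>auto simp: continuous_on_eq_continuous_at\<close>)
  then show ?thesis using that by (auto simp: has_real_derivative_iff_has_vector_derivative)
qed

text \<open>The increment of an antiderivative over one period does not depend on the starting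
  point, and the vanishing mean makes it 0.\<close>

lemma smooth_periodic_antiderivative:
  fixes \<zeta> :: "real \<Rightarrow> real"
  assumes \<zeta>: "smooth \<zeta>" "\<And>t. \<zeta> (t + 2 * pi) = \<zeta> t" and mean: "integral {0..2 * pi} \<zeta> = 0"
  obtains \<eta> where "smooth \<eta>" "\<And>t. \<eta> (t + 2 * pi) = \<eta> t" "\<And>t. (\<eta> has_field_derivative \<zeta> t) (at t)"
proof -
  obtain \<eta> where \<eta>: "\<And>t. (\<eta> has_field_derivative \<zeta> t) (at t)"
    using continuous_antiderivative_real[OF smooth_imp_continuous[OF \<zeta>(1)]] by metis
  have "((\<lambda>t. \<eta> (t + 2 * pi) - \<eta> t) has_field_derivative 0) (at t)" for t
  proof -
    have "((\<lambda>t. \<eta> (t + 2 * pi)) has_field_derivative \<zeta> (t + 2 * pi) * 1) (at t)"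
      by (rule DERIV_chain2[OF \<eta>]) (auto intro!: derivative_eq_intros)
    from DERIV_diff[OF this \<eta>] show ?thesis by (simp add: \<zeta>(2))
  qed
  then have const: "\<eta> (t + 2 * pi) - \<eta> t = \<eta> (0 + 2 * pi) - \<eta> 0" for t
    by (intro DERIV_isconst_all[of "\<lambda>t. \<eta> (t + 2 * pi) - \<eta> t"] allI)
  have "(\<zeta> has_integral \<eta> (2 * pi) - \<eta> 0) {0..2 * pi}"
    by (rule fundamental_theorem_of_calculus)
      (use \<eta> in \<open>auto simp: has_real_derivative_iff_has_vector_derivative intro: has_vector_derivative_at_within\<close>)
  then have "\<eta> (2 * pi) - \<eta> 0 = 0" using mean by (simp add: integral_unique)
  then have "\<eta> (t + 2 * pi) = \<eta> t" for t using const[of t] by simp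
  then show ?thesis using that \<eta> smooth_if_has_derivative[OF \<eta> \<zeta>(1)] by blast
qed

section \<open>Periodic test functions and the du Bois-Reymond lemma on the circle\<close>

text \<open>Cosine supplies the periodicity: within a period it exceeds its value at the ends of an
  arc exactly inside the arc. Midpoint and half length of the arc are \<open>(c + d) / 2\<close> and
  \<open>(d - c) / 2\<close>.\<close>

definition arc_bump :: "real \<Rightarrow> real \<Rightarrow> nat \<Rightarrow> real \<Rightarrow> real" where
  "arc_bump c d n t = bump (real n * (cos (t - (c + d) / 2) - cos ((d - c) / 2)))"

lemma smooth_arc_bump: "smooth (arc_bump c d n)"
proof -
  have "smooth (\<lambda>t. t + (- ((c + d) / 2)))"
    by (intro smooth_add smooth_const smooth_bounded_linear bounded_linear_ident)
  from smooth_compose_real[OF smooth_cos this]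
  have "smooth (\<lambda>t. real n * (cos (t + (- ((c + d) / 2))) + - cos ((d - c) / 2)))"
    by (intro smooth_mult smooth_add smooth_const)
  from smooth_compose_real[OF smooth_bump this]
  show ?thesis by (simp add: arc_bump_def[abs_def])
qed

lemma arc_bump_periodic: "arc_bump c d n (t + 2 * pi) = arc_bump c d n t"
proof -
  have "cos (t + 2 * pi - (c + d) / 2) = cos (t - (c + d) / 2)"
    using cos_periodic[of "t - (c + d) / 2"] by (simp add: algebra_simps)
  then show ?thesis by (simp add: arc_bump_def)
qed

lemma arc_bump_tendsto:
  assumes "0 \<le> c" "c \<le> d" "d \<le> 2 * pi" "t \<in> {0..2 * pi}"
  shows "(\<lambda>n. arc_bump c d n t) \<longlonglongrightarrow> indicator {c<..<d} t"
proof -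
  define m \<delta> where "m = (c + d) / 2" and "\<delta> = (d - c) / 2"
  have \<delta>: "0 \<le> \<delta>" "\<delta> \<le> pi" using assms by (auto simp: \<delta>_def)
  have *: "cos (t - m) - cos \<delta> > 0 \<longleftrightarrow> t \<in> {c<..<d}"
  proof
    assume "t \<in> {c<..<d}"
    then have "\<bar>t - m\<bar> < \<delta>" by (auto simp: m_def \<delta>_def abs_if field_simps)
    then have "cos \<delta> < cos \<bar>t - m\<bar>" using \<delta> by (intro cos_monotone_0_pi) auto
    then show "cos (t - m) - cos \<delta> > 0" by simp
  next
    assume pos: "cos (t - m) - cos \<delta> > 0"
    show "t \<in> {c<..<d}"
    proof (rule ccontr)
      assume "t \<notin> {c<..<d}"
      then have ge: "\<bar>t - m\<bar> \<ge> \<delta>" by (auto simp: m_def \<delta>_def abs_if field_simps)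
      \<comment> \<open>This uses \<open>0 \<le> c\<close> and \<open>d \<le> 2 * pi\<close>: the
        distance to the midpoint, measured the other way around the circle, is still at least
        \<open>\<delta>\<close>.\<close>
      have le: "\<bar>t - m\<bar> \<le> 2 * pi - \<delta>" using assms by (auto simp: m_def \<delta>_def abs_if field_simps)
      have "cos \<bar>t - m\<bar> \<le> cos \<delta>"
      proof (cases "\<bar>t - m\<bar> \<le> pi")
        case True
        then show ?thesis using ge \<delta> by (intro cos_monotone_0_pi_le) auto
      next
        case False
        then have "cos (2 * pi - \<bar>t - m\<bar>) \<le> cos \<delta>" using le \<delta> by (intro cos_monotone_0_pi_le) auto
        then show ?thesis by (simp add: cos_diff)
      qed
      then show False using pos by simp
    qed
  qed
  have eq: "(if 0 < cos (t - m) - cos \<delta> then 1 else 0) = (indicator {c<..<d} t :: real)"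
    using * by (simp add: indicator_def)
  have "(\<lambda>n. bump (real n * (cos (t - m) - cos \<delta>))) \<longlonglongrightarrow> indicator {c<..<d} t"
    using bump_tendsto[of "cos (t - m) - cos \<delta>"] unfolding eq .
  then show ?thesis by (simp only: arc_bump_def m_def \<delta>_def)
qed

text \<open>Subtracting its mean makes any periodic test function admissible, and the correction can
  be moved onto \<open>w\<close> as the subtraction of the mean of \<open>w\<close>. Hence
  \<open>w\<close> minus its mean is orthogonal to all periodic test functions, in particular to
  approximations of arc indicators.\<close>

lemma AE_constant_if_periodic_test_zero:
  fixes w :: "real \<Rightarrow> 'b::euclidean_space"
  assumes w: "integrable angles w"
    and test: "\<And>\<zeta>. smooth \<zeta> \<Longrightarrow> (\<And>t. \<zeta> (t + 2 * pi) = \<zeta> t) \<Longrightarrow> integral {0..2 * pi} \<zeta> = 0 \<Longrightarrow>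
        (LINT t|angles. \<zeta> t *\<^sub>R w t) = 0"
  shows "AE t in angles. w t = (1 / (2 * pi)) *\<^sub>R (LINT s|angles. w s)"
proof -
  define W where "W = (1 / (2 * pi)) *\<^sub>R (LINT s|angles. w s)"
  interpret finite_measure angles by (rule finite_measure_lebesgue_on) simp
  have mA: "measure angles {0..2 * pi} = 2 * pi"
    by (simp add: measure_restrict_space)
  have int_mult: "integrable angles (\<lambda>t. \<zeta> t *\<^sub>R f t)"
    if "integrable angles f" "continuous_on UNIV \<zeta>" for f :: "real \<Rightarrow> 'c::euclidean_space" and \<zeta> :: "real \<Rightarrow> real"
    using absolutely_integrable_bilinear[OF bounded_bilinear_scaleR continuous_on_subset[OF that(2) subset_UNIV], where g = f] that(1)
    by (simp add: absolutely_integrable_on_iff_integrable)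
  have test0: "(LINT t|angles. \<zeta> t *\<^sub>R (w t - W)) = 0"
    if \<zeta>: "smooth \<zeta>" "\<And>t. \<zeta> (t + 2 * pi) = \<zeta> t" for \<zeta>
  proof -
    have c\<zeta>: "continuous_on UNIV \<zeta>" by (rule smooth_imp_continuous[OF \<zeta>(1)])
    have i\<zeta>: "integrable angles \<zeta>" using int_mult[OF integrable_const[of "1::real"] c\<zeta>] by simp
    define \<mu> where "\<mu> = (1 / (2 * pi)) * (LINT t|angles. \<zeta> t)"
    have "(LINT t|angles. (\<zeta> t + - \<mu>) *\<^sub>R w t) = 0"
    proof (rule test)
      show "smooth (\<lambda>t. \<zeta> t + - \<mu>)" by (intro smooth_add \<zeta> smooth_const)
      show "\<zeta> (t + 2 * pi) + - \<mu> = \<zeta> t + - \<mu>" for t by (simp add: \<zeta>)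
      have "integral {0..2 * pi} (\<lambda>t. \<zeta> t + - \<mu>) = (LINT t|angles. \<zeta> t + - \<mu>)"
        by (rule lebesgue_integral_eq_integral[symmetric]) (use i\<zeta> in auto)
      also have "\<dots> = 0" using i\<zeta> by (simp add: mA \<mu>_def)
      finally show "integral {0..2 * pi} (\<lambda>t. \<zeta> t + - \<mu>) = 0" .
    qed
    then have "(LINT t|angles. \<zeta> t *\<^sub>R w t) = \<mu> *\<^sub>R (LINT t|angles. w t)"
      using int_mult[OF w c\<zeta>] w by (simp add: scaleR_left_diff_distrib)
    moreover have "(LINT t|angles. \<zeta> t *\<^sub>R W) = (LINT t|angles. \<zeta> t) *\<^sub>R W" using i\<zeta> by simp
    ultimately show ?thesis
      using int_mult[OF w c\<zeta>] i\<zeta> by (simp add: scaleR_diff_right W_def \<mu>_def mult.commute)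
  qed
  have iw: "integrable angles (\<lambda>t. w t - W)" using w by simp
  have meas: "(\<lambda>t. indicat_real {u<..<v} t *\<^sub>R (w t - W)) \<in> borel_measurable angles" for u v
  proof -
    have "{u<..<v} \<inter> {0..2 * pi} \<in> sets angles" by (subst sets_restrict_space_iff) auto
    then have "(\<lambda>t. indicat_real ({u<..<v} \<inter> {0..2 * pi}) t *\<^sub>R (w t - W)) \<in> borel_measurable angles"
      using iw by (intro borel_measurable_scaleR borel_measurable_indicator borel_measurable_integrable)
    moreover have "(\<lambda>t. indicat_real ({u<..<v} \<inter> {0..2 * pi}) t *\<^sub>R (w t - W)) \<in> borel_measurable angles \<longleftrightarrow>
        (\<lambda>t. indicat_real {u<..<v} t *\<^sub>R (w t - W)) \<in> borel_measurable angles"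
      by (rule measurable_cong) (simp add: indicator_def)
    ultimately show ?thesis by (rule iffD1[rotated])
  qed
  have open_arc: "(LINT t|angles. indicator {c<..<d} t *\<^sub>R (w t - W)) = 0" if cd: "0 \<le> c" "c \<le> d" "d \<le> 2 * pi" for c d
  proof -
    have "(\<lambda>n. LINT t|angles. arc_bump c d n t *\<^sub>R (w t - W)) \<longlonglongrightarrow> (LINT t|angles. indicator {c<..<d} t *\<^sub>R (w t - W))"
    proof (rule integral_dominated_convergence)
      show "integrable angles (\<lambda>t. norm (w t - W))" using iw by (rule integrable_norm)
      show "(\<lambda>t. arc_bump c d n t *\<^sub>R (w t - W)) \<in> borel_measurable angles" for n
        by (rule borel_measurable_integrable[OF int_mult[OF iw smooth_imp_continuous[OF smooth_arc_bump]]])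
      show "(\<lambda>t. indicat_real {c<..<d} t *\<^sub>R (w t - W)) \<in> borel_measurable angles"
        by (rule meas)
      show "AE t in angles. (\<lambda>n. arc_bump c d n t *\<^sub>R (w t - W)) \<longlonglongrightarrow> indicat_real {c<..<d} t *\<^sub>R (w t - W)"
        by (intro AE_I2 tendsto_scaleR tendsto_const arc_bump_tendsto cd) simp
      show "AE t in angles. norm (arc_bump c d n t *\<^sub>R (w t - W)) \<le> norm (w t - W)" for n
        by (intro AE_I2) (simp add: arc_bump_def bump_nonneg bump_le_1 mult_left_le_one_le)
    qed
    moreover have "(LINT t|angles. arc_bump c d n t *\<^sub>R (w t - W)) = 0" for n
      by (rule test0[OF smooth_arc_bump arc_bump_periodic])
    ultimately show ?thesis by (simp add: LIMSEQ_const_iff)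
  qed
  have "AE t in lebesgue_on (cbox 0 (2 * pi)). w t - W = 0"
  proof (rule AE_zero_if_box_integrals_zero)
    show "integrable (lebesgue_on (cbox 0 (2 * pi))) (\<lambda>t. w t - W)" using iw by simp
    fix c d :: real
    \<comment> \<open>The interval is clipped to one period. The maximum in \<open>d'\<close> keeps
      the endpoints ordered when the clipped interval is empty.\<close>
    define c' d' where "c' = max 0 c" and "d' = max c' (min d (2 * pi))"
    show "(LINT t:box c d|lebesgue_on (cbox 0 (2 * pi)). w t - W) = 0"
    proof (cases "c' \<le> 2 * pi")
      case True
      have "AE t in lebesgue. t \<notin> {0, 2 * pi}" by (intro AE_not_in) (simp add: negligible_iff_null_sets[symmetric])
      then have "AE t in angles. t \<notin> {0, 2 * pi}" by (subst AE_restrict_space_iff) auto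
      then have "AE t in angles. indicat_real {c<..<d} t *\<^sub>R (w t - W) = indicat_real {c'<..<d'} t *\<^sub>R (w t - W)"
        using AE_space by eventually_elim (auto simp: indicator_def c'_def d'_def)
      then have "(LINT t|angles. indicator {c<..<d} t *\<^sub>R (w t - W)) = (LINT t|angles. indicator {c'<..<d'} t *\<^sub>R (w t - W))"
        by (intro integral_cong_AE meas)
      also have "\<dots> = 0" by (rule open_arc) (use True in \<open>auto simp: c'_def d'_def\<close>)
      finally show ?thesis by (simp add: set_lebesgue_integral_def)
    next
      case False
      have "(LINT t:box c d|lebesgue_on (cbox 0 (2 * pi)). w t - W) = (LINT t|angles. 0)"
        unfolding set_lebesgue_integral_def
        by (rule Bochner_Integration.integral_cong) (use False in \<open>auto simp: c'_def indicator_def\<close>)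
      then show ?thesis by simp
    qed
  qed
  then show ?thesis unfolding W_def right_minus_eq cbox_interval .
qed

text \<open>The constant 1 is a periodic test function. As a consequence the primitive of
  \<open>\<psi>\<close> closes up after one turn.\<close>

lemma has_weak_tangential_mean_zero:
  assumes "has_weak_tangential \<phi> \<psi>"
  shows "integral {0..2 * pi} (\<lambda>s. \<psi> (cis s)) = 0"
proof -
  have i: "integrable angles (\<lambda>t. \<psi> (cis t))" using assms by (simp add: has_weak_tangential_def)
  have "(LINT t|angles. deriv (\<lambda>_. 1::real) t *\<^sub>R \<phi> (cis t)) = - (LINT t|angles. 1 *\<^sub>R \<psi> (cis t))"
    using assms smooth_const unfolding has_weak_tangential_def by blast
  then have "(LINT t|angles. \<psi> (cis t)) = 0" by simp
  then show ?thesis using lebesgue_integral_eq_integral[OF i] by simp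
qed

text \<open>A test function of mean zero is the derivative of a periodic \<open>\<eta>\<close>.
  Paired with \<open>\<phi>\<close>, by definition, or with the primitive \<open>Q\<close>, by
  parts, it gives the same value, because the boundary term carries \<open>Q (2 * pi) = 0\<close>.
  So the difference is constant.\<close>

lemma has_weak_tangential_AE_eq_indefinite_integral:
  assumes T: "has_weak_tangential \<phi> \<psi>"
  obtains c where "AE t in angles. \<phi> (cis t) = c + integral {0..t} (\<lambda>s. \<psi> (cis s))"
proof -
  define p q where "p t = \<phi> (cis t)" and "q t = \<psi> (cis t)" for t
  define Q where "Q t = integral {0..t} q" for t
  have ip: "integrable angles p" and iq: "integrable angles q"
    using T by (simp_all add: has_weak_tangential_def p_def[abs_def] q_def[abs_def])
  have aq: "q absolutely_integrable_on {0..2 * pi}" using iq by (simp add: absolutely_integrable_on_iff_integrable)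
  have cQ: "continuous_on {0..2 * pi} Q" unfolding Q_def by (rule indefinite_integral_continuous_AC(1)[OF aq])
  then have aQ: "Q absolutely_integrable_on {0..2 * pi}" by (rule absolutely_integrable_continuous_real)
  then have iQ: "integrable angles Q" by (simp add: absolutely_integrable_on_iff_integrable)
  have iw: "integrable angles (\<lambda>t. p t - Q t)" using ip iQ by simp
  have "AE t in angles. p t - Q t = (1 / (2 * pi)) *\<^sub>R (LINT s|angles. p s - Q s)"
  proof (rule AE_constant_if_periodic_test_zero[OF iw])
    fix \<zeta> :: "real \<Rightarrow> real" assume \<zeta>: "smooth \<zeta>" "\<And>t. \<zeta> (t + 2 * pi) = \<zeta> t" "integral {0..2 * pi} \<zeta> = 0"
    obtain \<eta> where \<eta>: "smooth \<eta>" "\<And>t. \<eta> (t + 2 * pi) = \<eta> t" "\<And>t. (\<eta> has_field_derivative \<zeta> t) (at t)"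
      using smooth_periodic_antiderivative[OF \<zeta>] by blast
    have d\<eta>: "deriv \<eta> t = \<zeta> t" for t using \<eta>(3) by (rule DERIV_imp_deriv)
    have c\<zeta>: "continuous_on S \<zeta>" for S using smooth_imp_continuous[OF \<zeta>(1)] continuous_on_subset by blast
    have c\<eta>: "continuous_on S \<eta>" for S using smooth_imp_continuous[OF \<eta>(1)] continuous_on_subset by blast
    have "(LINT t|angles. deriv \<eta> t *\<^sub>R \<phi> (cis t)) = - (LINT t|angles. \<eta> t *\<^sub>R \<psi> (cis t))"
      using T \<eta>(1,2) unfolding has_weak_tangential_def by blast
    then have 1: "(LINT t|angles. \<zeta> t *\<^sub>R p t) = - (LINT t|angles. \<eta> t *\<^sub>R q t)"
      by (simp add: d\<eta> p_def q_def)
    have a1: "(\<lambda>t. \<zeta> t *\<^sub>R p t) absolutely_integrable_on {0..2 * pi}"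
      using absolutely_integrable_bilinear[OF bounded_bilinear_scaleR c\<zeta>] ip by (simp add: absolutely_integrable_on_iff_integrable)
    have a2: "(\<lambda>t. \<zeta> t *\<^sub>R Q t) absolutely_integrable_on {0..2 * pi}"
      by (rule absolutely_integrable_bilinear[OF bounded_bilinear_scaleR c\<zeta> aQ])
    have a3: "(\<lambda>t. \<eta> t *\<^sub>R q t) absolutely_integrable_on {0..2 * pi}"
      by (rule absolutely_integrable_bilinear[OF bounded_bilinear_scaleR c\<eta> aq])
    have parts: "\<eta> (2 * pi) *\<^sub>R Q (2 * pi) - \<eta> 0 *\<^sub>R (0::'a) =
        integral {0..2 * pi} (\<lambda>t. \<zeta> t *\<^sub>R Q t) + integral {0..2 * pi} (\<lambda>t. \<eta> t *\<^sub>R q t)"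
    proof (rule integral_by_parts_AC[OF bounded_bilinear_scaleR _ _ aq])
      show "\<zeta> absolutely_integrable_on {0..2 * pi}" by (rule absolutely_integrable_continuous_real[OF c\<zeta>])
      show "Q t = 0 + integral {0..t} q" for t by (simp add: Q_def)
      show "\<eta> t = \<eta> 0 + integral {0..t} \<zeta>" if "t \<in> {0..2 * pi}" for t
      proof -
        have "(\<zeta> has_integral \<eta> t - \<eta> 0) {0..t}"
          by (rule fundamental_theorem_of_calculus)
            (use \<eta>(3) that in \<open>auto simp: has_real_derivative_iff_has_vector_derivative intro: has_vector_derivative_at_within\<close>)
        then show ?thesis by (simp add: integral_unique)
      qed
    qed simp
    have "Q (2 * pi) = 0" using has_weak_tangential_mean_zero[OF T] by (simp add: Q_def q_def[abs_def])
    then have 2: "(LINT t|angles. \<zeta> t *\<^sub>R Q t) = - (LINT t|angles. \<eta> t *\<^sub>R q t)"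
      using parts a2 a3 by (simp add: absolutely_integrable_on_iff_integrable lebesgue_integral_eq_integral eq_neg_iff_add_eq_0)
    have "(LINT t|angles. \<zeta> t *\<^sub>R (p t - Q t)) = (LINT t|angles. \<zeta> t *\<^sub>R p t) - (LINT t|angles. \<zeta> t *\<^sub>R Q t)"
      unfolding scaleR_diff_right
      by (rule Bochner_Integration.integral_diff) (use a1 a2 in \<open>simp_all add: absolutely_integrable_on_iff_integrable\<close>)
    then show "(LINT t|angles. \<zeta> t *\<^sub>R (p t - Q t)) = 0" using 1 2 by simp
  qed
  then have "AE t in angles. \<phi> (cis t) = (1 / (2 * pi)) *\<^sub>R (LINT s|angles. p s - Q s) + integral {0..t} (\<lambda>s. \<psi> (cis s))"
    by eventually_elim (simp add: p_def Q_def q_def[abs_def] algebra_simps)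
  then show ?thesis using that by blast
qed

section \<open>The harmonic extension of the phase\<close>

text \<open>The exceptional null set may depend on the point \<open>x\<close>. This matters on the
  circle, where the argument kernel is discontinuous at the angles that point to
  \<open>x\<close>.\<close>

lemma continuous_on_integral_dominated:
  fixes k :: "'a::metric_space \<Rightarrow> 'b \<Rightarrow> 'c::{banach, second_countable_topology}"
  assumes w: "integrable M w"
    and meas: "\<And>x. x \<in> S \<Longrightarrow> k x \<in> borel_measurable M"
    and bound: "\<And>x t. x \<in> S \<Longrightarrow> t \<in> space M \<Longrightarrow> norm (k x t) \<le> w t"
    and cont: "\<And>x. x \<in> S \<Longrightarrow> AE t in M. continuous (at x within S) (\<lambda>y. k y t)"
  shows "continuous_on S (\<lambda>x. LINT t|M. k x t)"
  unfolding continuous_on_sequentially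
proof (intro ballI allI impI, elim conjE)
  fix u x assume x: "x \<in> S" and u: "\<forall>n. u n \<in> S" "u \<longlonglongrightarrow> x"
  have "(\<lambda>n. LINT t|M. k (u n) t) \<longlonglongrightarrow> (LINT t|M. k x t)"
  proof (rule integral_dominated_convergence[OF _ _ w])
    show "AE t in M. (\<lambda>n. k (u n) t) \<longlonglongrightarrow> k x t"
      using cont[OF x] by eventually_elim (use u in \<open>auto simp: continuous_within_sequentially o_def\<close>)
  qed (use u x meas bound in auto)
  then show "((\<lambda>x. LINT t|M. k x t) \<circ> u) \<longlonglongrightarrow> (LINT t|M. k x t)" by (simp add: o_def)
qed

text \<open>On the closed disk \<open>1 - x * cis (- t)\<close> lies in the right half plane, so \<open>arg_kernel x t\<close> is its
  principal argument; at \<open>x = cis t\<close> it is \<open>0\<close> because \<open>0 / 0 = 0\<close>.\<close>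

definition arg_kernel :: "complex \<Rightarrow> real \<Rightarrow> real" where
  "arg_kernel x t = arctan (Im (1 - x * cis (- t)) / Re (1 - x * cis (- t)))"

lemma arg_kernel_bound: "\<bar>arg_kernel x t\<bar> \<le> pi / 2"
  using arctan_bounded[of "Im (1 - x * cis (- t)) / Re (1 - x * cis (- t))"] by (auto simp: arg_kernel_def)

lemma abs_mult_arg_kernel_le: "\<bar>c * arg_kernel x t\<bar> \<le> \<bar>c\<bar> * (pi / 2)"
  unfolding abs_mult by (rule mult_left_mono[OF arg_kernel_bound abs_ge_zero])

lemma borel_measurable_cis [measurable]: "cis \<in> borel_measurable borel"
  by (intro borel_measurable_continuous_onI continuous_intros)

lemma measurable_angles_borel: "f \<in> borel_measurable borel \<Longrightarrow> f \<in> borel_measurable angles"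
  by (simp add: measurable_completion measurable_restrict_space1)

lemma arg_kernel_measurable: "arg_kernel x \<in> borel_measurable angles"
proof (rule measurable_angles_borel)
  have "(\<lambda>t. cis (- t)) \<in> borel_measurable borel" by measurable
  then show "arg_kernel x \<in> borel_measurable borel"
    unfolding arg_kernel_def[abs_def]
    by (intro borel_measurable_continuous_on[where f = arctan] borel_measurable_divide
        measurable_compose[OF _ borel_measurable_Im] measurable_compose[OF _ borel_measurable_Re] borel_measurable_diff borel_measurable_times borel_measurable_const)
      (auto intro: continuous_intros)
qed

lemma Re_one_minus_pos:
  assumes "norm w \<le> 1" "w \<noteq> 1" shows "Re (1 - w) > 0"
proof (rule ccontr)
  assume "\<not> Re (1 - w) > 0"
  then have "Re w \<ge> 1" by simp
  moreover have "Re w \<le> norm w" by (rule complex_Re_le_cmod)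
  ultimately have R: "Re w = 1" "norm w = 1" using assms(1) by auto
  then have "Im w = 0" using cmod_power2[of w] by simp
  with R have "w = 1" by (simp add: complex_eq_iff)
  then show False using assms(2) by simp
qed

lemma mult_cis_eq_1_iff: "x * cis (- t) = 1 \<longleftrightarrow> x = cis t"
proof
  assume "x * cis (- t) = 1"
  then have "x * cis (- t) * cis t = cis t" by simp
  then show "x = cis t" by (simp add: cis_mult mult.assoc)
qed (simp add: cis_mult)

lemma arg_kernel_eq_Im_Ln:
  assumes "norm x < 1" shows "arg_kernel x t = Im (Ln (1 - x * cis (- t)))"
proof -
  have n: "norm (x * cis (- t)) < 1" using assms by (simp add: norm_mult)
  then have "x * cis (- t) \<noteq> 1" by (metis norm_one less_irrefl)
  then have "Re (1 - x * cis (- t)) > 0" using n by (intro Re_one_minus_pos) auto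
  then have "Arg (1 - x * cis (- t)) = arg_kernel x t"
    unfolding arg_kernel_def by (rule arg_conv_arctan)
  moreover have "1 - x * cis (- t) \<noteq> 0" using \<open>x * cis (- t) \<noteq> 1\<close> by simp
  ultimately show ?thesis by (simp add: Arg_eq_Im_Ln)
qed

text \<open>At most two parameters hit \<open>x\<close>: its argument in the half-open period, and
  the right endpoint \<open>2 * pi\<close>, which the argument never attains.\<close>

lemma AE_angles_cis_neq: "AE t in angles. cis t \<noteq> x"
proof -
  have "t \<in> {Arg2pi x, 2 * pi}" if "t \<in> {0..2 * pi}" "cis t = x" for t
  proof (cases "t = 2 * pi")
    case False
    then have "Arg2pi x = t" using that by (intro Arg2pi_unique[of 1]) (auto simp: cis_conv_exp mult.commute)
    then show ?thesis by simp
  qed simp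
  moreover have "AE t in angles. t \<notin> {Arg2pi x, 2 * pi}"
  proof -
    have "AE t in lebesgue. t \<notin> {Arg2pi x, 2 * pi}"
      by (intro AE_not_in) (simp add: negligible_iff_null_sets[symmetric])
    then show ?thesis by (subst AE_restrict_space_iff) auto
  qed
  ultimately show ?thesis
    using AE_space[of angles] by (auto elim!: eventually_elim2)
qed

section \<open>The harmonic phase and its Cauchy integral\<close>

text \<open>Up to its factor, this is the harmonic conjugate of the logarithmic potential of
  \<open>f\<close>. The factor \<open>- (1 / pi)\<close> scales the jump of the kernel to height 1,
  so that the primitive of \<open>f\<close> appears on the circle.\<close>

definition conj_ext :: "(real \<Rightarrow> real) \<Rightarrow> complex \<Rightarrow> real" where
  "conj_ext f x = - (1 / pi) * (LINT t|angles. f t * arg_kernel x t)"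

text \<open>A Cauchy integral: inside the disk \<open>conj_ext f\<close> is the imaginary part of a
  holomorphic function with this derivative.\<close>

definition conj_ext_deriv :: "(real \<Rightarrow> real) \<Rightarrow> complex \<Rightarrow> complex" where
  "conj_ext_deriv f x = complex_of_real (1 / pi) * (LINT t|angles. complex_of_real (f t) / (cis t - x))"

lemma integrable_mult_arg_kernel:
  assumes "integrable angles f" shows "integrable angles (\<lambda>t. f t * arg_kernel x t)"
proof (rule Bochner_Integration.integrable_bound)
  show "integrable angles (\<lambda>t. f t * (pi / 2))" using assms by simp
  show "(\<lambda>t. f t * arg_kernel x t) \<in> borel_measurable angles"
    using assms by (intro borel_measurable_times arg_kernel_measurable borel_measurable_integrable)
  show "AE t in angles. norm (f t * arg_kernel x t) \<le> norm (f t * (pi / 2))"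
    using abs_mult_arg_kernel_le[of "f _"] by (intro AE_I2) (simp add: abs_mult)
qed

text \<open>The bound \<open>pi / 2\<close> on the kernel is uniform up to the circle, and for each
  \<open>x\<close>, also on the circle, the kernel is continuous at \<open>x\<close> for almost
  every angle.\<close>

lemma continuous_on_conj_ext:
  assumes f: "integrable angles f" shows "continuous_on (cball 0 1) (conj_ext f)"
proof -
  have "continuous_on (cball 0 1) (\<lambda>x. LINT t|angles. f t * arg_kernel x t)"
  proof (rule continuous_on_integral_dominated)
    show "integrable angles (\<lambda>t. \<bar>f t\<bar> * (pi / 2))" using f by simp
    show "(\<lambda>t. f t * arg_kernel x t) \<in> borel_measurable angles" for x
      by (rule borel_measurable_integrable[OF integrable_mult_arg_kernel[OF f]])
    show "norm (f t * arg_kernel x t) \<le> \<bar>f t\<bar> * (pi / 2)" for x t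
      using abs_mult_arg_kernel_le[of "f t"] by simp
    fix x :: complex assume x: "x \<in> cball 0 1"
    show "AE t in angles. continuous (at x within cball 0 1) (\<lambda>y. f t * arg_kernel y t)"
      using AE_angles_cis_neq[of x]
    proof eventually_elim
      fix t assume t: "cis t \<noteq> x"
      have "Re (1 - x * cis (- t)) > 0"
        using x t by (intro Re_one_minus_pos) (auto simp: norm_mult mult_cis_eq_1_iff)
      then show "continuous (at x within cball 0 1) (\<lambda>y. f t * arg_kernel y t)"
        unfolding arg_kernel_def by (auto intro!: continuous_intros)
    qed
  qed
  then show ?thesis unfolding conj_ext_def[abs_def] by (intro continuous_intros)
qed

lemma norm_cis_diff_ge: "norm (cis t - x) \<ge> 1 - norm x"
  using norm_triangle_ineq2[of "cis t" x] by simp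

lemma measurable_conj_ext_deriv:
  assumes f: "integrable angles f"
  shows "(\<lambda>t. complex_of_real (f t) / (cis t - x)) \<in> borel_measurable angles"
  using f by (intro borel_measurable_divide borel_measurable_diff borel_measurable_of_real
      borel_measurable_integrable measurable_angles_borel[OF borel_measurable_cis] borel_measurable_const) auto

lemma integrable_conj_ext_deriv:
  assumes f: "integrable angles f" and x: "norm x < 1"
  shows "integrable angles (\<lambda>t. complex_of_real (f t) / (cis t - x))"
proof (rule Bochner_Integration.integrable_bound)
  show "integrable angles (\<lambda>t. f t / (1 - norm x))" using f by simp
  show "AE t in angles. norm (complex_of_real (f t) / (cis t - x)) \<le> norm (f t / (1 - norm x))"
    using x norm_cis_diff_ge[of x] by (intro AE_I2) (auto simp: norm_divide intro!: divide_left_mono mult_pos_pos)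
qed (rule measurable_conj_ext_deriv[OF f])

lemma continuous_on_conj_ext_deriv:
  assumes f: "integrable angles f" shows "continuous_on (ball 0 1) (conj_ext_deriv f)"
proof -
  \<comment> \<open>The dominating function blows up at the circle, so continuity is obtained on
    each smaller disk.\<close>
  have *: "continuous_on (ball 0 \<rho>) (conj_ext_deriv f)" if \<rho>: "\<rho> < 1" for \<rho>
  proof -
    have far: "norm (cis t - x) \<ge> 1 - \<rho>" if "x \<in> ball 0 \<rho>" for x t
      using norm_cis_diff_ge[of x t] that by simp
    have "continuous_on (ball 0 \<rho>) (\<lambda>x. LINT t|angles. complex_of_real (f t) / (cis t - x))"
    proof (rule continuous_on_integral_dominated)
      show "integrable angles (\<lambda>t. \<bar>f t\<bar> / (1 - \<rho>))" using f by simp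
      show "norm (complex_of_real (f t) / (cis t - x)) \<le> \<bar>f t\<bar> / (1 - \<rho>)" if "x \<in> ball 0 \<rho>" for x t
        using far[OF that, of t] \<rho> by (auto simp: norm_divide intro!: divide_left_mono mult_pos_pos)
      show "AE t in angles. continuous (at x within ball 0 \<rho>) (\<lambda>y. complex_of_real (f t) / (cis t - y))"
        if "x \<in> ball 0 \<rho>" for x
      proof (rule AE_I2)
        fix t
        have "cis t - x \<noteq> 0" using far[OF that, of t] \<rho> by force
        then show "continuous (at x within ball 0 \<rho>) (\<lambda>y. complex_of_real (f t) / (cis t - y))"
          by (intro continuous_intros)
      qed
    qed (rule measurable_conj_ext_deriv[OF f])
    then show ?thesis unfolding conj_ext_deriv_def[abs_def] by (intro continuous_intros)
  qed
  have "isCont (conj_ext_deriv f) x" if x: "x \<in> ball 0 1" for x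
  proof -
    have "x \<in> ball 0 ((1 + norm x) / 2)" "(1 + norm x) / 2 < 1" using x by auto
    then show ?thesis using * continuous_on_eq_continuous_at[OF open_ball] by blast
  qed
  then show ?thesis by (intro continuous_at_imp_continuous_on ballI)
qed

text \<open>Taylor's formula for the holomorphic logarithm, of which the kernel is the imaginary
  part. Staying within \<open>r\<close>, half the distance of \<open>x\<close> to the circle, keeps
  \<open>norm (1 - z * c) \<ge> r\<close>; the second derivative is then at most
  \<open>1 / r^2 = 4 / (1 - norm x)^2\<close>, uniformly in the angle.\<close>

lemma arg_kernel_Taylor:
  assumes x: "norm x < 1" and y: "dist y x < (1 - norm x) / 2"
  shows "\<bar>arg_kernel y t - arg_kernel x t + Im ((y - x) / (cis t - x))\<bar> \<le> 4 / (1 - norm x)\<^sup>2 * (norm (y - x))\<^sup>2"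
proof -
  define r where "r = (1 - norm x) / 2"
  define c where "c = cis (- t)"
  \<comment> \<open>The logarithm and its first two derivatives; only the indices 0, 1 and 2
    occur.\<close>
  define k :: "nat \<Rightarrow> complex \<Rightarrow> complex" where
    "k i z = (if i = 0 then Ln (1 - z * c) else if i = 1 then - c / (1 - z * c) else - c\<^sup>2 / (1 - z * c)\<^sup>2)" for i z
  have r: "r > 0" using x by (simp add: r_def)
  have nc: "norm c = 1" by (simp add: c_def)
  have inS: "norm z < 1 - r" if "z \<in> ball x r" for z
    using that norm_triangle_ineq2[of z x] by (auto simp: r_def dist_norm norm_minus_commute field_simps)
  have far: "norm (1 - z * c) \<ge> r" if "z \<in> ball x r" for z
    using norm_triangle_ineq2[of 1 "z * c"] inS[OF that] by (simp add: norm_mult nc)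
  have "norm (k 0 y - (\<Sum>i\<le>1. k i x * (y - x) ^ i / fact i)) \<le> 1 / r\<^sup>2 * norm (y - x) ^ Suc 1 / fact 1"
  proof (rule complex_Taylor[of "ball x r"])
    show "(k i has_field_derivative k (Suc i) z) (at z within ball x r)" if z: "z \<in> ball x r" and "i \<le> 1" for i z
    proof -
      have "norm (z * c) < 1" using inS[OF z] r by (simp add: norm_mult nc)
      moreover from this have "z * c \<noteq> 1" by (metis norm_one less_irrefl)
      ultimately have "Re (1 - z * c) > 0" by (intro Re_one_minus_pos) auto
      then have nz: "1 - z * c \<notin> \<real>\<^sub>\<le>\<^sub>0" by (auto simp: complex_nonpos_Reals_iff)
      have nz': "1 - z * c \<noteq> 0" using \<open>z * c \<noteq> 1\<close> by simp
      consider "i = 0" | "i = 1" using \<open>i \<le> 1\<close> by linarith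
      then show ?thesis
      proof cases
        case 1
        have "((\<lambda>z. Ln (1 - z * c)) has_field_derivative - c / (1 - z * c)) (at z within ball x r)"
          using nz nz' by (auto intro!: derivative_eq_intros simp: field_simps)
        then show ?thesis using 1 by (simp add: k_def[abs_def])
      next
        case 2
        have "((\<lambda>z. - c / (1 - z * c)) has_field_derivative - c\<^sup>2 / (1 - z * c)\<^sup>2) (at z within ball x r)"
          using nz nz' by (auto intro!: derivative_eq_intros simp: power2_eq_square)
        then show ?thesis using 2 by (simp add: k_def[abs_def])
      qed
    qed
    show "norm (k (Suc 1) z) \<le> 1 / r\<^sup>2" if "z \<in> ball x r" for z
    proof -
      have "r\<^sup>2 \<le> (norm (1 - z * c))\<^sup>2" using far[OF that] r by (intro power_mono) auto
      then show ?thesis using r by (simp add: k_def norm_divide norm_power nc frac_le)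
    qed
  qed (use r y in \<open>auto simp: r_def dist_commute\<close>)
  also have "(\<Sum>i\<le>1. k i x * (y - x) ^ i / fact i) = k 0 x + k 1 x * (y - x)" by simp
  finally have *: "norm (k 0 y - k 0 x - k 1 x * (y - x)) \<le> 4 / (1 - norm x)\<^sup>2 * (norm (y - x))\<^sup>2"
    by (simp add: r_def power_divide diff_diff_eq power2_eq_square)
  have "k 1 x * (y - x) = - ((y - x) / (cis t - x))"
  proof -
    have "cis t * c = 1" by (simp add: c_def cis_mult)
    then have "(1 - x * c) * cis t = cis t - x" by (simp add: algebra_simps)
    moreover have "1 - x * c \<noteq> 0" using far[of x] r by auto
    ultimately have "c / (1 - x * c) = 1 / (cis t - x)"
      using \<open>cis t * c = 1\<close> by (metis mult.commute mult_cancel_right1 nonzero_mult_divide_mult_cancel_right2 cis_neq_zero)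
    then show ?thesis by (simp add: k_def)
  qed
  moreover have "norm y < 1"
  proof -
    have "y \<in> ball x r" using y by (simp add: r_def dist_commute)
    from inS[OF this] r show ?thesis by linarith
  qed
  ultimately have "arg_kernel y t - arg_kernel x t + Im ((y - x) / (cis t - x)) = Im (k 0 y - k 0 x - k 1 x * (y - x))"
    using x by (simp add: arg_kernel_eq_Im_Ln k_def c_def)
  then show ?thesis using * abs_Im_le_cmod order_trans by metis
qed

text \<open>The kernel is differentiable with a quadratic error that is uniform in the angle, and
  this error survives integration against \<open>\<bar>f t\<bar>\<close>.\<close>

lemma conj_ext_has_derivative:
  assumes f: "integrable angles f" and x: "norm x < 1"
  shows "(conj_ext f has_derivative (\<lambda>v. Im (conj_ext_deriv f x * v))) (at x)"
proof (rule has_derivative_if_quadratic[where \<delta> = "(1 - norm x) / 2" and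
      B = "1 / pi * (LINT t|angles. \<bar>f t\<bar>) * (4 / (1 - norm x)\<^sup>2)"])
  show "bounded_linear (\<lambda>v. Im (conj_ext_deriv f x * v))"
    by (rule bounded_linear_compose[OF bounded_linear_Im bounded_linear_mult_right])
  fix y assume y: "dist y x < (1 - norm x) / 2"
  define B where "B = 4 / (1 - norm x)\<^sup>2 * (norm (y - x))\<^sup>2"
  have lin: "Im (conj_ext_deriv f x * (y - x)) = 1 / pi * (LINT t|angles. f t * Im ((y - x) / (cis t - x)))"
    and lin_int: "integrable angles (\<lambda>t. f t * Im ((y - x) / (cis t - x)))"
  proof -
    have bl: "bounded_linear (\<lambda>z. Im (complex_of_real (1 / pi) * z * (y - x)))"
      by (intro bounded_linear_compose[OF bounded_linear_Im] bounded_linear_mult_const bounded_linear_mult_right)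
    have eq: "Im (complex_of_real (1 / pi) * (complex_of_real (f t) / (cis t - x)) * (y - x)) = 1 / pi * (f t * Im ((y - x) / (cis t - x)))" for t
    proof -
      have "complex_of_real (1 / pi) * (complex_of_real (f t) / (cis t - x)) * (y - x) = complex_of_real (1 / pi * f t) * ((y - x) / (cis t - x))"
        by simp
      also have "Im \<dots> = (1 / pi * f t) * Im ((y - x) / (cis t - x))" by (simp only: times_complex.sel Re_complex_of_real Im_complex_of_real mult_zero_left add_0_right)
      finally show ?thesis by simp
    qed
    have i: "integrable angles (\<lambda>t. 1 / pi * (f t * Im ((y - x) / (cis t - x))))"
      using integrable_bounded_linear[OF bl integrable_conj_ext_deriv[OF f x]] by (simp only: eq)
    have "integrable angles (\<lambda>t. pi * (1 / pi * (f t * Im ((y - x) / (cis t - x)))))"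
      by (intro integrable_mult_right i)
    then show "integrable angles (\<lambda>t. f t * Im ((y - x) / (cis t - x)))" by simp
    have "Im (conj_ext_deriv f x * (y - x)) = (LINT t|angles. 1 / pi * (f t * Im ((y - x) / (cis t - x))))"
      using integral_bounded_linear[OF bl integrable_conj_ext_deriv[OF f x]]
      by (simp only: eq conj_ext_deriv_def)
    then show "Im (conj_ext_deriv f x * (y - x)) = 1 / pi * (LINT t|angles. f t * Im ((y - x) / (cis t - x)))" by simp
  qed
  have "conj_ext f y - conj_ext f x - Im (conj_ext_deriv f x * (y - x)) =
      - (1 / pi) * ((LINT t|angles. f t * arg_kernel y t) - (LINT t|angles. f t * arg_kernel x t) + (LINT t|angles. f t * Im ((y - x) / (cis t - x))))"
  proof -
    have "- c * u - - c * v - c * w = - c * (u - v + w)" for c u v w :: real by (simp add: algebra_simps)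
    then show ?thesis unfolding conj_ext_def lin .
  qed
  also have "(LINT t|angles. f t * arg_kernel y t) - (LINT t|angles. f t * arg_kernel x t) + (LINT t|angles. f t * Im ((y - x) / (cis t - x))) =
      (LINT t|angles. f t * arg_kernel y t - f t * arg_kernel x t + f t * Im ((y - x) / (cis t - x)))"
    using integrable_mult_arg_kernel[OF f] lin_int by simp
  finally have "norm (conj_ext f y - conj_ext f x - Im (conj_ext_deriv f x * (y - x))) =
      1 / pi * norm (LINT t|angles. f t * arg_kernel y t - f t * arg_kernel x t + f t * Im ((y - x) / (cis t - x)))"
    by (simp add: abs_mult)
  also have "\<dots> \<le> 1 / pi * (LINT t|angles. \<bar>f t\<bar> * B)"
  proof (intro mult_left_mono Bochner_Integration.integral_norm_bound_integral)
    show "integrable angles (\<lambda>t. f t * arg_kernel y t - f t * arg_kernel x t + f t * Im ((y - x) / (cis t - x)))"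
      using integrable_mult_arg_kernel[OF f] lin_int by simp
    fix t
    have "norm (f t * arg_kernel y t - f t * arg_kernel x t + f t * Im ((y - x) / (cis t - x))) =
        \<bar>f t\<bar> * \<bar>arg_kernel y t - arg_kernel x t + Im ((y - x) / (cis t - x))\<bar>"
      by (simp add: abs_mult[symmetric] algebra_simps)
    also have "\<dots> \<le> \<bar>f t\<bar> * B"
      unfolding B_def by (intro mult_left_mono arg_kernel_Taylor x y) simp
    finally show "norm (f t * arg_kernel y t - f t * arg_kernel x t + f t * Im ((y - x) / (cis t - x))) \<le> \<bar>f t\<bar> * B" .
  qed (use f in auto)
  also have "\<dots> = 1 / pi * (LINT t|angles. \<bar>f t\<bar>) * (4 / (1 - norm x)\<^sup>2) * (norm (y - x))\<^sup>2"
    using f by (simp add: B_def)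
  finally show "norm (conj_ext f y - conj_ext f x - Im (conj_ext_deriv f x * (y - x))) \<le>
      1 / pi * (LINT t|angles. \<bar>f t\<bar>) * (4 / (1 - norm x)\<^sup>2) * (norm (y - x))\<^sup>2" .
qed (use x in auto)

lemma norm_conj_ext_deriv_le:
  assumes f: "integrable angles f" and x: "norm x < 1"
  shows "ennreal (norm (conj_ext_deriv f x)) \<le> ennreal (1 / pi) * (\<integral>\<^sup>+t. ennreal (\<bar>f t\<bar> / norm (cis t - x)) \<partial>angles)"
proof -
  have "ennreal (norm (conj_ext_deriv f x)) = ennreal (1 / pi) * ennreal (norm (LINT t|angles. complex_of_real (f t) / (cis t - x)))"
    by (simp add: conj_ext_deriv_def norm_mult ennreal_mult[symmetric] norm_divide)
  also have "\<dots> \<le> ennreal (1 / pi) * (\<integral>\<^sup>+t. ennreal (norm (complex_of_real (f t) / (cis t - x))) \<partial>angles)"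
    by (intro mult_left_mono integral_norm_bound_ennreal integrable_conj_ext_deriv f x) simp
  finally show ?thesis by (simp add: norm_divide)
qed

section \<open>Boundary values of the harmonic phase\<close>

text \<open>In terms of half the angle difference \<open>\<theta>\<close> the quotient is the
  negative cotangent, that is, the tangent of \<open>\<theta> - pi / 2\<close> and of
  \<open>\<theta> + pi / 2\<close>. The sign of \<open>\<theta>\<close> decides which of the two
  lies in the range of \<open>arctan\<close>, and this produces the jump.\<close>

lemma arg_kernel_circle:
  assumes "s \<in> {0..2 * pi}" "t \<in> {0..2 * pi}" "cis s \<noteq> cis t"
  shows "arg_kernel (cis s) t = (s - t) / 2 - pi / 2 + (if s < t then pi else 0)"
proof -
  define \<theta> where "\<theta> = (s - t) / 2"
  have "2 * \<theta> = s - t" by (simp add: \<theta>_def)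
  then have z: "cis s * cis (- t) = cis (2 * \<theta>)" by (simp add: cis_mult)
  have "sin \<theta> \<noteq> 0"
  proof
    assume "sin \<theta> = 0"
    then have "cis (2 * \<theta>) = 1" by (simp add: complex_eq_iff cos_double sin_double cos_squared_eq)
    then have "cis s * cis (- t) = 1" using z by simp
    then show False using assms(3) by (simp add: mult_cis_eq_1_iff)
  qed
  have ratio: "Im (1 - cis s * cis (- t)) / Re (1 - cis s * cis (- t)) = - (cos \<theta> / sin \<theta>)"
  proof -
    have i: "Im (1 - cis (2 * \<theta>)) = - (2 * sin \<theta> * cos \<theta>)" by (simp add: sin_double)
    have r: "Re (1 - cis (2 * \<theta>)) = 2 * sin \<theta> * sin \<theta>" by (simp add: cos_double_sin power2_eq_square)
    show ?thesis unfolding z i r using \<open>sin \<theta> \<noteq> 0\<close> by (simp add: field_simps)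
  qed
  consider "0 < \<theta>" | "\<theta> < 0" using \<open>sin \<theta> \<noteq> 0\<close> by fastforce
  then show ?thesis
  proof cases
    case 1
    have "\<theta> \<noteq> pi" using \<open>sin \<theta> \<noteq> 0\<close> by auto
    then have \<theta>: "\<theta> < pi" using assms by (auto simp: \<theta>_def)
    have "tan (\<theta> - pi / 2) = - (cos \<theta> / sin \<theta>)"
      by (simp add: tan_def sin_diff cos_diff)
    then have "arctan (- (cos \<theta> / sin \<theta>)) = \<theta> - pi / 2"
      using arctan_tan[of "\<theta> - pi / 2"] 1 \<theta> by simp
    then have "arg_kernel (cis s) t = \<theta> - pi / 2" unfolding arg_kernel_def ratio .
    then show ?thesis using 1 by (simp add: \<theta>_def)
  next
    case 2
    have "\<theta> \<noteq> - pi" using \<open>sin \<theta> \<noteq> 0\<close> by auto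
    then have \<theta>: "- pi < \<theta>" using assms by (auto simp: \<theta>_def)
    have "tan (\<theta> + pi / 2) = - (cos \<theta> / sin \<theta>)"
      by (simp add: tan_def sin_add cos_add)
    then have "arctan (- (cos \<theta> / sin \<theta>)) = \<theta> + pi / 2"
      using arctan_tan[of "\<theta> + pi / 2"] 2 \<theta> by simp
    then have "arg_kernel (cis s) t = \<theta> + pi / 2" unfolding arg_kernel_def ratio .
    then show ?thesis using 2 by (simp add: \<theta>_def)
  qed
qed

text \<open>The step of the sawtooth integrates to the primitive of \<open>f\<close>, its slope in
  \<open>s\<close> gives the linear correction, and everything else is independent of
  \<open>s\<close>.\<close>

lemma conj_ext_circle:
  assumes f: "integrable angles f" and s: "s \<in> {0..2 * pi}"
  shows "conj_ext f (cis s) = integral {0..s} f - s / (2 * pi) * integral {0..2 * pi} f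
    + (1 / (2 * pi) * (LINT t|angles. t * f t) - integral {0..2 * pi} f / 2)"
proof -
  define D where "D = (LINT t|angles. f t)"
  have D: "integral {0..2 * pi} f = D"
    unfolding D_def by (rule lebesgue_integral_eq_integral[symmetric]) (use f in auto)
  have itf: "integrable angles (\<lambda>t. t * f t)"
    using absolutely_integrable_bilinear[OF bounded_bilinear_mult continuous_on_id, where g = f] f
    by (simp add: absolutely_integrable_on_iff_integrable)
  have sub: "{0..s} \<subseteq> {0..2 * pi}" using s by auto
  have "{0..s} \<in> sets angles" using sub by (subst sets_restrict_space_iff) auto
  then have iF: "integrable angles (\<lambda>t. indicator {0..s} t * f t)"
    using integrable_mult_indicator[OF _ f, of "{0..s}"] by simp
  have F: "(LINT t|angles. indicator {0..s} t * f t) = integral {0..s} f"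
  proof -
    have "(LINT t|angles. indicator {0..s} t * f t) = (LINT t|lebesgue. indicator {0..2 * pi} t *\<^sub>R (indicator {0..s} t * f t))"
      by (rule integral_restrict_space) simp
    also have "(\<lambda>t. indicator {0..2 * pi} t *\<^sub>R (indicator {0..s} t * f t)) = (\<lambda>t. indicator {0..s} t *\<^sub>R f t)"
      using sub by (auto simp: indicator_def fun_eq_iff)
    also have "(LINT t|lebesgue. indicator {0..s} t *\<^sub>R f t) = (LINT t|lebesgue_on {0..s}. f t)"
      by (rule integral_restrict_space[symmetric]) simp
    also have "\<dots> = integral {0..s} f"
      by (rule lebesgue_integral_eq_integral) (use integrable_subinterval[OF f sub] in auto)
    finally show ?thesis .
  qed
  \<comment> \<open>The jump is moved from the angles beyond \<open>s\<close> to those up to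
    \<open>s\<close>: \<open>- pi / 2\<close> plus \<open>pi\<close> beyond \<open>s\<close> is
    \<open>pi / 2\<close> minus \<open>pi\<close> up to \<open>s\<close>.\<close>
  have "AE t in angles. f t * arg_kernel (cis s) t = (s / 2 + pi / 2) * f t - 1 / 2 * (t * f t) - pi * (indicator {0..s} t * f t)"
    using AE_angles_cis_neq[of "cis s"] AE_space
  proof eventually_elim
    case (elim t)
    then have t: "t \<in> {0..2 * pi}" "cis s \<noteq> cis t" by auto
    show ?case unfolding arg_kernel_circle[OF s t]
      using t(1) by (cases "s < t") (auto simp: field_simps)
  qed
  moreover have meas: "(\<lambda>t. f t * arg_kernel (cis s) t) \<in> borel_measurable angles"
    by (rule borel_measurable_integrable[OF integrable_mult_arg_kernel[OF f]])
  ultimately have "(LINT t|angles. f t * arg_kernel (cis s) t) =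
      (LINT t|angles. (s / 2 + pi / 2) * f t - 1 / 2 * (t * f t) - pi * (indicator {0..s} t * f t))"
    using f itf iF by (intro integral_cong_AE) (auto intro!: borel_measurable_integrable)
  also have "\<dots> = (s / 2 + pi / 2) * D - 1 / 2 * (LINT t|angles. t * f t) - pi * integral {0..s} f"
    using f itf iF by (simp add: D_def F)
  finally have X: "(LINT t|angles. f t * arg_kernel (cis s) t) =
      (s / 2 + pi / 2) * D - 1 / 2 * (LINT t|angles. t * f t) - pi * integral {0..s} f" .
  have "- (1 / pi) * ((s / 2 + pi / 2) * d - 1 / 2 * i - pi * v) = v - s / (2 * pi) * d + (1 / (2 * pi) * i - d / 2)" for d i v :: real
    by (simp add: field_simps)
  then show ?thesis unfolding conj_ext_def D X .
qed

section \<open>The weak \<open>L\<^sup>2\<close> estimate\<close>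

text \<open>Layer cake: the part of \<open>E\<close> where the kernel exceeds height
  \<open>s\<close> lies in the ball of radius \<open>1 / s\<close> about \<open>a\<close>, so its
  area is at most the smaller of \<open>m\<close> and \<open>pi / s^2\<close>. Integrating over all
  heights gives the bound, with a constant independent of \<open>a\<close>.\<close>

lemma nn_integral_inverse_dist_le:
  fixes a :: complex
  assumes E: "E \<in> sets borel" and fin: "emeasure lborel E < \<infinity>"
  shows "(\<integral>\<^sup>+x. indicator E x * ennreal (1 / norm (x - a)) \<partial>lborel) \<le> ennreal ((1 + pi) * sqrt (measure lborel E))"
proof -
  define m where "m = measure lborel E"
  have em: "emeasure lborel E = ennreal m"
    using fin by (simp add: m_def emeasure_eq_ennreal_measure top.not_eq_extremum)
  note [measurable] = E
  show ?thesis
  proof (cases "m = 0")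
    case True
    then have "E \<in> null_sets lborel" using em E by auto
    then have "AE x in lborel. indicator E x * ennreal (1 / norm (x - a)) = 0"
      by (rule AE_mp[OF AE_not_in]) (auto intro!: AE_I2)
    then have "(\<integral>\<^sup>+x. indicator E x * ennreal (1 / norm (x - a)) \<partial>lborel) = 0"
      by (subst nn_integral_0_iff_AE) auto
    then show ?thesis by simp
  next
    case False
    then have m: "m > 0" by (simp add: m_def order_less_le)
    \<comment> \<open>At this height the contributions below and above are \<open>sqrt m\<close> and
      \<open>pi * sqrt m\<close>, whence the factor \<open>1 + pi\<close>.\<close>
    define s0 where "s0 = 1 / sqrt m"
    have s0: "s0 > 0" using m by (simp add: s0_def)
    have layer: "ennreal (1 / norm (x - a)) = (\<integral>\<^sup>+s. indicator {s. 0 < s \<and> s < 1 / norm (x - a)} s \<partial>lborel)" for x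
    proof -
      have "{s. 0 < s \<and> s < 1 / norm (x - a)} = {0<..<1 / norm (x - a)}" by auto
      then show ?thesis by simp
    qed
    have "(\<integral>\<^sup>+x. indicator E x * ennreal (1 / norm (x - a)) \<partial>lborel) =
        (\<integral>\<^sup>+x. (\<integral>\<^sup>+s. indicator E x * indicator {s. 0 < s \<and> s < 1 / norm (x - a)} s \<partial>lborel) \<partial>lborel)"
      unfolding layer by (subst nn_integral_cmult[symmetric]) auto
    also have "\<dots> = (\<integral>\<^sup>+s. (\<integral>\<^sup>+x. indicator E x * indicator {s. 0 < s \<and> s < 1 / norm (x - a)} s \<partial>lborel) \<partial>lborel)"
    proof (rule lborel_pair.Fubini'[symmetric])
      have "(\<lambda>p. indicator E (fst p) * (if 0 < snd p \<and> snd p < 1 / norm (fst p - a) then 1 else 0 :: ennreal))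
          \<in> borel_measurable (lborel \<Otimes>\<^sub>M lborel)" by measurable
      then show "(\<lambda>(x, s). indicator E x * indicator {s. 0 < s \<and> s < 1 / norm (x - a)} s :: ennreal) \<in> borel_measurable (lborel \<Otimes>\<^sub>M lborel)"
        by (simp add: indicator_def of_bool_def split_beta' cong: if_cong)
    qed
    also have "\<dots> \<le> (\<integral>\<^sup>+s. ennreal m * indicator {0..s0} s + ennreal (pi / s\<^sup>2) * indicator {s0..} s \<partial>lborel)"
    proof (rule nn_integral_mono)
      fix s :: real
      show "(\<integral>\<^sup>+x. indicator E x * indicator {s. 0 < s \<and> s < 1 / norm (x - a)} s \<partial>lborel) \<le>
         ennreal m * indicator {0..s0} s + ennreal (pi / s\<^sup>2) * indicator {s0..} s"
      proof (cases "s > 0")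
        case False
        then show ?thesis by simp
      next
        case True
        have le: "(\<integral>\<^sup>+x. indicator E x * indicator {s. 0 < s \<and> s < 1 / norm (x - a)} s \<partial>lborel) \<le> emeasure lborel B"
          if "E \<inter> ball a (1 / s) \<subseteq> B" "B \<in> sets borel" for B
        proof -
          have "(\<integral>\<^sup>+x. indicator E x * indicator {s. 0 < s \<and> s < 1 / norm (x - a)} s \<partial>lborel) \<le> (\<integral>\<^sup>+x. indicator B x \<partial>lborel)"
          proof (rule nn_integral_mono)
            fix x
            have "x \<in> ball a (1 / s)" if "s < 1 / norm (x - a)"
            proof (cases "x = a")
              case False
              then show ?thesis using that True by (simp add: dist_norm norm_minus_commute field_simps)
            qed (use True in simp)
            then show "indicator E x * indicator {s. 0 < s \<and> s < 1 / norm (x - a)} s \<le> (indicator B x :: ennreal)"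
              using \<open>E \<inter> ball a (1 / s) \<subseteq> B\<close> by (auto simp: indicator_def)
          qed
          also have "\<dots> = emeasure lborel B" using that(2) by simp
          finally show ?thesis .
        qed
        show ?thesis
        proof (cases "s \<le> s0")
          case True
          then show ?thesis using le[of E] \<open>s > 0\<close> em E by (auto intro: order_trans)
        next
          case False
          have "emeasure lborel (ball a (1 / s)) = ennreal (pi / s\<^sup>2)"
            using \<open>s > 0\<close> by (simp add: emeasure_ball unit_ball_vol_2 power_divide)
          then show ?thesis using le[of "ball a (1 / s)"] False by simp
        qed
      qed
    qed
    also have "\<dots> = ennreal m * ennreal s0 + ennreal (pi / s0)"
    proof -
      have "(\<integral>\<^sup>+s. ennreal (pi / s\<^sup>2) * indicator {s0..} s \<partial>lborel) = ennreal (0 - (- pi / s0))"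
      proof (rule nn_integral_FTC_atLeast)
        show "DERIV (\<lambda>s. - pi / s) s :> pi / s\<^sup>2" if "s0 \<le> s" for s
          using that s0 by (auto intro!: derivative_eq_intros simp: power2_eq_square)
        have "((\<lambda>s. - pi * inverse s) \<longlongrightarrow> - pi * 0) at_top"
          by (intro tendsto_intros tendsto_inverse_0_at_top filterlim_ident)
        then show "((\<lambda>s. - pi / s) \<longlongrightarrow> 0) at_top" by (simp add: divide_inverse)
      qed auto
      moreover have "(\<integral>\<^sup>+s. ennreal m * indicator {0..s0} s \<partial>lborel) = ennreal m * ennreal s0"
        using s0 by (simp add: nn_integral_cmult_indicator)
      ultimately show ?thesis by (subst nn_integral_add) auto
    qed
    also have "\<dots> = ennreal ((1 + pi) * sqrt m)"
    proof -
      have "ennreal m * ennreal s0 + ennreal (pi / s0) = ennreal (m * s0 + pi / s0)"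
        using m s0 by (simp add: ennreal_mult ennreal_plus)
      also have "m * s0 + pi / s0 = (1 + pi) * sqrt m"
        using m by (simp add: s0_def real_div_sqrt algebra_simps)
      finally show ?thesis .
    qed
    finally show ?thesis by (simp add: m_def)
  qed
qed

text \<open>By Tonelli's theorem the kernel bound can be applied for each angle separately; it is
  the same for every centre \<open>cis t\<close>.\<close>

lemma nn_integral_potential_le:
  fixes f :: "real \<Rightarrow> real"
  assumes f: "integrable angles f" and E: "E \<in> sets borel" and fin: "emeasure lborel E < \<infinity>"
  shows "(\<integral>\<^sup>+x. indicator E x * (\<integral>\<^sup>+t. ennreal (\<bar>f t\<bar> / norm (cis t - x)) \<partial>angles) \<partial>lborel)
    \<le> ennreal ((LINT t|angles. \<bar>f t\<bar>) * ((1 + pi) * sqrt (measure lborel E)))"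
proof -
  define C where "C = (1 + pi) * sqrt (measure lborel E)"
  have C: "C \<ge> 0" by (simp add: C_def)
  interpret A: finite_measure angles by (rule finite_measure_lebesgue_on) simp
  interpret pair_sigma_finite lborel angles ..
  have f_meas [measurable]: "f \<in> borel_measurable angles" using f by (rule borel_measurable_integrable)
  have "cis \<in> borel_measurable borel" by (intro borel_measurable_continuous_onI continuous_intros)
  then have cis_meas [measurable]: "cis \<in> borel_measurable angles"
    by (simp add: measurable_completion measurable_restrict_space1)
  note [measurable] = E
  have "(\<integral>\<^sup>+x. indicator E x * (\<integral>\<^sup>+t. ennreal (\<bar>f t\<bar> / norm (cis t - x)) \<partial>angles) \<partial>lborel) =
      (\<integral>\<^sup>+x. (\<integral>\<^sup>+t. indicator E x * ennreal (\<bar>f t\<bar> / norm (cis t - x)) \<partial>angles) \<partial>lborel)"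
    by (intro nn_integral_cong nn_integral_cmult[symmetric]) measurable
  also have "\<dots> = (\<integral>\<^sup>+t. (\<integral>\<^sup>+x. indicator E x * ennreal (\<bar>f t\<bar> / norm (cis t - x)) \<partial>lborel) \<partial>angles)"
    by (rule Fubini'[symmetric]) measurable
  also have "\<dots> \<le> (\<integral>\<^sup>+t. ennreal \<bar>f t\<bar> * ennreal C \<partial>angles)"
  proof (rule nn_integral_mono)
    fix t
    have "(\<integral>\<^sup>+x. indicator E x * ennreal (\<bar>f t\<bar> / norm (cis t - x)) \<partial>lborel) =
        (\<integral>\<^sup>+x. ennreal \<bar>f t\<bar> * (indicator E x * ennreal (1 / norm (x - cis t))) \<partial>lborel)"
    proof (rule nn_integral_cong)
      fix x
      have "ennreal (\<bar>f t\<bar> / norm (cis t - x)) = ennreal \<bar>f t\<bar> * ennreal (1 / norm (x - cis t))"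
        by (simp add: ennreal_mult[symmetric] norm_minus_commute)
      then show "indicator E x * ennreal (\<bar>f t\<bar> / norm (cis t - x)) = ennreal \<bar>f t\<bar> * (indicator E x * ennreal (1 / norm (x - cis t)))"
        by (simp add: mult_ac)
    qed
    also have "\<dots> = ennreal \<bar>f t\<bar> * (\<integral>\<^sup>+x. indicator E x * ennreal (1 / norm (x - cis t)) \<partial>lborel)"
      by (rule nn_integral_cmult) measurable
    also have "\<dots> \<le> ennreal \<bar>f t\<bar> * ennreal C"
      unfolding C_def by (intro mult_left_mono nn_integral_inverse_dist_le E fin) simp
    finally show "(\<integral>\<^sup>+x. indicator E x * ennreal (\<bar>f t\<bar> / norm (cis t - x)) \<partial>lborel) \<le> ennreal \<bar>f t\<bar> * ennreal C" .
  qed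
  also have "\<dots> = (\<integral>\<^sup>+t. ennreal \<bar>f t\<bar> \<partial>angles) * ennreal C"
    by (rule nn_integral_multc) measurable
  also have "(\<integral>\<^sup>+t. ennreal \<bar>f t\<bar> \<partial>angles) = ennreal (LINT t|angles. \<bar>f t\<bar>)"
    using f by (intro nn_integral_eq_integral) auto
  finally show ?thesis
    using C by (simp add: C_def ennreal_mult[symmetric])
qed

lemma weak_L2_if_integral_bound:
  assumes B: "B \<ge> 0" and t: "t > 0" and m: "m \<ge> 0" and le: "t * m \<le> B * sqrt m"
  shows "t\<^sup>2 * m \<le> B\<^sup>2"
proof (cases "m = 0")
  case False
  then have "sqrt m > 0" using m by simp
  have "t * sqrt m * sqrt m \<le> B * sqrt m" using le m by (simp add: mult.assoc)
  then have "t * sqrt m \<le> B" using \<open>sqrt m > 0\<close> by simp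
  then have "(t * sqrt m)\<^sup>2 \<le> B\<^sup>2" using t m by (intro power_mono) auto
  then show ?thesis using m by (simp add: power_mult_distrib)
qed (use B in simp)

text \<open>Chebyshev's inequality on a superlevel set E gives \<open>t * m \<le> B * sqrt m\<close>
  for its area \<open>m\<close>, and dividing by \<open>sqrt m\<close> yields the weak bound. The
  Borel majorant \<open>g\<close> provides a Borel set E, whereas \<open>h\<close> is only Lebesgue
  measurable.\<close>

lemma weak_Lp_sup_le_if_integral_bound:
  fixes g :: "complex \<Rightarrow> real" and h :: "complex \<Rightarrow> 'b::euclidean_space"
  assumes \<Omega>: "open \<Omega>" "emeasure lborel \<Omega> < \<infinity>"
    and g: "g \<in> borel_measurable borel" and h: "h \<in> borel_measurable (lebesgue_on \<Omega>)"
    and ae: "AE x in lebesgue_on \<Omega>. norm (h x) \<le> g x" and B: "B \<ge> 0"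
    and bound: "\<And>E. E \<in> sets borel \<Longrightarrow> E \<subseteq> \<Omega> \<Longrightarrow>
      (\<integral>\<^sup>+x. indicator E x * ennreal (g x) \<partial>lborel) \<le> ennreal (B * sqrt (measure lborel E))"
  shows "weak_Lp_sup 2 \<Omega> h \<le> ennreal (B\<^sup>2)"
  unfolding weak_Lp_sup_def
proof (rule SUP_least)
  fix t :: real assume "t \<in> {0<..}"
  then have t: "t > 0" by simp
  define E where "E = {x \<in> \<Omega>. t < g x}"
  have Eb: "E \<in> sets borel"
  proof -
    have "{x \<in> space borel. t < g x} \<in> sets borel" using g by measurable
    then have "\<Omega> \<inter> {x \<in> space borel. t < g x} \<in> sets borel" using \<Omega> by simp
    moreover have "\<Omega> \<inter> {x \<in> space borel. t < g x} = E" by (auto simp: E_def)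
    ultimately show ?thesis by simp
  qed
  have Es: "E \<subseteq> \<Omega>" by (auto simp: E_def)
  have Ef: "emeasure lborel E < \<infinity>"
    using emeasure_mono[OF Es, of lborel] \<Omega> by (auto intro: le_less_trans)
  define m where "m = measure lborel E"
  have em: "emeasure lborel E = ennreal m"
    using Ef by (simp add: m_def emeasure_eq_ennreal_measure top.not_eq_extremum)
  have [simp]: "\<Omega> \<in> sets lebesgue" using \<Omega> by auto
  have hE: "{x \<in> \<Omega>. t < norm (h x)} \<in> sets (lebesgue_on \<Omega>)"
  proof -
    have "{x \<in> space (lebesgue_on \<Omega>). t < norm (h x)} \<in> sets (lebesgue_on \<Omega>)"
      using h by measurable
    then show ?thesis by simp
  qed
  have EO: "E \<in> sets (lebesgue_on \<Omega>)" using Eb Es by (subst sets_restrict_space_iff) auto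
  have "emeasure (lebesgue_on \<Omega>) {x \<in> \<Omega>. t < norm (h x)} \<le> emeasure (lebesgue_on \<Omega>) E"
  proof (rule emeasure_mono_AE[OF _ EO])
    show "AE x in lebesgue_on \<Omega>. x \<in> {x \<in> \<Omega>. t < norm (h x)} \<longrightarrow> x \<in> E"
      using ae by eventually_elim (auto simp: E_def)
  qed
  also have "\<dots> = emeasure lborel E"
    using Es Eb by (simp add: emeasure_restrict_space emeasure_completion)
  finally have le: "emeasure (lebesgue_on \<Omega>) {x \<in> \<Omega>. t < norm (h x)} \<le> ennreal m" unfolding em .
  have "ennreal (t * m) = (\<integral>\<^sup>+x. ennreal t * indicator E x \<partial>lborel)"
    using Eb t by (simp add: nn_integral_cmult_indicator em ennreal_mult m_def)
  also have "\<dots> \<le> (\<integral>\<^sup>+x. indicator E x * ennreal (g x) \<partial>lborel)"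
    by (rule nn_integral_mono) (auto simp: E_def indicator_def intro!: ennreal_leI)
  also have "\<dots> \<le> ennreal (B * sqrt m)" unfolding m_def by (rule bound[OF Eb Es])
  finally have "t * m \<le> B * sqrt m" using B by (simp add: m_def)
  then have "t\<^sup>2 * m \<le> B\<^sup>2" by (intro weak_L2_if_integral_bound B t) (simp_all add: m_def)
  then have "ennreal (t powr 2) * ennreal m \<le> ennreal (B\<^sup>2)"
    using t by (simp add: ennreal_mult[symmetric] m_def powr_numeral ennreal_leI)
  moreover have "ennreal (t powr 2) * emeasure (lebesgue_on \<Omega>) {x \<in> \<Omega>. t < norm (h x)} \<le> ennreal (t powr 2) * ennreal m"
    by (intro mult_left_mono le) simp
  ultimately show "ennreal (t powr 2) * emeasure (lebesgue_on \<Omega>) {x \<in> \<Omega>. t < norm (h x)} \<le> ennreal (B\<^sup>2)"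
    by (rule order_trans[rotated])
qed

lemma weak_Lp_norm_le_sqrt:
  assumes "weak_Lp_sup 2 \<Omega> h \<le> ennreal c" "0 \<le> c"
  shows "weak_Lp_norm 2 \<Omega> h \<le> sqrt c"
proof -
  have "enn2real (weak_Lp_sup 2 \<Omega> h) \<le> c"
    using assms enn2real_mono[OF assms(1)] by simp
  then show ?thesis
    unfolding weak_Lp_norm_def by (simp add: powr_half_sqrt)
qed

section \<open>Weak derivatives off a point\<close>

lemma borel_measurable_Complex_pair:
  "(\<lambda>(x, y). Complex x y) \<in> borel_measurable (lborel \<Otimes>\<^sub>M lborel)"
proof -
  have "continuous_on UNIV (\<lambda>p. Complex (fst p) (snd p))"
    by (intro continuous_on_Complex continuous_intros)
  then have "(\<lambda>p. Complex (fst p) (snd p)) \<in> borel_measurable borel"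
    by (rule borel_measurable_continuous_onI)
  then show ?thesis by (simp add: split_beta' lborel_prod)
qed

lemma lborel_complex_eq_distr:
  "lborel = distr (lborel \<Otimes>\<^sub>M lborel) borel (\<lambda>(x, y). Complex x y)"
proof (rule lborel_eqI)
  fix l u :: complex
  assume le: "\<And>b. b \<in> Basis \<Longrightarrow> l \<bullet> b \<le> u \<bullet> b"
  have R: "Re l \<le> Re u" "Im l \<le> Im u" using le[of 1] le[of \<i>] by (auto simp: Basis_complex_def inner_complex_def)
  note meas = borel_measurable_Complex_pair
  have "(\<lambda>(x, y). Complex x y) -` box l u \<inter> space (lborel \<Otimes>\<^sub>M lborel) = {Re l<..<Re u} \<times> {Im l<..<Im u}"
    by (auto simp: box_def Basis_complex_def inner_complex_def space_pair_measure)
  then have "emeasure (distr (lborel \<Otimes>\<^sub>M lborel) borel (\<lambda>(x, y). Complex x y)) (box l u) =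
      emeasure (lborel \<Otimes>\<^sub>M lborel) ({Re l<..<Re u} \<times> {Im l<..<Im u})"
    using meas by (subst emeasure_distr) auto
  also have "\<dots> = ennreal (Re u - Re l) * ennreal (Im u - Im l)"
    using R by (subst lborel.emeasure_pair_measure_Times) auto
  also have "\<dots> = ennreal (\<Prod>b\<in>Basis. (u - l) \<bullet> b)"
    using R by (simp add: Basis_complex_def inner_complex_def ennreal_mult)
  finally show "emeasure (distr (lborel \<Otimes>\<^sub>M lborel) borel (\<lambda>(x, y). Complex x y)) (box l u) = ennreal (\<Prod>b\<in>Basis. (u - l) \<bullet> b)" .
qed simp

text \<open>Fubini's theorem over the lines parallel to \<open>b\<close>, indexed by their foot
  \<open>p\<close> on the other axis. The line through the origin is exempt, being a null set among
  these lines.\<close>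

lemma integral_complex_zero_if_lines_zero:
  fixes F :: "complex \<Rightarrow> 'b::{banach, second_countable_topology}"
  assumes F: "integrable lborel F" and b: "b \<in> Basis"
    and zero: "\<And>p. p \<noteq> 0 \<Longrightarrow> p \<bullet> b = 0 \<Longrightarrow> (LINT s|lborel. F (p + s *\<^sub>R b)) = 0"
  shows "(LINT z|lborel. F z) = 0"
proof -
  note meas = borel_measurable_Complex_pair
  have Fm: "F \<in> borel_measurable borel" using F by auto
  have i: "integrable (lborel \<Otimes>\<^sub>M lborel) (\<lambda>(x, y). F (Complex x y))"
    using F integrable_distr[OF meas, of F] unfolding lborel_complex_eq_distr[symmetric] by (simp add: split_beta')
  have eq: "(LINT z|lborel. F z) = (LINT p|(lborel \<Otimes>\<^sub>M lborel). (case p of (x, y) \<Rightarrow> F (Complex x y)))"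
    by (subst lborel_complex_eq_distr, subst integral_distr[OF meas Fm]) (simp add: split_beta')
  have ae: "AE y in lborel. y \<noteq> (0::real)" by (rule AE_lborel_singleton)
  consider "b = 1" | "b = \<i>" using b by (auto simp: Basis_complex_def)
  then show ?thesis
  proof cases
    case 1
    have z: "(LINT x|lborel. F (Complex x y)) = 0" if "y \<noteq> 0" for y
    proof -
      have line: "Complex 0 y + s *\<^sub>R b = Complex s y" for s by (simp add: 1 complex_eq_iff)
      have "Complex 0 y \<noteq> 0" "Complex 0 y \<bullet> b = 0" using that by (simp_all add: 1 complex_eq_iff inner_complex_def)
      from zero[OF this] show ?thesis unfolding line .
    qed
    have "(LINT y|lborel. (LINT x|lborel. F (Complex x y))) = (LINT y|(lborel::real measure). 0)"
    proof (rule integral_cong_AE)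
      show "(\<lambda>y. LINT x|lborel. F (Complex x y)) \<in> borel_measurable lborel"
        by (rule borel_measurable_integrable[OF lborel_pair.integrable_snd[OF i]])
      show "AE y in lborel. (LINT x|lborel. F (Complex x y)) = 0" using ae by eventually_elim (rule z)
    qed simp
    then show ?thesis unfolding eq lborel_pair.integral_snd[OF i, symmetric] by simp
  next
    case 2
    have z: "(LINT y|lborel. F (Complex x y)) = 0" if "x \<noteq> 0" for x
    proof -
      have line: "Complex x 0 + s *\<^sub>R b = Complex x s" for s by (simp add: 2 complex_eq_iff)
      have "Complex x 0 \<noteq> 0" "Complex x 0 \<bullet> b = 0" using that by (simp_all add: 2 complex_eq_iff inner_complex_def)
      from zero[OF this] show ?thesis unfolding line .
    qed
    have "(LINT x|lborel. (LINT y|lborel. F (Complex x y))) = (LINT x|(lborel::real measure). 0)"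
    proof (rule integral_cong_AE)
      show "(\<lambda>x. LINT y|lborel. F (Complex x y)) \<in> borel_measurable lborel"
        by (rule borel_measurable_integrable[OF lborel_pair.integrable_fst[OF i]])
      show "AE x in lborel. (LINT y|lborel. F (Complex x y)) = 0" using ae by eventually_elim (rule z)
    qed simp
    then show ?thesis unfolding eq lborel_pair.integral_fst[OF i, symmetric] by simp
  qed
qed

lemma has_vector_derivative_along_line:
  fixes f :: "'a::real_normed_vector \<Rightarrow> 'b::real_normed_vector"
  assumes "(f has_derivative D) (at (p + s *\<^sub>R b))"
  shows "((\<lambda>s. f (p + s *\<^sub>R b)) has_vector_derivative D b) (at s)"
proof -
  have "((\<lambda>s. p + s *\<^sub>R b) has_derivative (\<lambda>h. h *\<^sub>R b)) (at s)"
    by (auto intro!: derivative_eq_intros)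
  from has_derivative_compose[OF this assms] show ?thesis
    using linear_scale[OF has_derivative_linear[OF assms]] by (simp add: has_vector_derivative_def)
qed

text \<open>Almost every line parallel to \<open>b\<close> misses the origin, and along such a line
  the derivative of \<open>\<eta> * f\<close> integrates to 0 by compact support. A point
  singularity is therefore invisible to weak derivatives as long as \<open>f\<close> and
  \<open>g\<close> are locally integrable.\<close>

lemma has_weak_partial_off_point:
  fixes f g :: "complex \<Rightarrow> 'b::euclidean_space"
  assumes \<Omega>: "open \<Omega>" and b: "b \<in> Basis"
    and lf: "locally_integrable \<Omega> f" and lg: "locally_integrable \<Omega> g"
    and cg: "continuous_on (\<Omega> - {0}) g"
    and der: "\<And>x. x \<in> \<Omega> - {0} \<Longrightarrow> \<exists>D. (f has_derivative D) (at x) \<and> D b = g x"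
  shows "has_weak_partial \<Omega> b f g"
  unfolding has_weak_partial_def
proof (intro conjI lf lg allI impI)
  fix \<eta> :: "complex \<Rightarrow> real" assume \<eta>: "test_function \<Omega> \<eta>"
  define K where "K = closure {x. \<eta> x \<noteq> 0}"
  define \<eta>' where "\<eta>' x = frechet_derivative \<eta> (at x) b" for x
  have sm: "smooth \<eta>" and K: "compact K" "K \<subseteq> \<Omega>" using \<eta> by (auto simp: test_function_def K_def)
  have K0: "\<eta> x = 0" if "x \<notin> K" for x
    using that closure_subset[of "{x. \<eta> x \<noteq> 0}"] by (auto simp: K_def)
  have oK: "open (- K)" using K(1) by (simp add: compact_imp_closed open_Compl)
  have K0': "\<eta>' x = 0" if "x \<notin> K" for x
  proof -
    have "(\<eta> has_derivative (\<lambda>_. 0)) (at x)"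
      by (rule has_derivative_transform_within_open[OF has_derivative_const[of 0] oK]) (use that K0 in auto)
    then show ?thesis using frechet_derivative_at[of \<eta> "\<lambda>_. 0" x] by (simp add: \<eta>'_def fun_eq_iff)
  qed
  have c\<eta>: "continuous_on UNIV \<eta>" and c\<eta>': "continuous_on UNIV \<eta>'"
    using smooth_imp_continuous[OF sm] smooth_imp_continuous[OF smooth_frechet_derivative[OF sm, of b]] by (simp_all add: \<eta>'_def[abs_def])
  have cf: "continuous_on (\<Omega> - {0}) f"
    using der by (intro continuous_at_imp_continuous_on ballI) (blast intro: has_derivative_continuous)
  \<comment> \<open>The derivative of \<open>\<eta> * f\<close> in direction \<open>b\<close>,
    extended by 0; the claim is that its integral over the plane vanishes.\<close>
  define F where "F x = indicator \<Omega> x *\<^sub>R (\<eta>' x *\<^sub>R f x + \<eta> x *\<^sub>R g x)" for x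
  have i1: "integrable (lebesgue_on \<Omega>) (\<lambda>x. \<eta>' x *\<^sub>R f x)"
    by (rule test_function_mult_integrable[OF \<Omega> lf c\<eta>' K K0'])
  have i2: "integrable (lebesgue_on \<Omega>) (\<lambda>x. \<eta> x *\<^sub>R g x)"
    by (rule test_function_mult_integrable[OF \<Omega> lg c\<eta> K K0])
  have [simp]: "\<Omega> \<in> sets lebesgue" using \<Omega> by auto
  have F0: "F x = 0" if "x \<notin> K" for x using K0[OF that] K0'[OF that] by (simp add: F_def)
  \<comment> \<open>Crossing the boundary of \<open>\<Omega>\<close> is harmless since
    \<open>F\<close> is 0 off the compact set \<open>K\<close> inside it.\<close>
  have cF: "continuous_on (- {0}) F"
  proof -
    have 1: "continuous_on (\<Omega> - {0}) F"
    proof -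
      have "continuous_on (\<Omega> - {0}) (\<lambda>x. \<eta>' x *\<^sub>R f x + \<eta> x *\<^sub>R g x)"
        by (intro continuous_intros cf cg continuous_on_subset[OF c\<eta>] continuous_on_subset[OF c\<eta>']) auto
      then show ?thesis by (rule continuous_on_eq) (auto simp: F_def)
    qed
    have 2: "continuous_on (- K) F"
      by (rule continuous_on_eq[of _ "\<lambda>_. 0"]) (use F0 in auto)
    have "continuous_on ((\<Omega> - {0}) \<union> - K) F"
      by (rule continuous_on_open_Un) (use 1 2 \<Omega> oK in \<open>auto simp: open_Diff\<close>)
    then show ?thesis by (rule continuous_on_subset) (use K(2) in auto)
  qed
  have Fb: "F \<in> borel_measurable borel"
  proof -
    have "continuous_on (- {0}) F" by (rule cF)
    then show ?thesis
      by (intro borel_measurable_continuous_countable_exceptions[of "{0}"]) auto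
  qed
  have iF: "integrable lebesgue F"
    using Bochner_Integration.integrable_add[OF i1 i2] by (simp add: F_def[abs_def] integrable_restrict_space)
  then have iF': "integrable lborel F"
    using Fb integrable_completion[of F lborel] by simp
  obtain R where R: "R > 0" "\<And>x. x \<in> K \<Longrightarrow> norm x < R"
    using bounded_pos_less[of K] compact_imp_bounded[OF K(1)] by auto
  have "(LINT z|lborel. F z) = 0"
  proof (rule integral_complex_zero_if_lines_zero[OF iF' b])
    fix p :: complex assume p: "p \<noteq> 0" "p \<bullet> b = 0"
    have bb: "b \<bullet> b = 1" "norm b = 1" using b by auto
    have nz: "p + s *\<^sub>R b \<noteq> 0" for s
    proof
      assume "p + s *\<^sub>R b = 0"
      then have "(p + s *\<^sub>R b) \<bullet> b = 0" by simp
      then have "s = 0" using p bb by (simp add: inner_add_left)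
      then show False using \<open>p + s *\<^sub>R b = 0\<close> p by simp
    qed
    have far: "p + s *\<^sub>R b \<notin> K" if "\<bar>s\<bar> \<ge> R" for s
    proof
      assume "p + s *\<^sub>R b \<in> K"
      moreover have "\<bar>s\<bar> \<le> norm (p + s *\<^sub>R b)"
        using Basis_le_norm[OF b, of "p + s *\<^sub>R b"] p bb by (simp add: inner_add_left)
      ultimately show False using R(2) that by force
    qed
    define h where "h s = indicator \<Omega> (p + s *\<^sub>R b) *\<^sub>R (\<eta> (p + s *\<^sub>R b) *\<^sub>R f (p + s *\<^sub>R b))" for s
    have op: "open ((\<lambda>s. p + s *\<^sub>R b) -` S)" if "open S" for S
      by (rule open_vimage[OF that]) (intro continuous_intros)
    have "(h has_vector_derivative F (p + s *\<^sub>R b)) (at s)" for s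
    proof (cases "p + s *\<^sub>R b \<in> \<Omega>")
      case True
      obtain D where D: "(f has_derivative D) (at (p + s *\<^sub>R b))" "D b = g (p + s *\<^sub>R b)"
        using der[of "p + s *\<^sub>R b"] True nz by auto
      have "((\<lambda>s. \<eta> (p + s *\<^sub>R b) *\<^sub>R f (p + s *\<^sub>R b)) has_vector_derivative
          \<eta> (p + s *\<^sub>R b) *\<^sub>R D b + \<eta>' (p + s *\<^sub>R b) *\<^sub>R f (p + s *\<^sub>R b)) (at s)"
        using has_vector_derivative_along_line[OF smooth_has_derivative[OF sm]]
          has_vector_derivative_along_line[OF D(1)]
        by (intro has_vector_derivative_scaleR) (simp_all add: \<eta>'_def has_real_derivative_iff_has_vector_derivative)
      then have "((\<lambda>s. \<eta> (p + s *\<^sub>R b) *\<^sub>R f (p + s *\<^sub>R b)) has_vector_derivative F (p + s *\<^sub>R b)) (at s)"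
        using True by (simp add: F_def D add.commute)
      then show ?thesis
        by (rule has_vector_derivative_transform_within_open[of _ _ _ "(\<lambda>s. p + s *\<^sub>R b) -` \<Omega>"])
          (use True op[OF \<Omega>] in \<open>auto simp: h_def\<close>)
    next
      case False
      then have nK: "p + s *\<^sub>R b \<notin> K" using K(2) by auto
      have "((\<lambda>s. 0) has_vector_derivative 0) (at s)" by simp
      then have "(h has_vector_derivative 0) (at s)"
        by (rule has_vector_derivative_transform_within_open[of _ _ _ "(\<lambda>s. p + s *\<^sub>R b) -` (- K)"])
          (use nK K0 op[OF oK] in \<open>auto simp: h_def\<close>)
      then show ?thesis using F0[OF nK] by simp
    qed
    then have "(LBINT s. indicator {- R..R} s *\<^sub>R F (p + s *\<^sub>R b)) = h R - h (- R)"
    proof (intro integral_FTC_Icc)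
      show "continuous_on {- R..R} (\<lambda>s. F (p + s *\<^sub>R b))"
        by (rule continuous_on_compose2[OF cF]) (use nz in \<open>auto intro!: continuous_intros\<close>)
    qed (use R in \<open>auto intro: has_vector_derivative_at_within\<close>)
    also have "\<dots> = 0" using far[of R] far[of "- R"] R(1) by (simp add: h_def K0)
    also have "(\<lambda>s. indicator {- R..R} s *\<^sub>R F (p + s *\<^sub>R b)) = (\<lambda>s. F (p + s *\<^sub>R b))"
      using far F0 by (force simp: indicator_def fun_eq_iff)
    finally show "(LINT s|lborel. F (p + s *\<^sub>R b)) = 0" .
  qed
  moreover have "(LINT z|lborel. F z) = (LINT x|lebesgue_on \<Omega>. \<eta>' x *\<^sub>R f x) + (LINT x|lebesgue_on \<Omega>. \<eta> x *\<^sub>R g x)"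
  proof -
    have "(LINT z|lborel. F z) = (LINT z|lebesgue. F z)"
      using Fb integral_completion[of F lborel] by simp
    also have "\<dots> = (LINT x|lebesgue_on \<Omega>. \<eta>' x *\<^sub>R f x + \<eta> x *\<^sub>R g x)"
      by (simp add: F_def[abs_def] integral_restrict_space)
    also have "\<dots> = (LINT x|lebesgue_on \<Omega>. \<eta>' x *\<^sub>R f x) + (LINT x|lebesgue_on \<Omega>. \<eta> x *\<^sub>R g x)"
      by (rule Bochner_Integration.integral_add[OF i1 i2])
    finally show ?thesis .
  qed
  ultimately show "(LINT x|lebesgue_on \<Omega>. frechet_derivative \<eta> (at x) b *\<^sub>R f x) = - (LINT x|lebesgue_on \<Omega>. \<eta> x *\<^sub>R g x)"
    by (simp add: \<eta>'_def eq_neg_iff_add_eq_0)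
qed

section \<open>Cutoff functions\<close>

text \<open>With \<open>v = x * w\<close> the real part of \<open>w\<close> is radial stretching,
  which the normalization removes; the imaginary part is a rotation and remains.\<close>

lemma sgn_complex_has_derivative:
  fixes x :: complex
  assumes x: "x \<noteq> 0"
  shows "(sgn has_derivative (\<lambda>v. \<i> * sgn x * complex_of_real (Im (v / x)))) (at x)"
proof -
  have "((\<lambda>y. inverse (norm y) *\<^sub>R y) has_derivative
      (\<lambda>v. inverse (norm x) *\<^sub>R v + (- (inverse (norm x) * (v \<bullet> sgn x) * inverse (norm x))) *\<^sub>R x)) (at x)"
    using x by (intro has_derivative_scaleR Deriv.has_derivative_inverse has_derivative_norm has_derivative_ident) auto
  moreover have "inverse (norm x) *\<^sub>R v + (- (inverse (norm x) * (v \<bullet> sgn x) * inverse (norm x))) *\<^sub>R x =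
      \<i> * sgn x * complex_of_real (Im (v / x))" for v
  proof -
    define w where "w = v / x"
    have v: "v = x * w" using x by (simp add: w_def)
    have n: "norm x > 0" using x by simp
    have "v \<bullet> x = (norm x)\<^sup>2 * Re w"
      unfolding v cmod_power2 inner_complex_def by (simp add: algebra_simps power2_eq_square)
    moreover have "v \<bullet> sgn x = (v \<bullet> x) / norm x"
      by (simp add: sgn_div_norm divide_inverse mult.commute)
    ultimately have vs: "v \<bullet> sgn x = norm x * Re w" using n by (simp add: power2_eq_square)
    have w: "w - complex_of_real (Re w) = \<i> * complex_of_real (Im w)" by (simp add: complex_eq_iff)
    have "inverse (norm x) *\<^sub>R v + (- (inverse (norm x) * (v \<bullet> sgn x) * inverse (norm x))) *\<^sub>R x =
        inverse (norm x) *\<^sub>R (x * (w - complex_of_real (Re w)))"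
      unfolding vs using n by (simp add: v scaleR_conv_of_real algebra_simps)
    also have "\<dots> = \<i> * sgn x * complex_of_real (Im w)"
      unfolding w by (simp add: sgn_div_norm scaleR_conv_of_real mult_ac)
    finally show ?thesis by (simp add: w_def)
  qed
  ultimately show ?thesis by (simp add: sgn_div_norm[abs_def])
qed

text \<open>One family serves three purposes: \<open>(\<alpha>, \<beta>) = (1, 0)\<close> is the
  constant 1, \<open>(1, - 1)\<close> vanishes at the origin and tends to 1 elsewhere as
  \<open>k\<close> grows, and \<open>(0, - 1)\<close> is the difference of the latter from
  1.\<close>

definition cutoff :: "real \<Rightarrow> real \<Rightarrow> real \<Rightarrow> complex \<Rightarrow> real" where
  "cutoff \<alpha> \<beta> k x = \<alpha> + \<beta> / (1 + k * (norm x)\<^sup>2)"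

definition cutoff_deriv :: "real \<Rightarrow> real \<Rightarrow> complex \<Rightarrow> complex \<Rightarrow> real" where
  "cutoff_deriv \<beta> k x v = - (\<beta> * (2 * k * (x \<bullet> v))) / (1 + k * (norm x)\<^sup>2)\<^sup>2"

lemma cutoff_denominator_pos: "k \<ge> 0 \<Longrightarrow> 1 + k * (norm x)\<^sup>2 > 0"
  by (intro add_pos_nonneg mult_nonneg_nonneg) auto

lemma cutoff_has_derivative:
  assumes k: "k \<ge> 0"
  shows "(cutoff \<alpha> \<beta> k has_derivative cutoff_deriv \<beta> k x) (at x)"
proof -
  have nz: "1 + k * (x \<bullet> x) \<noteq> 0" using cutoff_denominator_pos[OF k, of x] by (simp add: power2_norm_eq_inner)
  have "((\<lambda>y. \<alpha> + \<beta> * inverse (1 + k * (y \<bullet> y))) has_derivative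
      (\<lambda>v. 0 + \<beta> * (- (inverse (1 + k * (x \<bullet> x)) * (0 + k * (x \<bullet> v + v \<bullet> x)) * inverse (1 + k * (x \<bullet> x)))))) (at x)"
    by (intro has_derivative_add has_derivative_const has_derivative_mult_right Deriv.has_derivative_inverse
        has_derivative_inner has_derivative_ident nz)
  then have "(cutoff \<alpha> \<beta> k has_derivative
      (\<lambda>v. 0 + \<beta> * (- (inverse (1 + k * (x \<bullet> x)) * (0 + k * (x \<bullet> v + v \<bullet> x)) * inverse (1 + k * (x \<bullet> x)))))) (at x)"
    by (simp add: cutoff_def[abs_def] power2_norm_eq_inner divide_inverse)
  then show ?thesis
    by (rule has_derivative_eq_rhs)
      (simp add: cutoff_deriv_def[abs_def] power2_norm_eq_inner inner_commute divide_inverse power2_eq_square[of "1 + k * (x \<bullet> x)"] mult_ac fun_eq_iff)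
qed

lemma continuous_on_cutoff: "k \<ge> 0 \<Longrightarrow> continuous_on S (cutoff \<alpha> \<beta> k)"
  by (intro continuous_at_imp_continuous_on ballI has_derivative_continuous[OF cutoff_has_derivative])

lemma continuous_on_cutoff_deriv: "k \<ge> 0 \<Longrightarrow> continuous_on S (\<lambda>x. cutoff_deriv \<beta> k x v)"
  unfolding cutoff_deriv_def
  by (intro continuous_intros) (simp add: less_imp_neq[OF cutoff_denominator_pos, symmetric])

lemma abs_cutoff_le: "k \<ge> 0 \<Longrightarrow> \<bar>cutoff \<alpha> \<beta> k x\<bar> \<le> \<bar>\<alpha>\<bar> + \<bar>\<beta>\<bar>"
proof -
  assume k: "k \<ge> 0"
  have "1 \<le> 1 + k * (norm x)\<^sup>2" using k by simp
  then have "\<bar>\<beta> / (1 + k * (norm x)\<^sup>2)\<bar> \<le> \<bar>\<beta>\<bar>"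
    using divide_left_mono[of 1 "1 + k * (norm x)\<^sup>2" "\<bar>\<beta>\<bar>"] by (simp add: abs_divide)
  then show ?thesis unfolding cutoff_def using abs_triangle_ineq[of \<alpha> "\<beta> / (1 + k * (norm x)\<^sup>2)"] by linarith
qed

definition cutoff_grad_norm :: "real \<Rightarrow> real \<Rightarrow> complex \<Rightarrow> real" where
  "cutoff_grad_norm \<beta> k x = \<bar>\<beta>\<bar> * (2 * k * norm x / (1 + k * (norm x)\<^sup>2)\<^sup>2)"

lemma cutoff_deriv_Basis:
  assumes "k \<ge> 0"
  shows "(cutoff_deriv \<beta> k x 1)\<^sup>2 + (cutoff_deriv \<beta> k x \<i>)\<^sup>2 = (cutoff_grad_norm \<beta> k x)\<^sup>2"
proof -
  define q where "q = (1 + k * (norm x)\<^sup>2)\<^sup>2"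
  have "(cutoff_deriv \<beta> k x 1)\<^sup>2 + (cutoff_deriv \<beta> k x \<i>)\<^sup>2 = (\<beta> * (2 * k) / q)\<^sup>2 * ((Re x)\<^sup>2 + (Im x)\<^sup>2)"
    by (simp add: cutoff_deriv_def q_def[symmetric] inner_complex_def power_divide power_mult_distrib add_divide_distrib distrib_left)
  also have "\<dots> = (\<beta> * (2 * k) / q)\<^sup>2 * (norm x)\<^sup>2" by (simp add: cmod_power2)
  also have "\<dots> = (cutoff_grad_norm \<beta> k x)\<^sup>2"
    by (simp add: cutoff_grad_norm_def q_def[symmetric] power_divide power_mult_distrib)
  finally show ?thesis .
qed

lemma cutoff_grad_norm_nonneg: "k \<ge> 0 \<Longrightarrow> 0 \<le> cutoff_grad_norm \<beta> k x"
  by (simp add: cutoff_grad_norm_def)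

text \<open>The bound is uniform in \<open>k\<close> because
  \<open>k * r^2 \<le> (1 + k * r^2)^2\<close>. It is integrable over the disk and so permits
  dominated convergence.\<close>

lemma cutoff_grad_norm_le:
  assumes "k \<ge> 0" "x \<noteq> 0"
  shows "cutoff_grad_norm \<beta> k x \<le> \<bar>\<beta>\<bar> * (2 / norm x)"
proof -
  define r where "r = norm x"
  have r: "r > 0" using assms by (simp add: r_def)
  have kr: "k * r\<^sup>2 \<ge> 0" using assms by simp
  have "k * r\<^sup>2 \<le> (1 + k * r\<^sup>2)\<^sup>2"
  proof -
    have "0 \<le> 1 + k * r\<^sup>2 + (k * r\<^sup>2)\<^sup>2" using kr by simp
    then show ?thesis by (simp add: power2_sum)
  qed
  then have "2 * k * r * r \<le> 2 * (1 + k * r\<^sup>2)\<^sup>2" by (simp add: power2_eq_square)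
  then have "2 * k * r / (1 + k * r\<^sup>2)\<^sup>2 \<le> 2 / r"
    using r kr by (simp add: divide_le_eq le_divide_eq pos_divide_le_eq mult.commute)
  then show ?thesis unfolding cutoff_grad_norm_def r_def by (intro mult_left_mono) auto
qed

lemma cutoff_grad_norm_tendsto:
  assumes x: "x \<noteq> 0"
  shows "(\<lambda>n. cutoff_grad_norm \<beta> (real n) x) \<longlonglongrightarrow> 0"
proof -
  define r where "r = norm x"
  have r: "r > 0" using x by (simp add: r_def)
  have "(\<lambda>n. 2 * real n * r / (1 + real n * r\<^sup>2)\<^sup>2) \<longlonglongrightarrow> 0" using r by real_asymp
  from tendsto_mult_left[OF this, of "\<bar>\<beta>\<bar>"] show ?thesis by (simp add: cutoff_grad_norm_def r_def)
qed

section \<open>Measurability and null sets on the disk\<close>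

lemma measurable_disk_if_continuous_off_0:
  fixes h :: "complex \<Rightarrow> 'b::euclidean_space"
  assumes "continuous_on (ball 0 1 - {0}) h"
  shows "h \<in> borel_measurable (lebesgue_on (ball 0 1))"
proof -
  have b: "(\<lambda>x. indicator (ball 0 1 - {0}) x *\<^sub>R h x) \<in> borel_measurable borel"
    using assms by (intro borel_measurable_continuous_on_indicator) auto
  have "(\<lambda>x. if x = 0 then h 0 else indicator (ball 0 1 - {0}) x *\<^sub>R h x) \<in> borel_measurable borel"
    by (rule measurable_If[OF measurable_const b]) auto
  then have "(\<lambda>x. if x = 0 then h 0 else indicator (ball 0 1 - {0}) x *\<^sub>R h x) \<in> borel_measurable (lebesgue_on (ball 0 1))"
    by (simp add: measurable_completion measurable_restrict_space1)
  moreover have "(\<lambda>x. if x = 0 then h 0 else indicator (ball 0 1 - {0}) x *\<^sub>R h x) \<in> borel_measurable (lebesgue_on (ball 0 1)) \<longleftrightarrow>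
      h \<in> borel_measurable (lebesgue_on (ball 0 1))"
    by (rule measurable_cong) (auto simp: indicator_def)
  ultimately show ?thesis by (rule iffD1[rotated])
qed

lemma AE_disk_neq_0: "AE x in lebesgue_on (ball (0::complex) 1). x \<noteq> 0"
proof -
  have "AE x in lebesgue. x \<noteq> (0::complex)" by (rule AE_completion) (rule AE_lborel_singleton)
  then show ?thesis by (subst AE_restrict_space_iff) auto
qed

lemma finite_measure_disk: "finite_measure (lebesgue_on (ball (0::complex) 1))"
  by (rule finite_measure_lebesgue_on) simp

lemma emeasure_disk_finite: "emeasure lborel (ball (0::complex) 1) < \<infinity>"
  by (simp add: emeasure_ball)

lemma borel_measurable_AE_lebesgue_on:
  fixes f g :: "'a::euclidean_space \<Rightarrow> 'b::euclidean_space"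
  assumes S: "S \<in> sets lebesgue" and f: "f \<in> borel_measurable (lebesgue_on S)"
    and ae: "AE x in lebesgue_on S. f x = g x"
  shows "g \<in> borel_measurable (lebesgue_on S)"
proof -
  have "AE x in lebesgue. indicator S x *\<^sub>R f x = indicator S x *\<^sub>R g x"
    using ae S by (subst (asm) AE_restrict_space_iff) (auto elim!: eventually_mono simp: indicator_def)
  moreover have "(\<lambda>x. indicator S x *\<^sub>R f x) \<in> borel_measurable lebesgue"
    using f S by (simp add: borel_measurable_restrict_space_iff)
  ultimately have "(\<lambda>x. indicator S x *\<^sub>R g x) \<in> borel_measurable lebesgue"
    by (rule borel_measurable_AE[rotated])
  then show ?thesis using S by (simp add: borel_measurable_restrict_space_iff)
qed

section \<open>The extension to the disk\<close>

locale disk_extension =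
  fixes f :: "real \<Rightarrow> real" and C :: complex and d :: int
  assumes f: "integrable angles f" and norm_C: "norm C = 1"
begin

definition uext :: "complex \<Rightarrow> complex" where
  "uext x = C * sgn x powi d * exp (\<i> * complex_of_real (conj_ext f x))"

text \<open>Up to the constant \<open>C\<close>, \<open>uext\<close> is the phase of a holomorphic
  function on the punctured disk, namely \<open>x powi d\<close> times the exponential of a
  primitive of \<open>conj_ext_deriv f\<close>; this is its logarithmic derivative.\<close>

definition log_deriv :: "complex \<Rightarrow> complex" where
  "log_deriv x = of_int d / x + conj_ext_deriv f x"

definition cut_ext :: "real \<Rightarrow> real \<Rightarrow> real \<Rightarrow> complex \<Rightarrow> complex" where
  "cut_ext \<alpha> \<beta> k x = complex_of_real (cutoff \<alpha> \<beta> k x) * uext x"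

text \<open>Factoring out the unimodular \<open>uext\<close> leaves the change of modulus as real
  part and the change of phase as imaginary part, so their squares simply add.\<close>

definition cut_ext_deriv :: "real \<Rightarrow> real \<Rightarrow> real \<Rightarrow> complex \<Rightarrow> complex \<Rightarrow> complex" where
  "cut_ext_deriv \<alpha> \<beta> k v x = uext x * Complex (cutoff_deriv \<beta> k x v) (cutoff \<alpha> \<beta> k x * Im (log_deriv x * v))"

definition cut_ext_grad_norm :: "real \<Rightarrow> real \<Rightarrow> real \<Rightarrow> complex \<Rightarrow> real" where
  "cut_ext_grad_norm \<alpha> \<beta> k x = sqrt ((cutoff_grad_norm \<beta> k x)\<^sup>2 + (cutoff \<alpha> \<beta> k x * norm (log_deriv x))\<^sup>2)"

lemma norm_ext: "x \<noteq> 0 \<Longrightarrow> norm (uext x) = 1"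
  by (simp add: uext_def norm_mult norm_C norm_power_int norm_sgn)

text \<open>At the origin \<open>sgn 0 powi d\<close> is 1 for \<open>d = 0\<close> and 0
  otherwise.\<close>

lemma norm_ext_le: "norm (uext x) \<le> 1"
  by (cases "x = 0") (simp_all add: norm_ext, simp add: uext_def norm_mult norm_C norm_power_int power_int_0_left_if)

lemma ext_has_derivative:
  assumes x: "x \<in> ball 0 1 - {0}"
  shows "(uext has_derivative (\<lambda>v. \<i> * uext x * complex_of_real (Im (log_deriv x * v)))) (at x)"
proof -
  have x': "x \<noteq> 0" "norm x < 1" using x by auto
  have s: "((\<lambda>y. sgn y powi d) has_derivative
      (\<lambda>v. \<i> * sgn x * complex_of_real (Im (v / x)) * (of_int d * sgn x powi (d - 1)))) (at x)"
    by (rule has_derivative_power_int[OF _ sgn_complex_has_derivative[OF x'(1)]]) (use x' in \<open>simp add: sgn_zero_iff\<close>)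
  have e: "((\<lambda>y. exp (\<i> * complex_of_real (conj_ext f y))) has_derivative
      (\<lambda>v. exp (\<i> * complex_of_real (conj_ext f x)) * (\<i> * complex_of_real (Im (conj_ext_deriv f x * v))))) (at x)"
  proof -
    have "((\<lambda>y. \<i> * complex_of_real (conj_ext f y)) has_derivative
        (\<lambda>v. \<i> * complex_of_real (Im (conj_ext_deriv f x * v)))) (at x)"
      by (intro has_derivative_mult_right has_derivative_of_real conj_ext_has_derivative f x')
    from has_derivative_compose[OF this DERIV_exp[unfolded has_field_derivative_def]] show ?thesis .
  qed
  have "(uext has_derivative (\<lambda>v. C * sgn x powi d * (exp (\<i> * complex_of_real (conj_ext f x)) * (\<i> * complex_of_real (Im (conj_ext_deriv f x * v)))) +
      C * (\<i> * sgn x * complex_of_real (Im (v / x)) * (of_int d * sgn x powi (d - 1))) * exp (\<i> * complex_of_real (conj_ext f x)))) (at x)"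
    unfolding uext_def[abs_def] by (intro has_derivative_mult has_derivative_mult_right s e)
  then show ?thesis
  proof (rule has_derivative_eq_rhs, intro ext)
    fix v
    have p: "sgn x powi d = sgn x * sgn x powi (d - 1)"
      using power_int_add_1[of "sgn x" "d - 1"] x'(1) by (simp add: sgn_zero_iff mult.commute)
    have "log_deriv x * v = complex_of_real (of_int d) * (v / x) + conj_ext_deriv f x * v"
      by (simp add: log_deriv_def distrib_right)
    then have "Im (log_deriv x * v) = of_int d * Im (v / x) + Im (conj_ext_deriv f x * v)"
      by (simp only: plus_complex.sel times_complex.sel Re_complex_of_real Im_complex_of_real mult_zero_left add_0_right)
    then have eq: "complex_of_real (Im (log_deriv x * v)) =
        of_int d * complex_of_real (Im (v / x)) + complex_of_real (Im (conj_ext_deriv f x * v))"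
      by (simp only: of_real_add of_real_mult of_real_of_int_eq)
    show "C * sgn x powi d * (exp (\<i> * complex_of_real (conj_ext f x)) * (\<i> * complex_of_real (Im (conj_ext_deriv f x * v)))) +
      C * (\<i> * sgn x * complex_of_real (Im (v / x)) * (of_int d * sgn x powi (d - 1))) * exp (\<i> * complex_of_real (conj_ext f x)) =
      \<i> * uext x * complex_of_real (Im (log_deriv x * v))"
      unfolding uext_def p eq by (simp only: algebra_simps)
  qed
qed

lemma cut_ext_has_derivative:
  assumes k: "k \<ge> 0" and x: "x \<in> ball 0 1 - {0}"
  shows "(cut_ext \<alpha> \<beta> k has_derivative (\<lambda>v. cut_ext_deriv \<alpha> \<beta> k v x)) (at x)"
proof -
  have "(cut_ext \<alpha> \<beta> k has_derivative
      (\<lambda>v. complex_of_real (cutoff \<alpha> \<beta> k x) * (\<i> * uext x * complex_of_real (Im (log_deriv x * v))) +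
        complex_of_real (cutoff_deriv \<beta> k x v) * uext x)) (at x)"
    unfolding cut_ext_def[abs_def]
    by (intro has_derivative_mult has_derivative_of_real cutoff_has_derivative ext_has_derivative k x)
  then show ?thesis
    by (rule has_derivative_eq_rhs)
      (simp add: cut_ext_deriv_def Complex_eq fun_eq_iff algebra_simps)
qed

lemma continuous_on_ext: "continuous_on (cball 0 1 - {0}) uext"
proof -
  have "continuous_on (cball 0 1 - {0}) (conj_ext f)"
    using continuous_on_conj_ext[OF f] by (rule continuous_on_subset) auto
  then show ?thesis unfolding uext_def[abs_def]
    by (intro continuous_intros) (auto simp: sgn_zero_iff)
qed

lemma continuous_on_ext': "continuous_on (ball 0 1 - {0}) uext"
  using continuous_on_ext by (rule continuous_on_subset) auto

lemma continuous_on_log_deriv: "continuous_on (ball 0 1 - {0}) log_deriv"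
proof -
  have "continuous_on (ball 0 1 - {0}) (conj_ext_deriv f)"
    using continuous_on_conj_ext_deriv[OF f] by (rule continuous_on_subset) auto
  then show ?thesis unfolding log_deriv_def[abs_def] by (intro continuous_intros) auto
qed

lemma continuous_on_cut_ext: "k \<ge> 0 \<Longrightarrow> continuous_on (ball 0 1 - {0}) (cut_ext \<alpha> \<beta> k)"
  unfolding cut_ext_def[abs_def] by (intro continuous_intros continuous_on_cutoff continuous_on_ext')

lemma continuous_on_cut_ext_deriv: "k \<ge> 0 \<Longrightarrow> continuous_on (ball 0 1 - {0}) (cut_ext_deriv \<alpha> \<beta> k v)"
  unfolding cut_ext_deriv_def[abs_def]
  by (intro continuous_intros continuous_on_Complex continuous_on_cutoff continuous_on_cutoff_deriv continuous_on_ext' continuous_on_log_deriv)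

section \<open>Integral estimates for the gradient\<close>

text \<open>The factor \<open>1 + pi\<close> is the constant of a single kernel; the other factor is
  the total mass of the kernels in \<open>log_deriv\<close>, namely \<open>\<bar>d\<bar>\<close> at
  the origin and \<open>\<bar>f\<bar> / pi\<close> along the circle.\<close>

definition slope :: real where
  "slope = (\<bar>of_int d\<bar> + (LINT t|angles. \<bar>f t\<bar>) / pi) * (1 + pi)"

lemma slope_nonneg: "slope \<ge> 0"
  by (auto simp: slope_def intro!: mult_nonneg_nonneg add_nonneg_nonneg)

lemma nn_integral_log_deriv_le:
  assumes E: "E \<in> sets borel" "E \<subseteq> ball 0 1"
  shows "(\<integral>\<^sup>+x. indicator E x * ennreal (norm (log_deriv x)) \<partial>lborel) \<le> ennreal (slope * sqrt (measure lborel E))"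
proof -
  interpret A: finite_measure angles by (rule finite_measure_lebesgue_on) simp
  have f_meas [measurable]: "f \<in> borel_measurable angles" using f by (rule borel_measurable_integrable)
  have [measurable]: "cis \<in> borel_measurable angles" by (rule measurable_angles_borel[OF borel_measurable_cis])
  note [measurable] = E(1)
  have fin: "emeasure lborel E < \<infinity>"
    using emeasure_mono[OF E(2), of lborel] emeasure_disk_finite by (auto intro: le_less_trans)
  define P where "P x = (\<integral>\<^sup>+t. ennreal (\<bar>f t\<bar> / norm (cis t - x)) \<partial>angles)" for x
  have P [measurable]: "P \<in> borel_measurable borel"
    unfolding P_def[abs_def] by (rule A.borel_measurable_nn_integral) measurable
  define S where "S = (1 + pi) * sqrt (measure lborel E)"
  have S: "S \<ge> 0" by (simp add: S_def)
  have "(\<integral>\<^sup>+x. indicator E x * ennreal (norm (log_deriv x)) \<partial>lborel) \<le>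
      (\<integral>\<^sup>+x. ennreal \<bar>of_int d\<bar> * (indicator E x * ennreal (1 / norm (x - 0))) + ennreal (1 / pi) * (indicator E x * P x) \<partial>lborel)"
  proof (rule nn_integral_mono)
    fix x
    show "indicator E x * ennreal (norm (log_deriv x)) \<le>
        ennreal \<bar>of_int d\<bar> * (indicator E x * ennreal (1 / norm (x - 0))) + ennreal (1 / pi) * (indicator E x * P x)"
    proof (cases "x \<in> E")
      case True
      then have x: "norm x < 1" using E by auto
      have "norm (log_deriv x) \<le> \<bar>of_int d\<bar> * (1 / norm x) + norm (conj_ext_deriv f x)"
        unfolding log_deriv_def using norm_triangle_ineq[of "of_int d / x"] by (simp add: norm_divide)
      then have "ennreal (norm (log_deriv x)) \<le> ennreal (\<bar>of_int d\<bar> * (1 / norm x) + norm (conj_ext_deriv f x))"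
        by (rule ennreal_leI)
      also have "\<dots> = ennreal (\<bar>of_int d\<bar> * (1 / norm x)) + ennreal (norm (conj_ext_deriv f x))"
        by (rule ennreal_plus) auto
      also have "\<dots> \<le> ennreal \<bar>of_int d\<bar> * ennreal (1 / norm x) + ennreal (1 / pi) * P x"
        unfolding P_def by (intro add_mono norm_conj_ext_deriv_le f x) (simp add: ennreal_mult[symmetric])
      finally show ?thesis using True by simp
    qed simp
  qed
  also have "\<dots> = ennreal \<bar>of_int d\<bar> * (\<integral>\<^sup>+x. indicator E x * ennreal (1 / norm (x - 0)) \<partial>lborel) +
      ennreal (1 / pi) * (\<integral>\<^sup>+x. indicator E x * P x \<partial>lborel)"
    by (subst nn_integral_add, measurable, subst (1 2) nn_integral_cmult, measurable)
  also have "\<dots> \<le> ennreal \<bar>of_int d\<bar> * ennreal S + ennreal (1 / pi) * ennreal ((LINT t|angles. \<bar>f t\<bar>) * S)"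
    unfolding P_def S_def by (intro add_mono mult_left_mono nn_integral_inverse_dist_le nn_integral_potential_le E f fin) auto
  also have "\<dots> = ennreal (\<bar>of_int d\<bar> * S + 1 / pi * ((LINT t|angles. \<bar>f t\<bar>) * S))"
    using S by (simp add: ennreal_mult[symmetric] ennreal_plus[symmetric] del: ennreal_plus)
  also have "\<bar>of_int d\<bar> * S + 1 / pi * ((LINT t|angles. \<bar>f t\<bar>) * S) = slope * sqrt (measure lborel E)"
    by (simp add: slope_def S_def field_simps)
  finally show ?thesis .
qed

lemma integrable_disk_if_nn_integral_finite:
  fixes h :: "complex \<Rightarrow> real"
  assumes h: "continuous_on (ball 0 1 - {0}) h" "\<And>x. 0 \<le> h x"
    and fin: "(\<integral>\<^sup>+x. indicator (ball 0 1 - {0}) x * ennreal (h x) \<partial>lborel) < \<infinity>"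
  shows "integrable (lebesgue_on (ball 0 1)) h"
proof (rule integrableI_bounded)
  show "h \<in> borel_measurable (lebesgue_on (ball 0 1))" by (rule measurable_disk_if_continuous_off_0[OF h(1)])
  have b: "(\<lambda>x. indicator (ball 0 1 - {0}) x *\<^sub>R h x) \<in> borel_measurable borel"
    using h(1) by (intro borel_measurable_continuous_on_indicator) auto
  have "(\<integral>\<^sup>+x. ennreal (norm (h x)) \<partial>lebesgue_on (ball 0 1)) =
      (\<integral>\<^sup>+x. ennreal (indicator (ball 0 1 - {0}) x *\<^sub>R h x) \<partial>lebesgue_on (ball 0 1))"
  proof (rule nn_integral_cong_AE)
    show "AE x in lebesgue_on (ball 0 1). ennreal (norm (h x)) = ennreal (indicator (ball 0 1 - {0}) x *\<^sub>R h x)"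
      using AE_disk_neq_0 AE_space by eventually_elim (auto simp: h(2) indicator_def)
  qed
  also have "\<dots> = (\<integral>\<^sup>+x. ennreal (indicator (ball 0 1 - {0}) x *\<^sub>R h x) * indicator (ball 0 1) x \<partial>lebesgue)"
    by (rule nn_integral_restrict_space) simp
  also have "\<dots> = (\<integral>\<^sup>+x. indicator (ball 0 1 - {0}) x * ennreal (h x) \<partial>lebesgue)"
    by (rule nn_integral_cong) (auto simp: indicator_def)
  also have "\<dots> = (\<integral>\<^sup>+x. indicator (ball 0 1 - {0}) x * ennreal (h x) \<partial>lborel)"
  proof -
    have "(\<lambda>x. ennreal (indicator (ball 0 1 - {0}) x *\<^sub>R h x)) \<in> borel_measurable lborel" using b by simp
    moreover have "ennreal (indicator (ball 0 1 - {0}) x *\<^sub>R h x) = indicator (ball 0 1 - {0}) x * ennreal (h x)" for x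
      by (auto simp: indicator_def)
    ultimately show ?thesis by (subst nn_integral_completion) simp_all
  qed
  finally show "(\<integral>\<^sup>+x. ennreal (norm (h x)) \<partial>lebesgue_on (ball 0 1)) < \<infinity>" using fin by simp
qed

lemma integrable_norm_log_deriv: "integrable (lebesgue_on (ball 0 1)) (\<lambda>x. norm (log_deriv x))"
proof (rule integrable_disk_if_nn_integral_finite)
  show "continuous_on (ball 0 1 - {0}) (\<lambda>x. norm (log_deriv x))"
    by (intro continuous_intros continuous_on_log_deriv)
  show "(\<integral>\<^sup>+x. indicator (ball 0 1 - {0}) x * ennreal (norm (log_deriv x)) \<partial>lborel) < \<infinity>"
    by (rule le_less_trans[OF nn_integral_log_deriv_le]) auto
qed simp

lemma integrable_inverse_norm: "integrable (lebesgue_on (ball 0 1)) (\<lambda>x::complex. 1 / norm x)"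
proof (rule integrable_disk_if_nn_integral_finite)
  show "continuous_on (ball 0 1 - {0}) (\<lambda>x::complex. 1 / norm x)" by (intro continuous_intros) auto
  have fin: "emeasure lborel (ball (0::complex) 1 - {0}) < \<infinity>"
    using emeasure_mono[of "ball 0 1 - {0}" "ball (0::complex) 1" lborel] emeasure_disk_finite by (auto intro: le_less_trans)
  have "(\<integral>\<^sup>+x. indicator (ball 0 1 - {0}) x * ennreal (1 / norm (x - (0::complex))) \<partial>lborel) < \<infinity>"
    by (rule le_less_trans[OF nn_integral_inverse_dist_le[OF _ fin]]) auto
  then show "(\<integral>\<^sup>+x. indicator (ball 0 1 - {0}) x * ennreal (1 / norm (x::complex)) \<partial>lborel) < \<infinity>" by simp
qed simp

text \<open>A multiple independent of \<open>k\<close> dominates everything: 1 is for the values,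
  \<open>2 / norm x\<close> for the gradient of the cutoff, and the last term for the gradient of
  the extension.\<close>

definition majorant :: "complex \<Rightarrow> real" where
  "majorant x = 1 + 2 / norm x + norm (log_deriv x)"

lemma integrable_majorant: "integrable (lebesgue_on (ball 0 1)) majorant"
proof -
  interpret finite_measure "lebesgue_on (ball (0::complex) 1)" by (rule finite_measure_disk)
  have "integrable (lebesgue_on (ball 0 1)) (\<lambda>x. 1 + 2 * (1 / norm x) + norm (log_deriv x))"
    by (intro Bochner_Integration.integrable_add integrable_mult_right integrable_norm_log_deriv integrable_inverse_norm integrable_const)
  then show ?thesis by (simp add: majorant_def[abs_def])
qed

lemma integrable_if_le_majorant:
  fixes h :: "complex \<Rightarrow> 'b::euclidean_space"
  assumes h: "continuous_on (ball 0 1 - {0}) h"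
    and le: "\<And>x. x \<in> ball 0 1 - {0} \<Longrightarrow> norm (h x) \<le> c * majorant x"
  shows "integrable (lebesgue_on (ball 0 1)) h"
proof (rule Bochner_Integration.integrable_bound)
  show "integrable (lebesgue_on (ball 0 1)) (\<lambda>x. c * majorant x)"
    by (intro integrable_mult_right integrable_majorant)
  show "h \<in> borel_measurable (lebesgue_on (ball 0 1))" by (rule measurable_disk_if_continuous_off_0[OF h])
  show "AE x in lebesgue_on (ball 0 1). norm (h x) \<le> norm (c * majorant x)"
    using AE_disk_neq_0 AE_space
  proof eventually_elim
    case (elim x)
    then show ?case using le[of x] by (auto intro: order_trans)
  qed
qed

lemma locally_integrable_disk:
  fixes h :: "complex \<Rightarrow> 'b::euclidean_space"
  assumes "integrable (lebesgue_on (ball 0 1)) h"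
  shows "locally_integrable (ball 0 1) h"
  unfolding locally_integrable_def
proof (intro allI impI, elim conjE)
  fix K :: "complex set" assume K: "compact K" "K \<subseteq> ball 0 1"
  have Ks: "K \<in> sets lebesgue" using lmeasurable_compact[OF K(1)] by (rule fmeasurableD)
  have "integrable lebesgue (\<lambda>x. indicator (ball 0 1) x *\<^sub>R h x)" using assms by (simp add: integrable_restrict_space)
  from integrable_mult_indicator[OF Ks this]
  have "integrable lebesgue (\<lambda>x. indicator K x *\<^sub>R (indicator (ball 0 1) x *\<^sub>R h x))" .
  also have "(\<lambda>x. indicator K x *\<^sub>R (indicator (ball 0 1) x *\<^sub>R h x)) = (\<lambda>x. indicator K x *\<^sub>R h x)"
    using K(2) by (auto simp: indicator_def fun_eq_iff)
  finally show "integrable (lebesgue_on K) h" using Ks by (simp add: integrable_restrict_space)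
qed

lemma cut_ext_grad_norm_le:
  assumes k: "k \<ge> 0"
  shows "cut_ext_grad_norm \<alpha> \<beta> k x \<le> cutoff_grad_norm \<beta> k x + \<bar>cutoff \<alpha> \<beta> k x\<bar> * norm (log_deriv x)"
proof -
  have "sqrt (a\<^sup>2 + b\<^sup>2) \<le> \<bar>a\<bar> + \<bar>b\<bar>" for a b :: real by (rule sqrt_sum_squares_le_sum_abs)
  from this[of "cutoff_grad_norm \<beta> k x" "cutoff \<alpha> \<beta> k x * norm (log_deriv x)"] show ?thesis
    using cutoff_grad_norm_nonneg[OF k, of \<beta> x] by (simp add: cut_ext_grad_norm_def abs_mult)
qed

lemma cut_ext_grad_norm_le_majorant:
  assumes k: "k \<ge> 0" and x: "x \<noteq> 0"
  shows "cut_ext_grad_norm \<alpha> \<beta> k x \<le> (\<bar>\<alpha>\<bar> + \<bar>\<beta>\<bar>) * majorant x"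
proof -
  have "cut_ext_grad_norm \<alpha> \<beta> k x \<le> \<bar>\<beta>\<bar> * (2 / norm x) + (\<bar>\<alpha>\<bar> + \<bar>\<beta>\<bar>) * norm (log_deriv x)"
    by (rule order_trans[OF cut_ext_grad_norm_le[OF k]])
      (intro add_mono cutoff_grad_norm_le mult_right_mono abs_cutoff_le k x norm_ge_zero)
  also have "\<dots> \<le> (\<bar>\<alpha>\<bar> + \<bar>\<beta>\<bar>) * (2 / norm x) + (\<bar>\<alpha>\<bar> + \<bar>\<beta>\<bar>) * norm (log_deriv x)"
    by (intro add_mono mult_right_mono) auto
  also have "\<dots> \<le> (\<bar>\<alpha>\<bar> + \<bar>\<beta>\<bar>) * majorant x" by (simp add: majorant_def distrib_left)
  finally show ?thesis .
qed

text \<open>For complex \<open>z\<close>, \<open>Im (z * 1)\<close> and \<open>Im (z * \<i>)\<close>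
  are the imaginary and the real part of \<open>z\<close>, so the two phase contributions combine to
  the squared modulus of \<open>log_deriv x\<close>.\<close>

lemma cut_ext_deriv_Basis:
  assumes k: "k \<ge> 0" and x: "x \<noteq> 0"
  shows "sqrt (\<Sum>b\<in>Basis. (norm (cut_ext_deriv \<alpha> \<beta> k b x))\<^sup>2) = cut_ext_grad_norm \<alpha> \<beta> k x"
proof -
  define c where "c = cutoff \<alpha> \<beta> k x"
  have "(norm (cut_ext_deriv \<alpha> \<beta> k b x))\<^sup>2 = (cutoff_deriv \<beta> k x b)\<^sup>2 + (c * Im (log_deriv x * b))\<^sup>2" for b
    using x by (simp add: cut_ext_deriv_def norm_mult norm_ext cmod_power2 c_def)
  then have "(\<Sum>b\<in>Basis. (norm (cut_ext_deriv \<alpha> \<beta> k b x))\<^sup>2) =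
      ((cutoff_deriv \<beta> k x 1)\<^sup>2 + (cutoff_deriv \<beta> k x \<i>)\<^sup>2) + c\<^sup>2 * ((Re (log_deriv x))\<^sup>2 + (Im (log_deriv x))\<^sup>2)"
    by (simp add: Basis_complex_def power_mult_distrib algebra_simps)
  also have "\<dots> = (cutoff_grad_norm \<beta> k x)\<^sup>2 + (c * norm (log_deriv x))\<^sup>2"
    unfolding cutoff_deriv_Basis[OF k] by (simp add: cmod_power2 power_mult_distrib)
  finally show ?thesis by (simp add: cut_ext_grad_norm_def c_def)
qed

lemma norm_cut_ext_le_majorant:
  assumes k: "k \<ge> 0"
  shows "norm (cut_ext \<alpha> \<beta> k x) \<le> (\<bar>\<alpha>\<bar> + \<bar>\<beta>\<bar>) * majorant x"
proof -
  have "norm (cut_ext \<alpha> \<beta> k x) \<le> (\<bar>\<alpha>\<bar> + \<bar>\<beta>\<bar>) * 1"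
    unfolding cut_ext_def norm_mult norm_of_real by (intro mult_mono abs_cutoff_le k norm_ext_le) auto
  also have "\<dots> \<le> (\<bar>\<alpha>\<bar> + \<bar>\<beta>\<bar>) * majorant x" by (intro mult_left_mono) (auto simp: majorant_def)
  finally show ?thesis .
qed

lemma has_weak_partial_cut_ext:
  assumes k: "k \<ge> 0" and b: "b \<in> Basis"
  shows "has_weak_partial (ball 0 1) b (cut_ext \<alpha> \<beta> k) (cut_ext_deriv \<alpha> \<beta> k b)"
proof (rule has_weak_partial_off_point[OF open_ball b])
  show "locally_integrable (ball 0 1) (cut_ext \<alpha> \<beta> k)"
  proof (rule locally_integrable_disk, rule integrable_if_le_majorant[OF continuous_on_cut_ext[OF k]])
    fix x :: complex
    show "norm (cut_ext \<alpha> \<beta> k x) \<le> (\<bar>\<alpha>\<bar> + \<bar>\<beta>\<bar>) * majorant x" by (rule norm_cut_ext_le_majorant[OF k])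
  qed
  show "locally_integrable (ball 0 1) (cut_ext_deriv \<alpha> \<beta> k b)"
  proof (rule locally_integrable_disk, rule integrable_if_le_majorant[OF continuous_on_cut_ext_deriv[OF k]])
    fix x :: complex assume x: "x \<in> ball 0 1 - {0}"
    have "norm (cut_ext_deriv \<alpha> \<beta> k b x) = sqrt ((norm (cut_ext_deriv \<alpha> \<beta> k b x))\<^sup>2)" by simp
    also have "\<dots> \<le> sqrt (\<Sum>b\<in>Basis. (norm (cut_ext_deriv \<alpha> \<beta> k b x))\<^sup>2)"
      by (intro real_sqrt_le_mono member_le_sum b) auto
    also have "\<dots> \<le> (\<bar>\<alpha>\<bar> + \<bar>\<beta>\<bar>) * majorant x"
      using cut_ext_deriv_Basis[OF k] cut_ext_grad_norm_le_majorant[OF k] x by auto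
    finally show "norm (cut_ext_deriv \<alpha> \<beta> k b x) \<le> (\<bar>\<alpha>\<bar> + \<bar>\<beta>\<bar>) * majorant x" .
  qed
  show "continuous_on (ball 0 1 - {0}) (cut_ext_deriv \<alpha> \<beta> k b)" by (rule continuous_on_cut_ext_deriv[OF k])
  show "\<exists>D. (cut_ext \<alpha> \<beta> k has_derivative D) (at x) \<and> D b = cut_ext_deriv \<alpha> \<beta> k b x" if "x \<in> ball 0 1 - {0}" for x
    using cut_ext_has_derivative[OF k that] by blast
qed

lemma weakly_differentiable_cut_ext: "k \<ge> 0 \<Longrightarrow> weakly_differentiable (ball 0 1) (cut_ext \<alpha> \<beta> k)"
  unfolding weakly_differentiable_def using has_weak_partial_cut_ext by blast

lemma AE_weak_grad_norm_cut_ext: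
  assumes k: "k \<ge> 0"
  shows "AE x in lebesgue_on (ball 0 1). weak_grad_norm (ball 0 1) (cut_ext \<alpha> \<beta> k) x = cut_ext_grad_norm \<alpha> \<beta> k x"
proof -
  have "AE x in lebesgue_on (ball 0 1). \<forall>b\<in>Basis. weak_partial (ball 0 1) b (cut_ext \<alpha> \<beta> k) x = cut_ext_deriv \<alpha> \<beta> k b x"
    by (subst AE_ball_countable) (auto intro!: weak_partial_AE_eq has_weak_partial_cut_ext k countable_finite)
  then show ?thesis using AE_disk_neq_0
    by eventually_elim (simp add: weak_grad_norm_def cut_ext_deriv_Basis[OF k, symmetric])
qed

text \<open>The chosen weak partials agree almost everywhere with functions continuous off the
  origin, and completeness of Lebesgue measure transfers measurability to them.\<close>

lemma measurable_weak_grad_norm_cut_ext: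
  assumes k: "k \<ge> 0"
  shows "weak_grad_norm (ball 0 1) (cut_ext \<alpha> \<beta> k) \<in> borel_measurable (lebesgue_on (ball 0 1))"
proof -
  have wp: "weak_partial (ball 0 1) b (cut_ext \<alpha> \<beta> k) \<in> borel_measurable (lebesgue_on (ball 0 1))" if b: "b \<in> Basis" for b
  proof -
    have m: "cut_ext_deriv \<alpha> \<beta> k b \<in> borel_measurable (lebesgue_on (ball 0 1))"
      by (rule measurable_disk_if_continuous_off_0[OF continuous_on_cut_ext_deriv[OF k]])
    have "AE x in lebesgue_on (ball 0 1). cut_ext_deriv \<alpha> \<beta> k b x = weak_partial (ball 0 1) b (cut_ext \<alpha> \<beta> k) x"
      using weak_partial_AE_eq[OF open_ball has_weak_partial_cut_ext[OF k b, of \<alpha> \<beta>]] by eventually_elim (rule sym)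
    then show ?thesis
      by (intro borel_measurable_AE_lebesgue_on[OF _ m]) simp_all
  qed
  show ?thesis unfolding weak_grad_norm_def[abs_def]
    by (intro measurable_compose[OF _ borel_measurable_sqrt] borel_measurable_sum borel_measurable_power measurable_compose[OF _ borel_measurable_norm] wp)
qed

end

section \<open>Sobolev norm and trace of the extension\<close>

context disk_extension
begin

lemma cut_ext_1_0: "cut_ext 1 0 k = uext"
  by (simp add: cut_ext_def cutoff_def fun_eq_iff)

lemma cut_ext_in_W11:
  assumes k: "k \<ge> 0"
  shows "cut_ext \<alpha> \<beta> k \<in> W11 (ball 0 1)"
proof -
  have "integrable (lebesgue_on (ball 0 1)) (cut_ext \<alpha> \<beta> k)"
  proof (rule integrable_if_le_majorant[OF continuous_on_cut_ext[OF k]])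
    fix x :: complex
    show "norm (cut_ext \<alpha> \<beta> k x) \<le> (\<bar>\<alpha>\<bar> + \<bar>\<beta>\<bar>) * majorant x" by (rule norm_cut_ext_le_majorant[OF k])
  qed
  moreover have "integrable (lebesgue_on (ball 0 1)) (weak_grad_norm (ball 0 1) (cut_ext \<alpha> \<beta> k))"
  proof (rule Bochner_Integration.integrable_bound)
    show "integrable (lebesgue_on (ball 0 1)) (\<lambda>x. (\<bar>\<alpha>\<bar> + \<bar>\<beta>\<bar>) * majorant x)"
      by (intro integrable_mult_right integrable_majorant)
    show "weak_grad_norm (ball 0 1) (cut_ext \<alpha> \<beta> k) \<in> borel_measurable (lebesgue_on (ball 0 1))"
      by (rule measurable_weak_grad_norm_cut_ext[OF k])
    show "AE x in lebesgue_on (ball 0 1). norm (weak_grad_norm (ball 0 1) (cut_ext \<alpha> \<beta> k) x) \<le> norm ((\<bar>\<alpha>\<bar> + \<bar>\<beta>\<bar>) * majorant x)"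
      using AE_weak_grad_norm_cut_ext[OF k, of \<alpha> \<beta>] AE_disk_neq_0
    proof eventually_elim
      case (elim x)
      have "0 \<le> cut_ext_grad_norm \<alpha> \<beta> k x" by (simp add: cut_ext_grad_norm_def)
      then show ?case
        using cut_ext_grad_norm_le_majorant[OF k elim(2), of \<alpha> \<beta>] unfolding elim(1) by (auto intro: order_trans)
    qed
  qed
  ultimately show ?thesis using weakly_differentiable_cut_ext[OF k] by (simp add: W11_def)
qed

lemma weak_Lp_sup_uext_le: "weak_Lp_sup 2 (ball 0 1) uext \<le> ennreal pi"
  unfolding weak_Lp_sup_def
proof (rule SUP_least)
  fix t :: real assume "t \<in> {0<..}"
  then have t: "t > 0" by simp
  show "ennreal (t powr 2) * emeasure (lebesgue_on (ball 0 1)) {x \<in> ball 0 1. t < norm (uext x)} \<le> ennreal pi"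
  proof (cases "t < 1")
    case True
    have "emeasure (lebesgue_on (ball 0 1)) {x \<in> ball 0 1. t < norm (uext x)} \<le> emeasure (lebesgue_on (ball 0 1)) (space (lebesgue_on (ball (0::complex) 1)))"
      by (rule emeasure_space)
    also have "\<dots> = ennreal pi"
      by (simp add: emeasure_restrict_space emeasure_completion emeasure_ball unit_ball_vol_2)
    finally have e: "emeasure (lebesgue_on (ball 0 1)) {x \<in> ball 0 1. t < norm (uext x)} \<le> ennreal pi" .
    have "t powr 2 \<le> 1" using t True by (simp add: powr_numeral power_le_one)
    then have "ennreal (t powr 2) * emeasure (lebesgue_on (ball 0 1)) {x \<in> ball 0 1. t < norm (uext x)} \<le> 1 * ennreal pi"
      by (intro mult_mono e) (auto simp: ennreal_le_1)
    then show ?thesis by simp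
  next
    case False
    then have empty: "{x \<in> ball 0 1. t < norm (uext x)} = {}" using norm_ext_le by (auto simp: not_less intro: order_trans)
    show ?thesis unfolding empty by simp
  qed
qed

lemma weak_Lp_sup_grad_uext_le: "weak_Lp_sup 2 (ball 0 1) (weak_grad_norm (ball 0 1) uext) \<le> ennreal (slope\<^sup>2)"
\<comment> \<open>The indicator makes the majorant Borel on the whole plane, since
  \<open>log_deriv\<close> is continuous on the punctured disk.\<close>
proof (rule weak_Lp_sup_le_if_integral_bound[where g = "\<lambda>x. indicator (ball 0 1 - {0}) x *\<^sub>R norm (log_deriv x)"])
  show "(\<lambda>x. indicator (ball 0 1 - {0}) x *\<^sub>R norm (log_deriv x)) \<in> borel_measurable borel"
    by (intro borel_measurable_continuous_on_indicator continuous_intros continuous_on_log_deriv) auto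
  show "weak_grad_norm (ball 0 1) uext \<in> borel_measurable (lebesgue_on (ball 0 1))"
    using measurable_weak_grad_norm_cut_ext[of 0 1 0] by (simp add: cut_ext_1_0)
  have "AE x in lebesgue_on (ball 0 1). weak_grad_norm (ball 0 1) (cut_ext 1 0 0) x = cut_ext_grad_norm 1 0 0 x"
    by (rule AE_weak_grad_norm_cut_ext) simp
  then show "AE x in lebesgue_on (ball 0 1). norm (weak_grad_norm (ball 0 1) uext x) \<le> indicator (ball 0 1 - {0}) x *\<^sub>R norm (log_deriv x)"
    using AE_disk_neq_0 AE_space
    by eventually_elim (simp add: cut_ext_1_0 cut_ext_grad_norm_def cutoff_grad_norm_def cutoff_def)
  fix E :: "complex set" assume E: "E \<in> sets borel" "E \<subseteq> ball 0 1"
  have "(\<integral>\<^sup>+x. indicator E x * ennreal (indicator (ball 0 1 - {0}) x *\<^sub>R norm (log_deriv x)) \<partial>lborel) \<le>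
      (\<integral>\<^sup>+x. indicator E x * ennreal (norm (log_deriv x)) \<partial>lborel)"
    by (intro nn_integral_mono mult_left_mono ennreal_leI) (auto simp: indicator_def)
  also have "\<dots> \<le> ennreal (slope * sqrt (measure lborel E))" by (rule nn_integral_log_deriv_le[OF E])
  finally show "(\<integral>\<^sup>+x. indicator E x * ennreal (indicator (ball 0 1 - {0}) x *\<^sub>R norm (log_deriv x)) \<partial>lborel) \<le> ennreal (slope * sqrt (measure lborel E))" .
qed (use emeasure_disk_finite slope_nonneg in auto)

lemma uext_in_W1_weak: "uext \<in> W1_weak_disk_S1 2"
proof -
  have m: "uext \<in> borel_measurable (lebesgue_on (ball 0 1))"
    by (rule measurable_disk_if_continuous_off_0[OF continuous_on_ext'])
  have g: "weak_grad_norm (ball 0 1) uext \<in> borel_measurable (lebesgue_on (ball 0 1))"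
    using measurable_weak_grad_norm_cut_ext[of 0 1 0] by (simp add: cut_ext_1_0)
  have "weakly_differentiable (ball 0 1) uext"
    using weakly_differentiable_cut_ext[of 0 1 0] by (simp add: cut_ext_1_0)
  moreover have "weak_Lp_sup 2 (ball 0 1) uext < \<infinity>" "weak_Lp_sup 2 (ball 0 1) (weak_grad_norm (ball 0 1) uext) < \<infinity>"
    using weak_Lp_sup_uext_le weak_Lp_sup_grad_uext_le by (auto intro: le_less_trans)
  moreover have "AE x in lebesgue_on (ball 0 1). uext x \<in> sphere 0 1"
    using AE_disk_neq_0 by eventually_elim (simp add: norm_ext)
  ultimately show ?thesis using m g by (simp add: W1_weak_disk_S1_def W1_weak_def weak_Lp_def)
qed

lemma W1_weak_norm_uext_le: "W1_weak_norm 2 (ball 0 1) uext \<le> 2 + slope"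
proof -
  have "weak_Lp_norm 2 (ball 0 1) uext \<le> sqrt pi" by (rule weak_Lp_norm_le_sqrt[OF weak_Lp_sup_uext_le]) simp
  also have "\<dots> \<le> 2" using pi_less_4 by (intro real_le_lsqrt) auto
  finally have 1: "weak_Lp_norm 2 (ball 0 1) uext \<le> 2" .
  have "weak_Lp_norm 2 (ball 0 1) (weak_grad_norm (ball 0 1) uext) \<le> sqrt (slope\<^sup>2)"
    by (rule weak_Lp_norm_le_sqrt[OF weak_Lp_sup_grad_uext_le]) simp
  then have 2: "weak_Lp_norm 2 (ball 0 1) (weak_grad_norm (ball 0 1) uext) \<le> slope" using slope_nonneg by simp
  show ?thesis unfolding W1_weak_norm_def using 1 2 by (rule add_mono)
qed

text \<open>The factor \<open>cutoff 1 (- 1) n\<close> vanishes at the origin, where \<open>uext\<close> is discontinuous, and tends to \<open>1\<close>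
  uniformly near the circle.\<close>

lemma continuous_on_cut_ext_cball:
  assumes k: "k \<ge> 0"
  shows "continuous_on (cball 0 1) (cut_ext 1 (- 1) k)"
proof -
  have off: "continuous_on (cball 0 1 - {0}) (cut_ext 1 (- 1) k)"
    unfolding cut_ext_def[abs_def] by (intro continuous_intros continuous_on_cutoff continuous_on_ext k)
  have at0: "isCont (cut_ext 1 (- 1) k) 0"
  proof -
    have "isCont (cutoff 1 (- 1) k) 0" by (rule has_derivative_continuous[OF cutoff_has_derivative[OF k]])
    then have "(cutoff 1 (- 1) k \<longlongrightarrow> 0) (at 0)" by (simp add: isCont_def cutoff_def)
    then have "(cut_ext 1 (- 1) k \<longlongrightarrow> 0) (at 0)"
    proof (rule Lim_null_comparison[rotated, OF tendsto_rabs_zero])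
      show "\<forall>\<^sub>F x in at 0. norm (cut_ext 1 (- 1) k x) \<le> \<bar>cutoff 1 (- 1) k x\<bar>"
        using norm_ext_le by (intro always_eventually allI) (simp add: cut_ext_def norm_mult mult_left_le)
    qed
    then show ?thesis by (simp add: isCont_def cut_ext_def cutoff_def)
  qed
  show ?thesis unfolding continuous_on_eq_continuous_within
  proof
    fix x :: complex assume x: "x \<in> cball 0 1"
    show "continuous (at x within cball 0 1) (cut_ext 1 (- 1) k)"
    proof (cases "x = 0")
      case True
      then show ?thesis using at0 by (simp add: continuous_at_imp_continuous_at_within)
    next
      case False
      then have "continuous (at x within cball 0 1 - {0}) (cut_ext 1 (- 1) k)"
        using off x by (simp add: continuous_on_eq_continuous_within)
      moreover have "at x within cball 0 1 - {0} = at x within cball 0 1"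
        by (rule at_within_nhd[of x "- {0}"]) (use False in auto)
      ultimately show ?thesis by simp
    qed
  qed
qed

text \<open>Off the origin the values and gradients tend to 0, with dominating functions 1 and
  \<open>majorant\<close> that do not depend on \<open>n\<close>. The gradients of the cutoffs
  concentrate at the origin but stay below the integrable \<open>2 / norm x\<close>.\<close>

lemma W11_norm_cut_ext_tendsto_0:
  "(\<lambda>n. W11_norm (ball 0 1) (cut_ext 0 (- 1) (real n))) \<longlonglongrightarrow> 0"
proof -
  interpret finite_measure "lebesgue_on (ball (0::complex) 1)" by (rule finite_measure_disk)
  have cutoff_lim: "(\<lambda>n. cutoff 0 (- 1) (real n) x) \<longlonglongrightarrow> 0" if "x \<noteq> 0" for x :: complex
  proof -
    define r where "r = norm x"
    have "r > 0" using that by (simp add: r_def)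
    then have "(\<lambda>n. - 1 / (1 + real n * r\<^sup>2)) \<longlonglongrightarrow> 0" by real_asymp
    then show ?thesis by (simp add: cutoff_def r_def)
  qed
  have 1: "(\<lambda>n. LINT x|lebesgue_on (ball 0 1). norm (cut_ext 0 (- 1) (real n) x)) \<longlonglongrightarrow> (LINT x|lebesgue_on (ball (0::complex) 1). 0)"
  proof (rule integral_dominated_convergence)
    show "integrable (lebesgue_on (ball (0::complex) 1)) (\<lambda>_. 1::real)" by (rule integrable_const)
    show "(\<lambda>x. norm (cut_ext 0 (- 1) (real n) x)) \<in> borel_measurable (lebesgue_on (ball 0 1))" for n
      by (intro measurable_compose[OF _ borel_measurable_norm] measurable_disk_if_continuous_off_0 continuous_on_cut_ext) simp
    show "AE x in lebesgue_on (ball 0 1). (\<lambda>n. norm (cut_ext 0 (- 1) (real n) x)) \<longlonglongrightarrow> 0"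
      using AE_disk_neq_0
    proof eventually_elim
      case (elim x)
      have "(\<lambda>n. norm (cut_ext 0 (- 1) (real n) x)) = (\<lambda>n. \<bar>cutoff 0 (- 1) (real n) x\<bar>)"
        using elim by (simp add: cut_ext_def norm_mult norm_ext)
      then show ?case using tendsto_rabs_zero[OF cutoff_lim[OF elim]] by simp
    qed
    show "AE x in lebesgue_on (ball 0 1). norm (norm (cut_ext 0 (- 1) (real n) x)) \<le> 1" for n
    proof (rule AE_I2)
      fix x :: complex
      have "\<bar>cutoff 0 (- 1) (real n) x\<bar> * norm (uext x) \<le> 1 * 1"
        using abs_cutoff_le[of "real n" 0 "- 1" x] norm_ext_le by (intro mult_mono) auto
      then show "norm (norm (cut_ext 0 (- 1) (real n) x)) \<le> 1" by (simp add: cut_ext_def norm_mult)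
    qed
  qed simp
  have 2: "(\<lambda>n. LINT x|lebesgue_on (ball 0 1). weak_grad_norm (ball 0 1) (cut_ext 0 (- 1) (real n)) x) \<longlonglongrightarrow> (LINT x|lebesgue_on (ball (0::complex) 1). 0)"
  proof (rule integral_dominated_convergence)
    show "integrable (lebesgue_on (ball 0 1)) majorant" by (rule integrable_majorant)
    show "weak_grad_norm (ball 0 1) (cut_ext 0 (- 1) (real n)) \<in> borel_measurable (lebesgue_on (ball 0 1))" for n
      by (rule measurable_weak_grad_norm_cut_ext) simp
    \<comment> \<open>Countably many null sets are discarded at once, so that the limit in
      \<open>n\<close> can be taken at a fixed point.\<close>
    have ae: "AE x in lebesgue_on (ball 0 1). \<forall>n. weak_grad_norm (ball 0 1) (cut_ext 0 (- 1) (real n)) x = cut_ext_grad_norm 0 (- 1) (real n) x"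
      unfolding AE_all_countable by (intro allI AE_weak_grad_norm_cut_ext) simp
    show "AE x in lebesgue_on (ball 0 1). (\<lambda>n. weak_grad_norm (ball 0 1) (cut_ext 0 (- 1) (real n)) x) \<longlonglongrightarrow> 0"
      using ae AE_disk_neq_0
    proof eventually_elim
      case (elim x)
      have "(\<lambda>n. sqrt ((cutoff_grad_norm (- 1) (real n) x)\<^sup>2 + (cutoff 0 (- 1) (real n) x * norm (log_deriv x))\<^sup>2)) \<longlonglongrightarrow>
          sqrt (0\<^sup>2 + (0 * norm (log_deriv x))\<^sup>2)"
        by (intro tendsto_intros cutoff_grad_norm_tendsto cutoff_lim elim)
      then show ?case using elim(1) by (simp add: cut_ext_grad_norm_def)
    qed
    show "AE x in lebesgue_on (ball 0 1). norm (weak_grad_norm (ball 0 1) (cut_ext 0 (- 1) (real n)) x) \<le> majorant x" for n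
      using ae AE_disk_neq_0
    proof eventually_elim
      case (elim x)
      have "0 \<le> cut_ext_grad_norm 0 (- 1) (real n) x" by (simp add: cut_ext_grad_norm_def)
      then show ?case using elim cut_ext_grad_norm_le_majorant[of "real n" x 0 "- 1"] by simp
    qed
  qed simp
  from tendsto_add[OF 1 2] show ?thesis by (simp add: W11_norm_def)
qed

text \<open>On the circle the cutoff is the constant \<open>1 - 1 / (1 + n)\<close>, so the boundary
  error is exactly \<open>1 / (1 + n)\<close> at almost every angle. In the disk the error is the
  family with parameters 0 and - 1.\<close>

lemma has_trace_uext:
  assumes \<phi>: "integrable angles (\<lambda>t. \<phi> (cis t))" and eq: "AE t in angles. uext (cis t) = \<phi> (cis t)"
  shows "has_trace uext \<phi>"
  unfolding has_trace_def
proof (intro conjI exI[of _ "\<lambda>n. cut_ext 1 (- 1) (real n)"] allI)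
  show "uext \<in> W11 disk" using cut_ext_in_W11[of 0 1 0] by (simp add: cut_ext_1_0)
  show "cut_ext 1 (- 1) (real n) \<in> W11 disk" for n by (rule cut_ext_in_W11) simp
  show "continuous_on (cball 0 1) (cut_ext 1 (- 1) (real n))" for n by (rule continuous_on_cut_ext_cball) simp
  have "(\<lambda>x. cut_ext 1 (- 1) (real n) x - uext x) = cut_ext 0 (- 1) (real n)" for n
    by (simp add: cut_ext_def cutoff_def fun_eq_iff algebra_simps)
  then show "(\<lambda>n. W11_norm disk (\<lambda>x. cut_ext 1 (- 1) (real n) x - uext x)) \<longlonglongrightarrow> 0"
    using W11_norm_cut_ext_tendsto_0 by simp
  have "(LINT t|angles. norm (cut_ext 1 (- 1) (real n) (cis t) - \<phi> (cis t))) = (LINT t|angles. 1 / (1 + real n))" for n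
  proof (rule integral_cong_AE)
    have "continuous_on UNIV (\<lambda>t. cut_ext 1 (- 1) (real n) (cis t))"
      by (rule continuous_on_compose2[OF continuous_on_cut_ext_cball]) (auto intro!: continuous_intros)
    then have "(\<lambda>t. cut_ext 1 (- 1) (real n) (cis t)) \<in> borel_measurable angles"
      by (intro measurable_angles_borel borel_measurable_continuous_onI)
    then show "(\<lambda>t. norm (cut_ext 1 (- 1) (real n) (cis t) - \<phi> (cis t))) \<in> borel_measurable angles"
      by (intro measurable_compose[OF _ borel_measurable_norm] borel_measurable_diff borel_measurable_integrable[OF \<phi>])
    show "AE t in angles. norm (cut_ext 1 (- 1) (real n) (cis t) - \<phi> (cis t)) = 1 / (1 + real n)"
      using eq
    proof eventually_elim
      case (elim t)
      have "cut_ext 1 (- 1) (real n) (cis t) - \<phi> (cis t) = complex_of_real (- 1 / (1 + real n)) * uext (cis t)"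
        unfolding elim[symmetric] by (simp add: cut_ext_def cutoff_def algebra_simps)
      then show ?case by (simp only: norm_mult norm_of_real) (simp add: norm_ext)
    qed
  qed simp
  moreover have "(\<lambda>n. LINT t|angles. 1 / (1 + real n)) \<longlonglongrightarrow> 0"
  proof -
    have "(\<lambda>n. 1 / (1 + real n)) \<longlonglongrightarrow> 0" by real_asymp
    from tendsto_mult_right[OF this, of "measure angles (space angles)"] show ?thesis by (simp add: mult.commute)
  qed
  ultimately show "(\<lambda>n. LINT t|angles. norm (cut_ext 1 (- 1) (real n) (cis t) - \<phi> (cis t))) \<longlonglongrightarrow> 0" by simp
qed (rule \<phi>)

end

section \<open>Lifting a Sobolev map of the circle to a phase\<close>

text \<open>The absolutely continuous representative has modulus 1 almost everywhere, hence
  everywhere by continuity, and so is an exponential. Constant modulus makes the exponent purely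
  imaginary, and closing up after one turn makes the total phase a multiple of
  \<open>2 * pi\<close>.\<close>

lemma W11_circle_S1_lift:
  assumes \<phi>: "\<phi> \<in> W11_circle_S1"
  obtains f \<Phi>0 d where "integrable angles f" "(LINT t|angles. \<bar>f t\<bar>) \<le> W11_circle_norm \<phi>" "norm \<Phi>0 = 1"
    "integral {0..2 * pi} f = 2 * pi * of_int d"
    "AE t in angles. \<phi> (cis t) = \<Phi>0 * exp (\<i> * complex_of_real (integral {0..t} f))"
proof -
  have "\<exists>\<psi>. has_weak_tangential \<phi> \<psi>" using \<phi> by (simp add: W11_circle_S1_def W11_circle_def)
  then have T: "has_weak_tangential \<phi> (weak_tangential \<phi>)" unfolding weak_tangential_def by (rule someI_ex)
  define \<psi> where "\<psi> t = weak_tangential \<phi> (cis t)" for t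
  have i\<psi>: "integrable angles \<psi>" using T by (simp add: has_weak_tangential_def \<psi>_def[abs_def])
  then have a\<psi>: "\<psi> absolutely_integrable_on {0..2 * pi}" by (simp add: absolutely_integrable_on_iff_integrable)
  obtain c where c: "AE t in angles. \<phi> (cis t) = c + integral {0..t} \<psi>"
    using has_weak_tangential_AE_eq_indefinite_integral[OF T] unfolding \<psi>_def by blast
  define \<Phi> where "\<Phi> t = c + integral {0..t} \<psi>" for t
  have c\<Phi>: "continuous_on {0..2 * pi} \<Phi>"
    unfolding \<Phi>_def by (intro continuous_intros indefinite_integral_continuous_AC a\<psi>)
  have ae: "AE t in angles. norm (\<Phi> t) = 1"
    using c \<phi>[unfolded W11_circle_S1_def, simplified, THEN conjunct2] by eventually_elim (simp add: \<Phi>_def)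
  have uni: "norm (\<Phi> t) = 1" if t: "t \<in> {0..2 * pi}" for t
  proof -
    define Z where "Z = {t \<in> {0..2 * pi}. norm (\<Phi> t) = 1}"
    have Z: "closed Z"
      unfolding Z_def by (intro continuous_closed_preimage_constant continuous_intros c\<Phi>)
    \<comment> \<open>A nonempty open set charges Lebesgue measure, so the open interval lies in the
      closed set \<open>Z\<close>; the endpoints follow by closure.\<close>
    have aeZ: "AE t in lebesgue. t \<in> {0<..<2 * pi} \<longrightarrow> t \<in> Z"
      using ae by (subst (asm) AE_restrict_space_iff) (auto simp: Z_def elim!: eventually_mono)
    have "{0<..<2 * pi} \<subseteq> Z"
      by (intro subsetI mem_closed_if_AE_lebesgue_open[OF open_greaterThanLessThan Z aeZ])
    then have "closure {0<..<2 * pi} \<subseteq> Z" by (rule closure_minimal[OF _ Z])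
    then show ?thesis using t by (auto simp: Z_def)
  qed
  define q where "q t = cnj (\<Phi> t) * \<psi> t" for t
  have q: "q absolutely_integrable_on {0..2 * pi}"
    unfolding q_def by (rule absolutely_integrable_bilinear[OF bounded_bilinear_mult _ a\<psi>]) (intro continuous_intros c\<Phi>)
  define f where "f t = Im (q t)" for t
  have f: "integrable angles f"
    using q unfolding absolutely_integrable_on_iff_integrable f_def[abs_def] by (rule integrable_Im)
  have exp: "\<Phi> t = \<Phi> 0 * exp (integral {0..t} q)" if "t \<in> {0..2 * pi}" for t
    unfolding q_def by (rule unimodular_AC_exp[OF a\<psi> _ uni that]) (simp_all add: \<Phi>_def)
  have Q: "integral {0..t} q = \<i> * complex_of_real (integral {0..t} f)" if t: "t \<in> {0..2 * pi}" for t
  proof -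
    have "q integrable_on {0..t}"
      using q t by (auto simp: absolutely_integrable_on_def intro: integrable_on_subinterval)
    from integral_linear[OF this bounded_linear_Im]
    have Im: "Im (integral {0..t} q) = integral {0..t} f" by (simp add: f_def[abs_def] o_def)
    have "1 = exp (Re (integral {0..t} q))"
      using arg_cong[OF exp[OF t], of norm] uni[OF t] uni[of 0] by (simp add: norm_mult)
    then have "Re (integral {0..t} q) = 0" by simp
    then show ?thesis by (simp add: complex_eq_iff Im)
  qed
  show ?thesis
  proof (rule that[OF f])
    have "(LINT t|angles. \<bar>f t\<bar>) \<le> (LINT t|angles. norm (\<psi> t))"
    proof (rule integral_mono)
      fix t assume "t \<in> space angles"
      then show "\<bar>f t\<bar> \<le> norm (\<psi> t)"
        using abs_Im_le_cmod[of "q t"] uni[of t] by (simp add: f_def q_def norm_mult)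
    qed (use f i\<psi> in auto)
    also have "\<dots> \<le> W11_circle_norm \<phi>" by (simp add: W11_circle_norm_def \<psi>_def)
    finally show "(LINT t|angles. \<bar>f t\<bar>) \<le> W11_circle_norm \<phi>" .
    show "norm (\<Phi> 0) = 1" using uni[of 0] by simp
    have "\<Phi> (2 * pi) = \<Phi> 0"
      using has_weak_tangential_mean_zero[OF T] by (simp add: \<Phi>_def \<psi>_def[abs_def])
    then have "\<Phi> 0 * exp (\<i> * complex_of_real (integral {0..2 * pi} f)) = \<Phi> 0"
      using exp[of "2 * pi"] Q[of "2 * pi"] by simp
    moreover have "\<Phi> 0 \<noteq> 0" using uni[of 0] by auto
    ultimately have "exp (\<i> * complex_of_real (integral {0..2 * pi} f)) = 1" by simp
    then obtain n :: int where "integral {0..2 * pi} f = of_int (2 * n) * pi" by (auto simp: exp_eq_1)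
    then have "integral {0..2 * pi} f = 2 * pi * of_int n" by simp
    \<comment> \<open>The degree must be a term that does not mention the local \<open>n\<close>,
      hence the choice expression.\<close>
    then show "integral {0..2 * pi} f = 2 * pi * of_int (SOME n. integral {0..2 * pi} f = 2 * pi * of_int n)"
      by (rule someI)
    show "AE t in angles. \<phi> (cis t) = \<Phi> 0 * exp (\<i> * complex_of_real (integral {0..t} f))"
      using c AE_space
    proof eventually_elim
      case (elim t)
      then have "t \<in> {0..2 * pi}" by simp
      then show ?case using elim(1) exp[of t] Q[of t] by (simp add: \<Phi>_def)
    qed
  qed
qed

theorem theorem2p5:
  shows "\<exists>g :: real \<Rightarrow> real. (\<forall>s\<ge>0. g s \<ge> 0) \<and>
    (\<forall>\<phi> \<in> W11_circle_S1. \<exists>u \<in> W1_weak_disk_S1 2.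
        has_trace u \<phi> \<and> W1_weak_norm 2 disk u \<le> g (W11_circle_norm \<phi>))"
proof (intro exI[of _ "\<lambda>s. 2 + 2 * s"] conjI ballI allI impI)
  \<comment> \<open>In the witness \<open>2 + 2 * s\<close> the summand 2 dominates
    \<open>sqrt pi\<close>, the contribution of a unimodular map on a disk of area
    \<open>pi\<close>, and \<open>2 * s\<close> dominates \<open>slope\<close>.\<close>
  fix \<phi> assume \<phi>: "\<phi> \<in> W11_circle_S1"
  obtain f \<Phi>0 d where f: "integrable angles f" and fN: "(LINT t|angles. \<bar>f t\<bar>) \<le> W11_circle_norm \<phi>"
    and \<Phi>0: "norm \<Phi>0 = 1" and d: "integral {0..2 * pi} f = 2 * pi * of_int d"
    and lift: "AE t in angles. \<phi> (cis t) = \<Phi>0 * exp (\<i> * complex_of_real (integral {0..t} f))"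
    by (rule W11_circle_S1_lift[OF \<phi>])
  \<comment> \<open>The additive constant in the boundary values of \<open>conj_ext f\<close>; the
    rotation hidden in \<open>C\<close> cancels it.\<close>
  define c where "c = 1 / (2 * pi) * (LINT t|angles. t * f t) - integral {0..2 * pi} f / 2"
  define C where "C = \<Phi>0 * exp (- (\<i> * complex_of_real c))"
  interpret disk_extension f C d
    by unfold_locales (use f \<Phi>0 in \<open>simp_all add: C_def norm_mult\<close>)
  have circle: "uext (cis t) = \<Phi>0 * exp (\<i> * complex_of_real (integral {0..t} f))" if t: "t \<in> {0..2 * pi}" for t
  proof -
    have H: "conj_ext f (cis t) = integral {0..t} f - of_int d * t + c"
      unfolding conj_ext_circle[OF f t] c_def d by simp
    have s: "sgn (cis t) powi d = exp (\<i> * complex_of_real (of_int d * t))"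
    proof -
      have "sgn (cis t) = cis t" by (simp add: sgn_div_norm)
      then have "sgn (cis t) powi d = cis (of_int d * t)" by (simp add: cis_power_int)
      then show ?thesis unfolding cis_conv_exp .
    qed
    have "exp (- (\<i> * complex_of_real c)) * exp (\<i> * complex_of_real (of_int d * t)) *
        exp (\<i> * complex_of_real (integral {0..t} f - of_int d * t + c)) = exp (\<i> * complex_of_real (integral {0..t} f))"
      unfolding exp_add[symmetric] by (rule arg_cong[of _ _ exp]) (simp add: algebra_simps)
    then show ?thesis unfolding uext_def s H unfolding C_def by (simp only: mult.assoc)
  qed
  have "AE t in angles. uext (cis t) = \<phi> (cis t)"
    using lift AE_space by eventually_elim (simp add: circle)
  moreover have "integrable angles (\<lambda>t. \<phi> (cis t))"
    using \<phi> by (auto simp: W11_circle_S1_def W11_circle_def has_weak_tangential_def)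
  ultimately have tr: "has_trace uext \<phi>" by (intro has_trace_uext)
  have "slope \<le> 2 * W11_circle_norm \<phi>"
  proof -
    define I where "I = (LINT t|angles. \<bar>f t\<bar>)"
    have I: "I \<ge> 0" by (simp add: I_def)
    \<comment> \<open>The degree is the total phase over \<open>2 * pi\<close>, so it is controlled
      by the L^1 norm of \<open>f\<close> and needs no separate term in \<open>g\<close>.\<close>
    have "\<bar>2 * pi * of_int d\<bar> \<le> I"
    proof -
      have "integral {0..2 * pi} f = (LINT t|angles. f t)"
        by (rule lebesgue_integral_eq_integral[symmetric]) (use f in auto)
      then show ?thesis using integral_norm_bound[of angles f] unfolding d[symmetric] I_def by simp
    qed
    then have "\<bar>of_int d\<bar> \<le> I / (2 * pi)" by (simp add: abs_mult field_simps)
    then have "slope \<le> (I / (2 * pi) + I / pi) * (1 + pi)"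
      unfolding slope_def I_def[symmetric] by (intro mult_right_mono add_mono) auto
    also have "\<dots> = I * (3 / (2 * pi) + 3 / 2)" by (simp add: field_simps)
    \<comment> \<open>From \<open>pi > 3\<close> it follows that \<open>3 / (2 * pi)\<close> is less
      than \<open>1 / 2\<close>.\<close>
    also have "\<dots> \<le> I * 2"
      using pi_gt3 I by (intro mult_left_mono) (auto simp: field_simps)
    finally show ?thesis using fN by (simp add: I_def)
  qed
  then have "W1_weak_norm 2 disk uext \<le> 2 + 2 * W11_circle_norm \<phi>"
    using W1_weak_norm_uext_le by linarith
  then show "\<exists>u\<in>W1_weak_disk_S1 2. has_trace u \<phi> \<and> W1_weak_norm 2 disk u \<le> 2 + 2 * W11_circle_norm \<phi>"
    using uext_in_W1_weak tr by blast
qed simp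

end
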